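(* Suppose that the system $\dot x=y+X(x,y,\delta),\ \dot y=Y(x,y,\delta)$ satisfies, for all $\delta\in D$ and a fixed integer $n\ge 2$, $g(x,\delta)=x^{2n-1}(a_{2n-1}(\delta)+O(x))$ with $a_{2n-1}(\delta)>0$, and $f(x,\delta)=\sum_{j\ge n-1}b_j(\delta)x^j$ with $b_{n-1}^2(\delta)-4n a_{2n-1}(\delta)<0$. Let $P(x_0,\delta)$ be its Poincaré return map. Then there is a unique function $\bar P(x_0,\delta)$, analytic in $x_0$ at $x_0=0$, satisfying $\frac{\partial \bar P}{\partial x_0}(0,\delta)>0$ and having an expansion $$\bar d(x_0,\delta)=\bar P(x_0,\delta)-x_0=\sum_{j\ge 1}v_j(\delta)x_0^j$$ for $|x_0|$ small, such that: (1) if $n$ is odd, then $P(x_0,\delta)=\bar P(x_0,\delta)$ for all $|x_0|$ small; (2) if $n$ is even, then for all $|x_0|$ small, $P(x_0,\delta)=\bar P(x_0,\delta)$ for $x_0>0$ and $P(x_0,\delta)=\bar P^{-1}(x_0,\delta)$ for $x_0<0$, where $\bar P^{-1}$ denotes the inverse of $\bar P$ in $x_0$. Hence, the system has a periodic orbit near the origin if and only if the analytic function $\bar d$ has two zeros in $x_0$ near $x_0=0$, one of which is positive and the other negative.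
   Context: The planar system is $\dot x=y+X(x,y,\delta),\ \dot y=Y(x,y,\delta)$, where $\delta=(\delta_1,\dots,\delta_m)\in D\subset\mathbb{R}^m$, $D$ is compact, $X,Y$ are real analytic, and $X,Y=O(|x,y|^2)$ for $(x,y)$ near the origin and $\delta\in D$. Let $y=F(x,\delta)$ be the solution of $y+X(x,y,\delta)=0$ with $F(0,\delta)=0$, and define $$g(x,\delta)=-Y(x,F(x,\delta),\delta),\qquad f(x,\delta)=-\left[\frac{\partial X}{\partial x}(x,F(x,\delta),\delta)+\frac{\partial Y}{\partial y}(x,F(x,\delta),\delta)\right].$$ Under the assumptions in the claim the origin is a center or a focus for all $\delta\in D$. Poincaré return map: for $\delta\in D$ and $x_0\ne0$ with $|x_0|$ small, let $(x(t,x_0,\delta),y(t,x_0,\delta))$ be the solution of the system with initial condition $(x(0),y(0))=(x_0,F(x_0,\delta))$. There is a unique least positive number $\tau=\tau(x_0,\delta)$ such that $y(\tau,x_0,\delta)=F(x(\tau,x_0,\delta),\delta)$ and $x_0\,x(\tau,x_0,\delta)>0$. Define $P(x_0,\delta)=x(\tau,x_0,\delta)$ for $0<|x_0|<\varepsilon_0$ ($\varepsilon_0$ a small positive constant) and $P(0,\delta)=0$. *)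

theory Defs
  imports "HOL-Analysis.Analysis" "HOL-Library.Landau_Symbols"
begin

text \<open>
  Real analyticity in several variables.  The multi-indices are the maps from the standard
  basis to the naturals; \<open>has_sum\<close> is unconditional (hence absolute) convergence.
\<close>

definition real_analytic_on :: "('a::euclidean_space \<Rightarrow> real) \<Rightarrow> 'a set \<Rightarrow> bool" where
  "real_analytic_on h S \<longleftrightarrow>
     (\<forall>p\<in>S. \<exists>r>0. \<exists>c :: ('a \<Rightarrow> nat) \<Rightarrow> real. \<forall>z\<in>ball p r.
        ((\<lambda>\<alpha>. c \<alpha> * (\<Prod>e\<in>Basis. ((z - p) \<bullet> e) ^ \<alpha> e)) has_sum h z)
          (Basis \<rightarrow>\<^sub>E UNIV))"

type_synonym 'm pfun = "real \<Rightarrow> real \<Rightarrow> real ^ 'm \<Rightarrow> real"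
type_synonym 'm pdom = "(real \<times> real \<times> (real ^ 'm)) set"

text \<open>
  Solutions of the system on a time set \<open>I\<close>.  The functions \<open>X\<close> and \<open>Y\<close> are total
  in HOL, but the system is only considered on the open set \<open>\<Omega>\<close> on which they are analytic.
\<close>

definition is_solution ::
    "'m::finite pfun \<Rightarrow> 'm pfun \<Rightarrow> 'm pdom \<Rightarrow> real ^ 'm \<Rightarrow> (real \<Rightarrow> real \<times> real) \<Rightarrow> real set \<Rightarrow> bool" where
  "is_solution X Y \<Omega> \<delta> z I \<longleftrightarrow>
     (\<forall>t\<in>I. (fst (z t), snd (z t), \<delta>) \<in> \<Omega> \<and>
        (z has_vector_derivative
           (snd (z t) + X (fst (z t)) (snd (z t)) \<delta>, Y (fst (z t)) (snd (z t)) \<delta>)) (at t within I))"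

definition is_periodic_solution ::
    "'m::finite pfun \<Rightarrow> 'm pfun \<Rightarrow> 'm pdom \<Rightarrow> real ^ 'm \<Rightarrow> (real \<Rightarrow> real \<times> real) \<Rightarrow> bool" where
  "is_periodic_solution X Y \<Omega> \<delta> z \<longleftrightarrow>
     is_solution X Y \<Omega> \<delta> z UNIV \<and> (\<exists>T>0. \<forall>t. z (t + T) = z t) \<and> (\<exists>t. z t \<noteq> z 0)"

text \<open>
  \<open>F\<close> is the solution of \<open>y + X(x,y,\<delta>) = 0\<close> with \<open>F(0,\<delta>) = 0\<close>.  Only its values for
  small \<open>x\<close> (uniformly in \<open>\<delta> \<in> D\<close>) matter; continuity selects the branch through the
  origin that the implicit function theorem provides.
\<close>

definition implicit_solution ::
    "'m::finite pfun \<Rightarrow> 'm pdom \<Rightarrow> (real ^ 'm) set \<Rightarrow> (real \<Rightarrow> real ^ 'm \<Rightarrow> real) \<Rightarrow> bool" where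
  "implicit_solution X \<Omega> D F \<longleftrightarrow>
     (\<exists>r>0. continuous_on ({-r<..<r} \<times> D) (\<lambda>(x, \<delta>). F x \<delta>) \<and>
        (\<forall>\<delta>\<in>D. F 0 \<delta> = 0 \<and>
           (\<forall>x\<in>{-r<..<r}. (x, F x \<delta>, \<delta>) \<in> \<Omega> \<and> F x \<delta> + X x (F x \<delta>) \<delta> = 0)))"

definition g_fun ::
    "'m::finite pfun \<Rightarrow> (real \<Rightarrow> real ^ 'm \<Rightarrow> real) \<Rightarrow> real \<Rightarrow> real ^ 'm \<Rightarrow> real" where
  "g_fun Y F x \<delta> = - Y x (F x \<delta>) \<delta>"

definition f_fun ::
    "'m::finite pfun \<Rightarrow> 'm pfun \<Rightarrow> (real \<Rightarrow> real ^ 'm \<Rightarrow> real) \<Rightarrow> real \<Rightarrow> real ^ 'm \<Rightarrow> real" where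
  "f_fun X Y F x \<delta> =
     - (deriv (\<lambda>u. X u (F x \<delta>) \<delta>) x + deriv (\<lambda>v. Y x v \<delta>) (F x \<delta>))"

text \<open>\<open>p\<close> is the abscissa of the first return of the orbit through \<open>(x0, F(x0,\<delta>))\<close> to the
  branch of \<open>y = F(x,\<delta>)\<close> on the same side of the origin.\<close>

definition first_return ::
    "'m::finite pfun \<Rightarrow> 'm pfun \<Rightarrow> 'm pdom \<Rightarrow> (real \<Rightarrow> real ^ 'm \<Rightarrow> real) \<Rightarrow> real ^ 'm \<Rightarrow> real \<Rightarrow> real \<Rightarrow> bool" where
  "first_return X Y \<Omega> F \<delta> x0 p \<longleftrightarrow>
     (\<exists>z \<tau>. 0 < \<tau> \<and> is_solution X Y \<Omega> \<delta> z {0..\<tau>} \<and> z 0 = (x0, F x0 \<delta>) \<and>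
        snd (z \<tau>) = F (fst (z \<tau>)) \<delta> \<and> x0 * fst (z \<tau>) > 0 \<and>
        (\<forall>s. 0 < s \<and> s < \<tau> \<longrightarrow> \<not> (snd (z s) = F (fst (z s)) \<delta> \<and> x0 * fst (z s) > 0)) \<and>
        p = fst (z \<tau>))"

definition return_map ::
    "'m::finite pfun \<Rightarrow> 'm pfun \<Rightarrow> 'm pdom \<Rightarrow> (real \<Rightarrow> real ^ 'm \<Rightarrow> real) \<Rightarrow> real \<Rightarrow> real ^ 'm \<Rightarrow> real" where
  "return_map X Y \<Omega> F x0 \<delta> = (if x0 = 0 then 0 else (THE p. first_return X Y \<Omega> F \<delta> x0 p))"

text \<open>
  The properties characterising \<open>q = Pbar(\<cdot>,\<delta>)\<close>, given \<open>p = P(\<cdot>,\<delta>)\<close>.  ``For \<open>|x0|\<close> small''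
  involves two radii: \<open>q\<close> is given by its power series for \<open>|x| < \<rho>\<close>, and the relations
  between \<open>p\<close> and \<open>q\<close> hold for \<open>|x| < \<epsilon>\<close>.  In the even case the inverse is that of \<open>q\<close>
  restricted to \<open>{-\<rho><..<\<rho>}\<close>, and it is defined for all \<open>|x| < \<epsilon>\<close>.
\<close>

definition analytic_return ::
    "nat \<Rightarrow> (real \<Rightarrow> real) \<Rightarrow> real \<Rightarrow> real \<Rightarrow> (real \<Rightarrow> real) \<Rightarrow> bool" where
  "analytic_return n p \<rho> \<epsilon> q \<longleftrightarrow>
     0 < \<epsilon> \<and> \<epsilon> \<le> \<rho> \<and>
     (\<exists>v :: nat \<Rightarrow> real. \<forall>x\<in>{-\<rho><..<\<rho>}. (\<lambda>j. v (Suc j) * x ^ Suc j) sums (q x - x)) \<and>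
     deriv q 0 > 0 \<and>
     (odd n \<longrightarrow> (\<forall>x\<in>{-\<epsilon><..<\<epsilon>}. p x = q x)) \<and>
     (even n \<longrightarrow>
        inj_on q {-\<rho><..<\<rho>} \<and> {-\<epsilon><..<\<epsilon>} \<subseteq> q ` {-\<rho><..<\<rho>} \<and>
        (\<forall>x\<in>{0<..<\<epsilon>}. p x = q x) \<and>
        (\<forall>x\<in>{-\<epsilon><..<0}. p x = the_inv_into {-\<rho><..<\<rho>} q x))"

end

theory Submission
  imports Defs "HOL-Complex_Analysis.Complex_Analysis"
begin

text \<open>
  Put \<open>x = r cos \<phi>\<close>, \<open>y = F(x) - r\<^sup>n sin \<phi>\<close>.  The conditions on \<open>g\<close>, \<open>f\<close> and the discriminant
  make the orbits the solutions of \<open>dr/d\<phi> = r H(\<phi>, r)\<close>, where \<open>H\<close> is \<open>2\<pi>\<close>-periodic in \<open>\<phi>\<close>, extends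
  holomorphically to small complex \<open>r\<close> and is bounded uniformly in \<open>\<delta> \<in> D\<close>.  Hence
  \<open>Pbar(x) = r(2\<pi>, x)\<close> is analytic.  The time along an orbit satisfies
  \<open>dt/d\<phi> = (cos\<^sup>2 \<phi> + n sin\<^sup>2 \<phi>) / (r\<^bsup>n-1\<^esup> W)\<close> with \<open>W > 0\<close>, so \<open>\<phi>\<close> runs backwards exactly
  if \<open>n\<close> is even and \<open>r < 0\<close>; there the return map is \<open>r(-2\<pi>, x)\<close>, the inverse of \<open>Pbar\<close>.
  On a periodic orbit the extreme values of \<open>x\<close> are taken on \<open>y = F(x)\<close>, and are fixed points of
  \<open>Pbar\<close> of opposite sign.  Conversely, if the closed orbit through a fixed point \<open>x1 > 0\<close> leaves
  \<open>|x| < \<eta>\<close> on the left, then the closed orbit through the fixed point \<open>x2 < 0\<close> lies inside it.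
\<close>

section \<open>Holomorphic families\<close>

text \<open>The linear part is nilpotent, so the angular velocity of ordinary polar coordinates
  degenerates along the x-axis. With \<open>v = y - F(x)\<close> the leading system is
  \<open>x' = v\<close>, \<open>v' = - a x^(2n-1) - b x^(n-1) v\<close>, where \<open>b\<close> is
  the coefficient of index \<open>n - 1\<close>; giving \<open>x\<close> weight 1 and
  \<open>v\<close> weight \<open>n\<close> makes both terms of \<open>v'\<close> of order
  \<open>2n - 1\<close>, hence the exponent \<open>n\<close>. Measuring \<open>y\<close> from
  \<open>F\<close> also turns the section \<open>y = F(x)\<close> into the rays
  \<open>sin \<phi> = 0\<close>. The variable \<open>r\<close> takes both signs, since a power
  series in \<open>x0\<close> needs a full neighbourhood of 0; every point off the origin then has
  two representations, and the parity of \<open>n\<close> decides how they are related. The radii in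
  the conclusion must not depend on \<delta>, although \<open>a\<close> and \<open>b\<close> come
  with no continuity in \<delta>. Therefore \<delta> stays real, only \<open>x\<close> and
  \<open>y\<close> are complexified, and all objects are kept jointly continuous in the parameter
  and the complex variable; compactness of \<open>D\<close> turns pointwise facts into uniform
  bounds.\<close>

definition hol_family ::
    "'p::topological_space set \<Rightarrow> real \<Rightarrow> ('p \<Rightarrow> complex \<Rightarrow> complex) \<Rightarrow> bool" where
  "hol_family P r f \<longleftrightarrow>
     continuous_on (P \<times> ball 0 r) (\<lambda>(p, z). f p z) \<and> (\<forall>p\<in>P. f p holomorphic_on ball 0 r)"

lemma hol_family_cont: "hol_family P r f \<Longrightarrow> continuous_on (P \<times> ball 0 r) (\<lambda>(p, z). f p z)"
  by (simp add: hol_family_def)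

lemma hol_family_hol: "hol_family P r f \<Longrightarrow> p \<in> P \<Longrightarrow> f p holomorphic_on ball 0 r"
  by (simp add: hol_family_def)

lemma hol_family_subset:
  assumes "hol_family P r f" "Q \<subseteq> P" "s \<le> r"
  shows "hol_family Q s f"
proof -
  have "Q \<times> ball 0 s \<subseteq> P \<times> ball (0::complex) r"
    using assms by auto
  moreover have "ball 0 s \<subseteq> ball (0::complex) r"
    using assms by auto
  ultimately show ?thesis
    using assms unfolding hol_family_def
    by (meson continuous_on_subset holomorphic_on_subset subsetD)
qed

text \<open>Every point of the ball lies in a smaller open ball, and continuity is local. It leaves
  space for a circle between the point and the boundary.\<close>

lemma continuous_on_Times_ball_exhaust:
  fixes g :: "'p::topological_space \<times> 'a::metric_space \<Rightarrow> 'b::topological_space"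
  assumes "\<And>s. s < r \<Longrightarrow> continuous_on (P \<times> ball a s) g"
  shows "continuous_on (P \<times> ball a r) g"
  unfolding continuous_on_def
proof
  fix x assume x: "x \<in> P \<times> ball a r"
  then obtain p z where pz: "x = (p, z)" "p \<in> P" "dist a z < r" by auto
  obtain s where s: "dist a z < s" "s < r"
    using dense pz by blast
  have "at x within (P \<times> ball a r) = at x within (P \<times> ball a s)"
    by (rule at_within_nhd[of _ "UNIV \<times> ball a s"]) (use pz s in \<open>auto intro: open_Times\<close>)
  moreover have "(g \<longlongrightarrow> g x) (at x within (P \<times> ball a s))"
    using assms[OF s(2)] pz s by (auto simp: continuous_on_def)
  ultimately show "(g \<longlongrightarrow> g x) (at x within (P \<times> ball a r))"
    by simp
qed

text \<open>Cauchy's formula on a circle of radius \<open>t\<close> writes the derivative as a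
  parameter integral, and such integrals are jointly continuous. The circle has to pass strictly
  between \<open>z\<close> and the boundary, so the claim is proved on every smaller ball
  first.\<close>

lemma hol_family_deriv:
  assumes f: "hol_family P r f"
  shows "hol_family P r (\<lambda>p. deriv (f p))"
  unfolding hol_family_def
proof (intro conjI ballI)
  show "deriv (f p) holomorphic_on ball 0 r" if "p \<in> P" for p
    using hol_family_hol[OF f that] by (rule holomorphic_deriv) simp
  show "continuous_on (P \<times> ball 0 r) (\<lambda>(p, z). deriv (f p) z)"
  proof (rule continuous_on_Times_ball_exhaust)
    fix s assume "s < r"
    then obtain t where t: "s < t" "t < r" using dense by blast
    show "continuous_on (P \<times> ball 0 s) (\<lambda>(p, z). deriv (f p) z)"
    proof (cases "s \<le> 0")
      case True
      then have "P \<times> ball (0::complex) s = {}" by auto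
      then show ?thesis by (metis continuous_on_empty)
    next
      case False
      define I where "I = (\<lambda>(p, z). integral (cbox 0 1) (\<lambda>x::real.
        f p (circlepath 0 t x) / (circlepath 0 t x - z)^2 * vector_derivative (circlepath 0 t) (at x)))"
      have on_c: "norm (circlepath 0 t x) = t" for x
        using False t by (simp add: circlepath norm_mult)
      have "continuous_on ((P \<times> ball 0 s) \<times> cbox 0 1)
        (\<lambda>x. (case fst x of (p, z) \<Rightarrow> f p (circlepath 0 t (snd x))
           / (circlepath 0 t (snd x) - z)^2 * vector_derivative (circlepath 0 t) (at (snd x))))"
      proof -
        have 1: "continuous_on ((P \<times> ball 0 s) \<times> cbox 0 1)
            (\<lambda>x. f (fst (fst x)) (circlepath 0 t (snd x)))"
        proof -
          have "continuous_on ((P \<times> ball 0 s) \<times> cbox 0 1)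
            (\<lambda>x. (\<lambda>(p, z). f p z) (fst (fst x), circlepath 0 t (snd x)))"
          proof (rule continuous_on_compose2[OF hol_family_cont[OF f]])
            show "continuous_on ((P \<times> ball 0 s) \<times> cbox (0::real) 1)
              (\<lambda>x. (fst (fst x), circlepath 0 t (snd x)))"
              unfolding circlepath by (intro continuous_intros)
          qed (use on_c t in auto)
          then show ?thesis by simp
        qed
        have 2: "circlepath 0 t (snd x) - snd (fst x) \<noteq> 0"
          if "x \<in> (P \<times> ball 0 s) \<times> cbox 0 1" for x
          using that on_c[of "snd x"] t by auto
        show ?thesis
          unfolding split_beta vector_derivative_circlepath
          by (intro continuous_intros 1)
            (use 2 in \<open>auto simp: circlepath intro!: continuous_intros\<close>)
      qed
      then have "continuous_on (P \<times> ball 0 s) (\<lambda>x. integral (cbox 0 1) (\<lambda>u.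
        (case x of (p, z) \<Rightarrow> f p (circlepath 0 t u)
           / (circlepath 0 t u - z)^2 * vector_derivative (circlepath 0 t) (at u))))"
        by (intro integral_continuous_on_param) (simp add: split_beta)
      then have "continuous_on (P \<times> ball 0 s) I"
        by (simp add: I_def split_beta)
      then have "continuous_on (P \<times> ball 0 s) (\<lambda>x. 1 / (2 * of_real pi * \<i>) * I x)"
        by (intro continuous_intros)
      moreover have "(\<lambda>(p, z). deriv (f p) z) x = 1 / (2 * of_real pi * \<i>) * I x"
        if x: "x \<in> P \<times> ball 0 s" for x
      proof -
        obtain p z where pz: "x = (p, z)" "p \<in> P" "z \<in> ball 0 s" using x by auto
        have h: "f p holomorphic_on cball 0 t"
          by (rule holomorphic_on_subset[OF hol_family_hol[OF f pz(2)]]) (use t in auto)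
        have "(f p has_field_derivative (1 / (2 * of_real pi * \<i>) *
           contour_integral(circlepath 0 t) (\<lambda>u. f p u / (u-z)^2))) (at z)"
          by (rule Cauchy_derivative_integral_circlepath)
            (use h t pz holomorphic_on_imp_continuous_on holomorphic_on_subset[OF h] in auto)
        then show ?thesis
          by (simp add: pz DERIV_imp_deriv I_def contour_integral_integral)
      qed
      ultimately show ?thesis
        by (simp cong: continuous_on_cong)
    qed
  qed
qed

text \<open>Removing the singularity for each \<open>p\<close> gives holomorphy but no continuity in
  \<open>p\<close> at \<open>z = 0\<close>. The integral of \<open>deriv (f p) (t * z)\<close> over
  \<open>t\<close> in \<open>[0, 1]\<close> equals \<open>f p z / z\<close> off 0 and
  \<open>deriv (f p) 0\<close> at 0, and it is jointly continuous by its form.\<close>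

lemma hol_family_divide_id:
  assumes f: "hol_family P r f" and 0: "\<And>p. p \<in> P \<Longrightarrow> f p 0 = 0"
  shows "hol_family P r (\<lambda>p z. if z = 0 then deriv (f p) 0 else f p z / z)"
  unfolding hol_family_def
proof (intro conjI ballI)
  fix p assume p: "p \<in> P"
  show "(\<lambda>z. if z = 0 then deriv (f p) 0 else f p z / z) holomorphic_on ball 0 r"
    by (rule pole_theorem_open_0[OF hol_family_hol[OF f p], where a = 0]) (use 0 p in auto)
next
  define J where "J = (\<lambda>(p, z). integral (cbox 0 1) (\<lambda>t::real. deriv (f p) (of_real t * z)))"
  have "continuous_on ((P \<times> ball 0 r) \<times> cbox 0 1)
      (\<lambda>x. (\<lambda>(p, z). deriv (f p) z) (fst (fst x), of_real (snd x) * snd (fst x)))"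
  proof (rule continuous_on_compose2[OF hol_family_cont[OF hol_family_deriv[OF f]]])
    show "continuous_on ((P \<times> ball (0::complex) r) \<times> cbox (0::real) 1)
      (\<lambda>x. (fst (fst x), of_real (snd x) * snd (fst x)))"
      by (intro continuous_intros)
    show "(\<lambda>x. (fst (fst x), of_real (snd x) * snd (fst x))) ` ((P \<times> ball (0::complex) r) \<times> cbox (0::real) 1)
      \<subseteq> P \<times> ball 0 r"
      by (auto simp: norm_mult) (smt (verit) mult_left_le_one_le norm_ge_zero)
  qed
  then have "continuous_on (P \<times> ball 0 r) J"
    unfolding J_def split_beta
    by (intro integral_continuous_on_param) (simp add: split_beta)
  moreover have "J x = (\<lambda>(p, z). if z = 0 then deriv (f p) 0 else f p z / z) x"
    if x: "x \<in> P \<times> ball 0 r" for x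
  proof -
    obtain p z where pz: "x = (p, z)" "p \<in> P" "z \<in> ball 0 r" using x by auto
    show ?thesis
    proof (cases "z = 0")
      case True
      then show ?thesis by (simp add: pz J_def)
    next
      case False
      have d: "((\<lambda>t::real. f p (of_real t * z) / z) has_vector_derivative deriv (f p) (of_real t * z))
            (at t within {0..1})" if t: "t \<in> {0..1}" for t
      proof -
        have "of_real t * z \<in> ball 0 r"
          using pz t by (auto simp: norm_mult intro: le_less_trans[OF mult_left_le_one_le])
        then have "(f p has_field_derivative deriv (f p) (of_real t * z)) (at (of_real t * z))"
          by (rule holomorphic_derivI[OF hol_family_hol[OF f pz(2)] open_ball])
        moreover have "((\<lambda>w. w * z) has_field_derivative z) (at (complex_of_real t))"
          by (auto intro!: derivative_eq_intros)
        ultimately have "((\<lambda>w. f p (w * z)) has_field_derivative deriv (f p) (of_real t * z) * z)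
            (at (complex_of_real t))"
          by (rule DERIV_chain2)
        then have "((\<lambda>w. f p (w * z) / z) has_field_derivative deriv (f p) (of_real t * z))
            (at (complex_of_real t))"
          using False by (auto intro!: derivative_eq_intros)
        then show ?thesis
          using has_vector_derivative_real_field[of "\<lambda>w. f p (w * z) / z"] by simp
      qed
      have "((\<lambda>t::real. deriv (f p) (of_real t * z)) has_integral
          (f p (of_real 1 * z) / z - f p (of_real 0 * z) / z)) {0..1}"
        by (rule fundamental_theorem_of_calculus) (use d in auto)
      then show ?thesis
        using False 0 pz by (simp add: J_def integral_unique)
    qed
  qed
  ultimately show "continuous_on (P \<times> ball 0 r)
      (\<lambda>(p, z). if z = 0 then deriv (f p) 0 else f p z / z)"
    by (simp cong: continuous_on_cong)
qed

text \<open>As long as \<open>m > 0\<close>, existence of the limit forces \<open>f p 0 = 0\<close>,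
  so one factor \<open>z\<close> is split off at a time. The limit \<open>l p\<close> is assumed for
  each \<open>p\<close> separately, and its continuity in \<open>p\<close> is part of the result;
  this is how the leading coefficients come to depend continuously on \<delta>.\<close>

lemma hol_family_divide_power:
  assumes "hol_family P r f" "0 < r"
    and "\<And>p. p \<in> P \<Longrightarrow> ((\<lambda>x. f p (of_real x) / of_real x ^ m) \<longlongrightarrow> l p) (at_right 0)"
  shows "\<exists>f1. hol_family P r f1 \<and> (\<forall>p\<in>P. f1 p 0 = l p \<and> (\<forall>z\<in>ball 0 r. f p z = z ^ m * f1 p z))"
  using assms
proof (induction m arbitrary: f)
  case 0
  have "f p 0 = l p" if p: "p \<in> P" for p
  proof -
    have "continuous (at 0) (f p)"
      using hol_family_hol[OF 0(1) p] \<open>0 < r\<close>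
      by (meson at_within_ball centre_in_ball continuous_on_eq_continuous_at holomorphic_on_imp_continuous_on open_ball)
    then have "(f p \<longlongrightarrow> f p 0) (nhds 0)"
      by (simp add: isCont_def tendsto_at_iff_tendsto_nhds)
    moreover have "filterlim complex_of_real (nhds 0) (at_right 0)"
      by (auto intro!: tendsto_eq_intros)
    ultimately have "((\<lambda>x. f p (of_real x)) \<longlongrightarrow> f p 0) (at_right 0)"
      by (rule filterlim_compose)
    then show ?thesis
      using 0(3)[OF p] by (auto intro: tendsto_unique[rotated])
  qed
  then show ?case
    using 0(1) by auto
next
  case (Suc m)
  have z: "f p 0 = 0" if p: "p \<in> P" for p
  proof -
    have "continuous (at 0) (f p)"
      using hol_family_hol[OF Suc(2) p] \<open>0 < r\<close>
      by (meson at_within_ball centre_in_ball continuous_on_eq_continuous_at holomorphic_on_imp_continuous_on open_ball)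
    then have "(f p \<longlongrightarrow> f p 0) (nhds 0)"
      by (simp add: isCont_def tendsto_at_iff_tendsto_nhds)
    moreover have lim: "filterlim complex_of_real (nhds 0) (at_right 0)"
      by (auto intro!: tendsto_eq_intros)
    ultimately have 1: "((\<lambda>x. f p (of_real x)) \<longlongrightarrow> f p 0) (at_right 0)"
      by (rule filterlim_compose)
    have "((\<lambda>x. f p (of_real x) / of_real x ^ Suc m * of_real x ^ Suc m) \<longlongrightarrow> l p * 0 ^ Suc m) (at_right 0)"
      by (intro tendsto_intros Suc.prems p lim)
    moreover have "\<forall>\<^sub>F x in at_right 0. f p (of_real x) / of_real x ^ Suc m * of_real x ^ Suc m = f p (of_real x)"
      by (rule eventually_at_rightI[of 0 1]) auto
    ultimately have 2: "((\<lambda>x. f p (of_real x)) \<longlongrightarrow> l p * 0 ^ Suc m) (at_right 0)"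
      by (rule Lim_transform_eventually)
    show ?thesis
      using tendsto_unique[OF _ 1 2] by simp
  qed
  let ?g = "\<lambda>p z. if z = 0 then deriv (f p) 0 else f p z / z"
  have g: "hol_family P r ?g"
    using hol_family_divide_id[OF Suc.prems(1) z] .
  have "((\<lambda>x. ?g p (of_real x) / of_real x ^ m) \<longlongrightarrow> l p) (at_right 0)" if p: "p \<in> P" for p
    by (rule Lim_transform_eventually[OF Suc.prems(3)[OF p]])
      (rule eventually_at_rightI[of 0 1], auto)
  from Suc.IH[OF g \<open>0 < r\<close> this] obtain f1 where f1: "hol_family P r f1"
    "\<forall>p\<in>P. f1 p 0 = l p \<and> (\<forall>z\<in>ball 0 r. ?g p z = z ^ m * f1 p z)" by blast
  have "f p z = z ^ Suc m * f1 p z" if "p \<in> P" "z \<in> ball 0 r" for p z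
  proof (cases "z = 0")
    case True
    then show ?thesis using z that by simp
  next
    case False
    then have "f p z / z = z ^ m * f1 p z"
      using f1(2) that by metis
    then show ?thesis
      using False by (simp add: field_simps)
  qed
  then show ?case
    using f1 by blast
qed

lemma hol_family_bounded:
  assumes "hol_family P r f" "compact P" "s < r"
  obtains B where "0 < B" "\<And>p z. p \<in> P \<Longrightarrow> norm z \<le> s \<Longrightarrow> norm (f p z) \<le> B"
proof -
  have "continuous_on (P \<times> cball 0 s) (\<lambda>(p, z). f p z)"
    by (rule continuous_on_subset[OF hol_family_cont[OF assms(1)]]) (use assms in auto)
  then have "compact ((\<lambda>(p, z). f p z) ` (P \<times> cball 0 s))"
    using assms by (intro compact_continuous_image compact_Times) auto
  then obtain B where "B > 0" "\<forall>y \<in> (\<lambda>(p, z). f p z) ` (P \<times> cball 0 s). norm y \<le> B"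
    using compact_imp_bounded bounded_pos by blast
  then show ?thesis
    using that by force
qed

lemma hol_family_Lipschitz:
  assumes "hol_family P r f" "compact P" "s < r"
  obtains L where "0 < L"
    "\<And>p z w. p \<in> P \<Longrightarrow> norm z \<le> s \<Longrightarrow> norm w \<le> s \<Longrightarrow> norm (f p z - f p w) \<le> L * norm (z - w)"
proof -
  obtain L where L: "0 < L" "\<And>p z. p \<in> P \<Longrightarrow> norm z \<le> s \<Longrightarrow> norm (deriv (f p) z) \<le> L"
    using hol_family_bounded[OF hol_family_deriv[OF assms(1)] assms(2,3)] by blast
  show ?thesis
  proof (rule that[OF L(1)])
    fix p and z w :: complex assume h: "p \<in> P" "norm z \<le> s" "norm w \<le> s"
    show "norm (f p z - f p w) \<le> L * norm (z - w)"
    proof (rule field_differentiable_bound[of "cball 0 s"])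
      fix u :: complex assume "u \<in> cball 0 s"
      then show "(f p has_field_derivative deriv (f p) u) (at u within cball 0 s)"
        using holomorphic_derivI[OF hol_family_hol[OF assms(1) h(1)] open_ball] assms(3)
        by (meson DERIV_subset mem_ball_0 mem_cball_0 le_less_trans has_field_derivative_at_within)
    qed (use h L in auto)
  qed
qed

section \<open>Complexification of real analytic functions\<close>

lemma continuous_on_local:
  assumes "\<And>x. x \<in> S \<Longrightarrow> \<exists>T. open T \<and> x \<in> T \<and> continuous_on (S \<inter> T) f"
  shows "continuous_on S f"
  unfolding continuous_on_def
proof
  fix x assume x: "x \<in> S"
  then obtain T where T: "open T" "x \<in> T" "continuous_on (S \<inter> T) f"
    using assms by blast
  have "at x within S = at x within (S \<inter> T)"
    by (rule at_within_nhd[OF T(2,1)]) auto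
  then show "(f \<longlongrightarrow> f x) (at x within S)"
    using T x by (simp add: continuous_on_def)
qed

lemma holomorphic_on_local:
  assumes "\<And>z. z \<in> S \<Longrightarrow> \<exists>d>0. f holomorphic_on ball z d"
  shows "f holomorphic_on S"
  unfolding holomorphic_on_def
proof
  fix z assume "z \<in> S"
  then obtain d where "d > 0" "f holomorphic_on ball z d" using assms by blast
  then have "f field_differentiable (at z)"
    by (intro holomorphic_on_imp_differentiable_at[of _ "ball z d"]) auto
  then show "f field_differentiable (at z within S)"
    by (rule field_differentiable_at_within)
qed

text \<open>Holomorphy in two variables, expressed by what is used of it: holomorphic curves put in
  for both arguments give a holomorphic function. Constant curves recover holomorphy in each
  variable, and \<open>r \<mapsto> (r cos \<phi>, F + v)\<close> is the curve needed later.\<close>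

definition bihol :: "real \<Rightarrow> (complex \<Rightarrow> complex \<Rightarrow> complex) \<Rightarrow> bool" where
  "bihol r f \<longleftrightarrow> (\<forall>S u v. open S \<longrightarrow> u holomorphic_on S \<longrightarrow> v holomorphic_on S \<longrightarrow>
     u ` S \<subseteq> ball 0 r \<longrightarrow> v ` S \<subseteq> ball 0 r \<longrightarrow> (\<lambda>z. f (u z) (v z)) holomorphic_on S)"

lemma biholD:
  assumes "bihol r f" "open S" "u holomorphic_on S" "v holomorphic_on S"
    "\<And>z. z \<in> S \<Longrightarrow> norm (u z) < r" "\<And>z. z \<in> S \<Longrightarrow> norm (v z) < r"
  shows "(\<lambda>z. f (u z) (v z)) holomorphic_on S"
proof -
  have "u ` S \<subseteq> ball 0 r" "v ` S \<subseteq> ball 0 r" using assms by auto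
  then show ?thesis using assms unfolding bihol_def by blast
qed

lemma bihol_mono: "bihol r f \<Longrightarrow> s \<le> r \<Longrightarrow> bihol s f"
  unfolding bihol_def by (meson subset_ball subset_trans)

lemma holomorphic_eq_on_reals:
  assumes "f holomorphic_on ball 0 r" "g holomorphic_on ball 0 r"
    and "\<And>x::real. \<bar>x\<bar> < r \<Longrightarrow> f (of_real x) = g (of_real x)" and z: "z \<in> ball 0 r"
  shows "f z = g z"
proof -
  have r: "0 < r" using z by (metis ball_eq_empty empty_iff not_le)
  have "f z - g z = 0"
  proof (rule analytic_continuation[of "\<lambda>z. f z - g z" "ball 0 r" "of_real ` {-r<..<r}" 0])
    show "(0::complex) islimpt of_real ` {-r<..<r}"
      unfolding islimpt_approachable
    proof (intro allI impI)
      fix e :: real assume "e > 0"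
      with r show "\<exists>x'\<in>of_real ` {-r<..<r}. x' \<noteq> 0 \<and> dist x' (0::complex) < e"
        by (intro bexI[of _ "of_real (min e r / 2)"] imageI) auto
    qed
  qed (use assms r in \<open>auto intro!: holomorphic_intros\<close>)
  then show ?thesis by simp
qed

text \<open>The identity theorem is applied twice: for real \<open>x\<close> it extends the equality
  to complex second arguments, and for fixed complex \<open>w\<close> it then extends the first one.
  It makes complex extensions built from different power series coincide.\<close>

lemma bihol_eq_on_reals:
  assumes f: "bihol r f" and g: "bihol r g"
    and eq: "\<And>x y::real. \<bar>x\<bar> < r \<Longrightarrow> \<bar>y\<bar> < r \<Longrightarrow> f (of_real x) (of_real y) = g (of_real x) (of_real y)"
    and z: "z \<in> ball 0 r" and w: "w \<in> ball 0 r"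
  shows "f z w = g z w"
proof -
  have 1: "f (of_real x) w = g (of_real x) w" if "\<bar>x\<bar> < r" for x
    by (rule holomorphic_eq_on_reals[OF _ _ _ w])
      (use that eq in \<open>auto intro!: biholD[OF f] biholD[OF g] holomorphic_intros\<close>)
  show ?thesis
    by (rule holomorphic_eq_on_reals[OF _ _ _ z, of "\<lambda>z. f z w" "\<lambda>z. g z w"])
      (use w 1 in \<open>auto intro!: biholD[OF f] biholD[OF g] holomorphic_intros\<close>)
qed

lemma prod_Basis_prod:
  "(\<Prod>e\<in>(Basis::('a::euclidean_space \<times> 'b::euclidean_space) set). g e) =
   (\<Prod>e\<in>Basis. g (e, 0)) * (\<Prod>e\<in>Basis. g (0, e))"
proof -
  have 1: "inj_on (\<lambda>u::'a. (u, 0::'b)) Basis" "inj_on (\<lambda>v::'b. (0::'a, v)) Basis"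
    by (auto simp: inj_on_def)
  have "(\<lambda>u::'a. (u, 0::'b)) ` Basis \<inter> (\<lambda>v::'b. (0::'a, v)) ` Basis = {}"
    by auto
  then show ?thesis
    by (simp add: Basis_prod_def prod.union_disjoint prod.reindex 1)
qed

text \<open>At the point whose coordinates relative to the centre all equal \<open>s\<close> the
  series converges absolutely, which gives a Weierstrass majorant \<open>M\<close> for all complex
  \<open>x\<close>, \<open>y\<close> of modulus below \<open>s\<close> and real \<delta> near
  \<open>\<delta>0\<close>. Uniform convergence carries holomorphy and continuity from the finite
  partial sums to \<open>K\<close>.\<close>

lemma real_analytic_chart:
  fixes h :: "real \<Rightarrow> real \<Rightarrow> 'd::euclidean_space \<Rightarrow> real"
  assumes "real_analytic_on (\<lambda>(x, y, \<delta>). h x y \<delta>) \<Omega>" "open \<Omega>" "(0, 0, \<delta>0) \<in> \<Omega>"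
  shows "\<exists>s>0. \<exists>K. (\<forall>\<delta>\<in>ball \<delta>0 s. bihol s (\<lambda>x y. K x y \<delta>) \<and>
            (\<forall>x y. \<bar>x\<bar> < s \<longrightarrow> \<bar>y\<bar> < s \<longrightarrow> (x, y, \<delta>) \<in> \<Omega> \<and>
               K (of_real x) (of_real y) \<delta> = complex_of_real (h x y \<delta>))) \<and>
          continuous_on (ball 0 s \<times> ball 0 s \<times> ball \<delta>0 s) (\<lambda>(x, y, \<delta>). K x y \<delta>)"
proof -
  obtain r c where r: "r > 0" and c: "\<forall>z\<in>ball (0, 0, \<delta>0) r.
     ((\<lambda>\<alpha>. c \<alpha> * (\<Prod>e\<in>Basis. ((z - (0, 0, \<delta>0)) \<bullet> e) ^ \<alpha> e)) has_sum (\<lambda>(x, y, \<delta>). h x y \<delta>) z)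
          (Basis \<rightarrow>\<^sub>E UNIV)"
    using assms(1,3) unfolding real_analytic_on_def by blast
  obtain r' where r': "r' > 0" "ball (0, 0, \<delta>0) r' \<subseteq> \<Omega>"
    using assms(2,3) open_contains_ball by blast
  define o3 where "o3 = (\<Sum>e\<in>(Basis::(real \<times> real \<times> 'd) set). e)"
  \<comment> \<open>The denominator serves two needs: if \<open>x\<close>, \<open>y\<close> and
    \<open>\<delta> - \<delta>0\<close> have norm below \<open>s\<close>, the triple has norm below
    \<open>3 * s\<close>; and the point \<open>s *\<^sub>R o3\<close> must lie in the ball of
    convergence.\<close>
  define s where "s = min r r' / (4 + norm o3)"
  have n3: "4 + norm o3 > 0" by (smt (verit) norm_ge_zero)
  then have s: "s > 0" using r r' by (simp add: s_def)
  have s4: "s * (4 + norm o3) = min r r'" using n3 by (simp add: s_def)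
  have s3: "3 * s < min r r'" "s * norm o3 < min r r'"
    using s s4 mult_nonneg_nonneg[OF less_imp_le[OF s] norm_ge_zero[of o3]]
    unfolding distrib_left by linarith+
  have inb: "(x, y, \<delta>) \<in> ball (0, 0, \<delta>0) (min r r')" if "\<bar>x\<bar> < s" "\<bar>y\<bar> < s" "\<delta> \<in> ball \<delta>0 s" for x y \<delta>
  proof -
    have "dist (0, 0, \<delta>0) (x, y, \<delta>) = norm (x, y, \<delta> - \<delta>0)"
      unfolding dist_commute[of "(0,0,\<delta>0)"] by (simp add: dist_norm)
    also have "\<dots> \<le> norm x + norm (y, \<delta> - \<delta>0)"
      by (rule norm_Pair_le)
    also have "\<dots> \<le> norm x + (norm y + norm (\<delta> - \<delta>0))"
      using norm_Pair_le[of y "\<delta> - \<delta>0"] by simp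
    also have "\<dots> < 3 * s"
      using that by (auto simp: dist_norm norm_minus_commute)
    finally show ?thesis using s3 by simp
  qed
  define M where "M = (\<lambda>\<alpha>. \<bar>c \<alpha>\<bar> * (\<Prod>e\<in>(Basis::(real \<times> real \<times> 'd) set). s ^ \<alpha> e))"
  have Ms: "M summable_on (Basis \<rightarrow>\<^sub>E UNIV)"
  proof -
    let ?z = "(0, 0, \<delta>0) + s *\<^sub>R o3"
    have "?z \<in> ball (0, 0, \<delta>0) r"
      using s3 s by (simp add: dist_norm)
    with c have "(\<lambda>\<alpha>. c \<alpha> * (\<Prod>e\<in>Basis. ((?z - (0, 0, \<delta>0)) \<bullet> e) ^ \<alpha> e)) summable_on (Basis \<rightarrow>\<^sub>E UNIV)"
      using has_sum_imp_summable by blast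
    moreover have "o3 \<bullet> e = 1" if "e \<in> Basis" for e
      using that by (simp add: o3_def inner_sum_left_Basis)
    ultimately have "(\<lambda>\<alpha>. c \<alpha> * (\<Prod>e\<in>(Basis::(real \<times> real \<times> 'd) set). s ^ \<alpha> e)) summable_on (Basis \<rightarrow>\<^sub>E UNIV)"
      by (simp cong: prod.cong)
    then have "(\<lambda>\<alpha>. norm (c \<alpha> * (\<Prod>e\<in>(Basis::(real \<times> real \<times> 'd) set). s ^ \<alpha> e))) summable_on (Basis \<rightarrow>\<^sub>E UNIV)"
      by (rule summable_on_iff_abs_summable_on_real[THEN iffD1])
    then show ?thesis
      using s by (simp add: M_def abs_mult prod_nonneg)
  qed
  define T where "T = (\<lambda>\<alpha> x y \<delta>. complex_of_real (c \<alpha>) * (x ^ \<alpha> (1, 0, 0) * (y ^ \<alpha> (0, 1, 0) *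
      of_real (\<Prod>e\<in>Basis. ((\<delta> - \<delta>0) \<bullet> e) ^ \<alpha> (0, 0, e)))))"
  define K where "K = (\<lambda>x y \<delta>. \<Sum>\<^sub>\<infinity>\<alpha>\<in>(Basis \<rightarrow>\<^sub>E UNIV). T \<alpha> x y \<delta>)"
  have TM: "norm (T \<alpha> x y \<delta>) \<le> M \<alpha>" if "norm x < s" "norm y < s" "\<delta> \<in> ball \<delta>0 s" for \<alpha> x y \<delta>
  proof -
    have e: "\<bar>(\<delta> - \<delta>0) \<bullet> e\<bar> \<le> s" if "e \<in> Basis" for e
      using Basis_le_norm[OF that, of "\<delta> - \<delta>0"] \<open>\<delta> \<in> ball \<delta>0 s\<close>
      by (auto simp: dist_norm norm_minus_commute)
    have "norm (T \<alpha> x y \<delta>) = \<bar>c \<alpha>\<bar> * (norm x ^ \<alpha> (1, 0, 0) * (norm y ^ \<alpha> (0, 1, 0) *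
       (\<Prod>e\<in>Basis. \<bar>(\<delta> - \<delta>0) \<bullet> e\<bar> ^ \<alpha> (0, 0, e))))"
      by (simp add: T_def norm_mult norm_power abs_prod power_abs flip: of_real_prod)
    also have "\<dots> \<le> \<bar>c \<alpha>\<bar> * (s ^ \<alpha> (1, 0, 0) * (s ^ \<alpha> (0, 1, 0) * (\<Prod>e\<in>(Basis::'d set). s ^ \<alpha> (0, 0, e))))"
      using that s e
      by (intro mult_left_mono mult_mono power_mono prod_mono mult_nonneg_nonneg prod_nonneg conjI) auto
    also have "\<dots> = M \<alpha>"
      by (simp add: M_def prod_Basis_prod zero_prod_def)
    finally show ?thesis .
  qed
  have Kbihol: "bihol s (\<lambda>x y. K x y \<delta>)" if \<delta>: "\<delta> \<in> ball \<delta>0 s" for \<delta>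
    unfolding bihol_def
  proof (intro allI impI)
    fix S u v assume S: "open S" "u holomorphic_on S" "v holomorphic_on S"
      "u ` S \<subseteq> ball 0 s" "v ` S \<subseteq> ball 0 s"
    show "(\<lambda>z. K (u z) (v z) \<delta>) holomorphic_on S"
    proof (rule holomorphic_on_local)
      fix z0 assume "z0 \<in> S"
      then obtain d where d: "d > 0" "cball z0 d \<subseteq> S"
        using S(1) open_contains_cball by blast
      have UL: "uniform_limit (cball z0 d) (\<lambda>A z. \<Sum>\<alpha>\<in>A. T \<alpha> (u z) (v z) \<delta>) (\<lambda>z. K (u z) (v z) \<delta>)
          (finite_subsets_at_top (Basis \<rightarrow>\<^sub>E UNIV))"
        unfolding K_def
      proof (rule Weierstrass_m_test_general[OF TM Ms])
        fix z assume "z \<in> cball z0 d"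
        then have "z \<in> S" using d by blast
        then show "norm (u z) < s" "norm (v z) < s"
          using S by (auto simp: image_subset_iff)
      qed (rule \<delta>)
      have "(\<lambda>z. \<Sum>\<alpha>\<in>A. T \<alpha> (u z) (v z) \<delta>) holomorphic_on S" for A
        unfolding T_def by (intro holomorphic_intros S)
      then have "(\<lambda>z. \<Sum>\<alpha>\<in>A. T \<alpha> (u z) (v z) \<delta>) holomorphic_on cball z0 d" for A
        using d holomorphic_on_subset by blast
      then have EV: "\<forall>\<^sub>F A in finite_subsets_at_top (Basis \<rightarrow>\<^sub>E UNIV).
         continuous_on (cball z0 d) (\<lambda>z. \<Sum>\<alpha>\<in>A. T \<alpha> (u z) (v z) \<delta>) \<and>
         (\<lambda>z. \<Sum>\<alpha>\<in>A. T \<alpha> (u z) (v z) \<delta>) holomorphic_on ball z0 d"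
        using holomorphic_on_imp_continuous_on holomorphic_on_subset[OF _ ball_subset_cball]
        by (simp add: always_eventually)
      have "(\<lambda>z. K (u z) (v z) \<delta>) holomorphic_on ball z0 d"
        using holomorphic_uniform_limit[OF EV UL finite_subsets_at_top_neq_bot] by blast
      then show "\<exists>d>0. (\<lambda>z. K (u z) (v z) \<delta>) holomorphic_on ball z0 d"
        using d by blast
    qed
  qed
  have Kcont: "continuous_on (ball 0 s \<times> ball 0 s \<times> ball \<delta>0 s) (\<lambda>(x, y, \<delta>). K x y \<delta>)"
  proof (rule uniform_limit_theorem)
    show "uniform_limit (ball 0 s \<times> ball 0 s \<times> ball \<delta>0 s)
       (\<lambda>A p. \<Sum>\<alpha>\<in>A. (\<lambda>(x, y, \<delta>). T \<alpha> x y \<delta>) p) (\<lambda>(x, y, \<delta>). K x y \<delta>) (finite_subsets_at_top (Basis \<rightarrow>\<^sub>E UNIV))"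
      unfolding K_def case_prod_unfold
    proof (rule Weierstrass_m_test_general[OF _ Ms])
      fix \<alpha> and p :: "complex \<times> complex \<times> 'd" assume "p \<in> ball 0 s \<times> ball 0 s \<times> ball \<delta>0 s"
      then show "norm (T \<alpha> (fst p) (fst (snd p)) (snd (snd p))) \<le> M \<alpha>"
        by (intro TM) (simp_all add: mem_Times_iff)
    qed
    show "\<forall>\<^sub>F A in finite_subsets_at_top (Basis \<rightarrow>\<^sub>E UNIV).
      continuous_on (ball 0 s \<times> ball 0 s \<times> ball \<delta>0 s) (\<lambda>p. \<Sum>\<alpha>\<in>A. (\<lambda>(x, y, \<delta>). T \<alpha> x y \<delta>) p)"
      unfolding T_def case_prod_unfold by (intro always_eventually allI continuous_intros)
  qed auto
  have Kreal: "K (of_real x) (of_real y) \<delta> = of_real (h x y \<delta>)"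
    if "\<bar>x\<bar> < s" "\<bar>y\<bar> < s" "\<delta> \<in> ball \<delta>0 s" for x y \<delta>
  proof -
    have "(x, y, \<delta>) \<in> ball (0, 0, \<delta>0) r" using inb[OF that] by auto
    from c[rule_format, OF this]
    have "((\<lambda>\<alpha>. c \<alpha> * (x ^ \<alpha> (1, 0, 0) * (y ^ \<alpha> (0, 1, 0) *
        (\<Prod>e\<in>Basis. ((\<delta> - \<delta>0) \<bullet> e) ^ \<alpha> (0, 0, e))))) has_sum h x y \<delta>) (Basis \<rightarrow>\<^sub>E UNIV)"
      by (simp add: prod_Basis_prod zero_prod_def)
    from has_sum_bounded_linear[OF bounded_linear_of_real[where 'a=complex] this]
    have "((\<lambda>\<alpha>. T \<alpha> (of_real x) (of_real y) \<delta>) has_sum of_real (h x y \<delta>)) (Basis \<rightarrow>\<^sub>E UNIV)"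
      by (simp add: T_def)
    then show ?thesis
      unfolding K_def by (rule infsumI)
  qed
  show ?thesis
    using s Kbihol Kcont Kreal inb r' by (intro exI[of _ s] conjI exI[of _ K]) auto
qed

text \<open>Finitely many charts cover the compact \<open>D\<close>, and the smallest of their radii
  works for all. Which chart is used for a given \<delta> is an arbitrary choice; continuity in
  \<delta> survives, because any two charts around \<delta> have the same complex extension by
  \<open>bihol_eq_on_reals\<close>.\<close>

lemma real_analytic_complexify:
  fixes h :: "real \<Rightarrow> real \<Rightarrow> 'd::euclidean_space \<Rightarrow> real"
  assumes an: "real_analytic_on (\<lambda>(x, y, \<delta>). h x y \<delta>) \<Omega>" "open \<Omega>"
    and D: "compact D" "\<And>\<delta>. \<delta> \<in> D \<Longrightarrow> (0, 0, \<delta>) \<in> \<Omega>"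
  obtains \<rho> H where "0 < \<rho>"
    "\<And>\<delta>. \<delta> \<in> D \<Longrightarrow> bihol \<rho> (\<lambda>x y. H x y \<delta>)"
    "\<And>\<delta> x y. \<delta> \<in> D \<Longrightarrow> \<bar>x\<bar> < \<rho> \<Longrightarrow> \<bar>y\<bar> < \<rho> \<Longrightarrow> (x, y, \<delta>) \<in> \<Omega>"
    "\<And>\<delta> x y. \<delta> \<in> D \<Longrightarrow> \<bar>x\<bar> < \<rho> \<Longrightarrow> \<bar>y\<bar> < \<rho> \<Longrightarrow>
       H (of_real x) (of_real y) \<delta> = complex_of_real (h x y \<delta>)"
    "continuous_on (ball 0 \<rho> \<times> ball 0 \<rho> \<times> D) (\<lambda>(x, y, \<delta>). H x y \<delta>)"
proof (cases "D = {}")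
  case True
  then show ?thesis using that[of 1] by auto
next
  case False
  obtain s K where sK: "\<And>\<delta>0. \<delta>0 \<in> D \<Longrightarrow> s \<delta>0 > 0 \<and>
         (\<forall>\<delta>\<in>ball \<delta>0 (s \<delta>0). bihol (s \<delta>0) (\<lambda>x y. K \<delta>0 x y \<delta>) \<and>
            (\<forall>x y. \<bar>x\<bar> < s \<delta>0 \<longrightarrow> \<bar>y\<bar> < s \<delta>0 \<longrightarrow> (x, y, \<delta>) \<in> \<Omega> \<and>
               K \<delta>0 (of_real x) (of_real y) \<delta> = complex_of_real (h x y \<delta>))) \<and>
          continuous_on (ball 0 (s \<delta>0) \<times> ball 0 (s \<delta>0) \<times> ball \<delta>0 (s \<delta>0)) (\<lambda>(x, y, \<delta>). K \<delta>0 x y \<delta>)"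
    using real_analytic_chart[OF an D(2)] by metis
  have "D \<subseteq> (\<Union>\<delta>\<in>D. ball \<delta> (s \<delta>))" using sK by force
  then obtain C where C: "C \<subseteq> D" "finite C" "D \<subseteq> (\<Union>\<delta>\<in>C. ball \<delta> (s \<delta>))"
    by (rule compactE_image[OF D(1) open_ball])
  have Cne: "C \<noteq> {}" using C False by auto
  define \<rho> where "\<rho> = Min (s ` C)"
  have \<rho>: "0 < \<rho>" "\<And>c. c \<in> C \<Longrightarrow> \<rho> \<le> s c"
    unfolding \<rho>_def using Cne C sK by auto
  obtain i where i: "\<And>\<delta>. \<delta> \<in> D \<Longrightarrow> i \<delta> \<in> C \<and> \<delta> \<in> ball (i \<delta>) (s (i \<delta>))"
  proof -
    have "\<forall>\<delta>\<in>D. \<exists>c. c \<in> C \<and> \<delta> \<in> ball c (s c)" using C(3) by blast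
    then show ?thesis using that by (metis (no_types) bchoice)
  qed
  define H where "H = (\<lambda>x y \<delta>. K (i \<delta>) x y \<delta>)"
  have Hb: "bihol \<rho> (\<lambda>x y. K c x y \<delta>)" if "\<delta> \<in> ball c (s c)" "c \<in> C" for \<delta> c
    by (rule bihol_mono[OF sK[THEN conjunct2, THEN conjunct1, rule_format, THEN conjunct1] \<rho>(2)])
      (use C that in auto)
  have Hr: "(x, y, \<delta>) \<in> \<Omega> \<and> K c (of_real x) (of_real y) \<delta> = complex_of_real (h x y \<delta>)"
    if "\<delta> \<in> ball c (s c)" "c \<in> C" "\<bar>x\<bar> < \<rho>" "\<bar>y\<bar> < \<rho>" for \<delta> c x y
  proof -
    have "\<bar>x\<bar> < s c" "\<bar>y\<bar> < s c" "c \<in> D" using that C \<rho>(2)[of c] by auto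
    then show ?thesis using sK[of c, THEN conjunct2, THEN conjunct1, rule_format, THEN conjunct2] that(1) by simp
  qed
  have eq: "H x y \<delta> = K c x y \<delta>"
    if "\<delta> \<in> ball c (s c)" "c \<in> C" "\<delta> \<in> D" "x \<in> ball 0 \<rho>" "y \<in> ball 0 \<rho>" for \<delta> c x y
    unfolding H_def
    by (rule bihol_eq_on_reals[OF Hb Hb]) (use that i Hr in auto)
  show ?thesis
  proof (rule that[OF \<rho>(1), of H])
    show "bihol \<rho> (\<lambda>x y. H x y \<delta>)" if "\<delta> \<in> D" for \<delta>
      unfolding H_def using Hb i that by auto
    show "continuous_on (ball 0 \<rho> \<times> ball 0 \<rho> \<times> D) (\<lambda>(x, y, \<delta>). H x y \<delta>)"
    proof (rule continuous_on_local)
      fix p assume "p \<in> ball (0::complex) \<rho> \<times> ball (0::complex) \<rho> \<times> D"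
      then obtain x y \<delta> where p: "p = (x, y, \<delta>)" "\<delta> \<in> D" by auto
      let ?T = "UNIV \<times> UNIV \<times> ball (i \<delta>) (s (i \<delta>))"
      have "continuous_on ((ball 0 \<rho> \<times> ball 0 \<rho> \<times> D) \<inter> ?T) (\<lambda>(x, y, \<delta>'). K (i \<delta>) x y \<delta>')"
        by (rule continuous_on_subset[of "ball 0 (s (i \<delta>)) \<times> ball 0 (s (i \<delta>)) \<times> ball (i \<delta>) (s (i \<delta>))"])
          (use sK[of "i \<delta>"] i[OF p(2)] C \<rho>(2)[of "i \<delta>"] in auto)
      moreover have "(\<lambda>(x, y, \<delta>'). H x y \<delta>') q = (\<lambda>(x, y, \<delta>'). K (i \<delta>) x y \<delta>') q"
        if "q \<in> (ball 0 \<rho> \<times> ball 0 \<rho> \<times> D) \<inter> ?T" for q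
        using that i[OF p(2)] by (cases q) (simp add: eq[of _ "i \<delta>"])
      ultimately have "continuous_on ((ball 0 \<rho> \<times> ball 0 \<rho> \<times> D) \<inter> ?T) (\<lambda>(x, y, \<delta>). H x y \<delta>)"
        by (subst continuous_on_cong[OF refl]) auto
      then show "\<exists>T. open T \<and> p \<in> T \<and>
          continuous_on ((ball 0 \<rho> \<times> ball 0 \<rho> \<times> D) \<inter> T) (\<lambda>(x, y, \<delta>). H x y \<delta>)"
        using i[OF p(2)] p by (intro exI[of _ ?T]) (auto intro!: open_Times)
    qed
    show "(x, y, \<delta>) \<in> \<Omega>" if "\<delta> \<in> D" "\<bar>x\<bar> < \<rho>" "\<bar>y\<bar> < \<rho>" for \<delta> x y
      using Hr[of \<delta> "i \<delta>"] i that by blast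
    show "H (of_real x) (of_real y) \<delta> = complex_of_real (h x y \<delta>)"
      if "\<delta> \<in> D" "\<bar>x\<bar> < \<rho>" "\<bar>y\<bar> < \<rho>" for \<delta> x y
      using Hr[of \<delta> "i \<delta>"] i that H_def by blast
  qed
qed

section \<open>Parameter dependence of the scalar equation\<close>

text \<open>Both iterations below, Picard's for the flow and the contraction for the implicit
  function, converge by this test; only the size of the increments differs.\<close>

lemma uniform_limit_telescoping:
  fixes f :: "nat \<Rightarrow> 'a \<Rightarrow> 'b::banach"
  assumes "\<And>k z. z \<in> S \<Longrightarrow> norm (f (Suc k) z - f k z) \<le> M k" "summable M"
  shows "\<exists>g. uniform_limit S f g sequentially"
proof -
  have "uniform_limit S (\<lambda>n z. \<Sum>k<n. f (Suc k) z - f k z) (\<lambda>z. \<Sum>k. f (Suc k) z - f k z) sequentially"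
    by (rule Weierstrass_m_test) (use assms in auto)
  then have "uniform_limit S (\<lambda>n z. f 0 z + (\<Sum>k<n. f (Suc k) z - f k z))
      (\<lambda>z. f 0 z + (\<Sum>k. f (Suc k) z - f k z)) sequentially"
    by (intro uniform_limit_add uniform_limit_const)
  moreover have "(\<lambda>n z. f 0 z + (\<Sum>k<n. f (Suc k) z - f k z)) = f"
    by (intro ext) (simp add: sum_lessThan_telescope[of "\<lambda>k. f k z" for z])
  ultimately show ?thesis by metis
qed

lemma hol_family_uniform_limit:
  assumes f: "\<And>n. hol_family P r (f n)"
    and lim: "uniform_limit (P \<times> ball 0 r) (\<lambda>n (p, z). f n p z) (\<lambda>(p, z). g p z) sequentially"
  shows "hol_family P r g"
  unfolding hol_family_def
proof (intro conjI ballI)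
  show "continuous_on (P \<times> ball 0 r) (\<lambda>(p, z). g p z)"
    by (rule uniform_limit_theorem[OF _ lim])
      (use hol_family_cont[OF f] in \<open>auto intro: always_eventually\<close>)
next
  fix p assume p: "p \<in> P"
  have lim': "uniform_limit (ball 0 r) (\<lambda>n. f n p) (g p) sequentially"
  proof (rule uniform_limitI)
    fix e :: real assume "e > 0"
    from uniform_limitD[OF lim this]
    show "\<forall>\<^sub>F n in sequentially. \<forall>z\<in>ball 0 r. dist (f n p z) (g p z) < e"
      by eventually_elim (use p in auto)
  qed
  show "g p holomorphic_on ball 0 r"
  proof (rule holomorphic_uniform_sequence[OF open_ball])
    show "f n p holomorphic_on ball 0 r" for n
      using hol_family_hol[OF f p] .
    fix x :: complex assume "x \<in> ball 0 r"
    then obtain d where "d > 0" "cball x d \<subseteq> ball 0 r"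
      using open_contains_cball[of "ball (0::complex) r"] by blast
    then show "\<exists>d>0. cball x d \<subseteq> ball 0 r \<and> uniform_limit (cball x d) (\<lambda>n. f n p) (g p) sequentially"
      using uniform_limit_on_subset[OF lim'] by blast
  qed
qed

text \<open>The bound on the derivative is integrated from 0. The interval is two-sided because the
  angle runs both ways from 0; negative \<open>t\<close> is reflected. The gain of one power
  together with the divisor \<open>Suc k\<close> produces the factorials in Picard's
  estimate.\<close>

lemma norm_le_power_integral:
  fixes g :: "real \<Rightarrow> 'a::real_normed_vector"
  assumes "g 0 = 0"
    and g': "\<And>t. t \<in> {-T..T} \<Longrightarrow> (g has_vector_derivative g' t) (at t within {-T..T})"
    and bd: "\<And>t. t \<in> {-T..T} \<Longrightarrow> norm (g' t) \<le> K * \<bar>t\<bar> ^ k"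
    and t: "t \<in> {-T..T}"
  shows "norm (g t) \<le> K * \<bar>t\<bar> ^ Suc k / Suc k"
proof -
  have pos: "norm (g t) \<le> K * t ^ Suc k / Suc k"
    if 0: "g 0 = 0"
      and g': "\<And>t. t \<in> {-T..T} \<Longrightarrow> (g has_vector_derivative g' t) (at t within {-T..T})"
      and bd: "\<And>t. t \<in> {-T..T} \<Longrightarrow> norm (g' t) \<le> K * \<bar>t\<bar> ^ k"
      and t: "0 \<le> t" "t \<le> T" for g g' :: "real \<Rightarrow> 'a" and t
  proof (cases "t = 0")
    case True
    then show ?thesis using 0 by simp
  next
    case False
    have c: "continuous_on {-T..T} g"
      using g' by (meson continuous_on_eq_continuous_within has_vector_derivative_continuous)
    have "norm (g t - g 0) \<le> K * t ^ Suc k / Suc k - K * 0 ^ Suc k / Suc k"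
    proof (rule differentiable_bound_general)
      show "0 < t" using t False by simp
      show "continuous_on {0..t} g"
        by (rule continuous_on_subset[OF c]) (use t in auto)
      show "continuous_on {0..t} (\<lambda>t. K * t ^ Suc k / Suc k)"
        by (intro continuous_intros) auto
    next
      fix s assume s: "0 < s" "s < t"
      then have "s \<in> {-T<..<T}" using t by auto
      then have "at s within {-T..T} = at s"
        by (metis at_within_interior interior_atLeastAtMost_real)
      then show "(g has_vector_derivative g' s) (at s)"
        using g'[of s] \<open>s \<in> {-T<..<T}\<close> by auto
      have "((\<lambda>t. K * t ^ Suc k / Suc k) has_real_derivative K * s ^ k) (at s)"
        by (rule derivative_eq_intros refl | simp)+
      then show "((\<lambda>t. K * t ^ Suc k / Suc k) has_vector_derivative K * s ^ k) (at s)"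
        by (simp add: has_real_derivative_iff_has_vector_derivative)
      show "norm (g' s) \<le> K * s ^ k"
        using bd[of s] s t by auto
    qed
    then show ?thesis using 0 by simp
  qed
  show ?thesis
  proof (cases "t \<ge> 0")
    case True
    then show ?thesis using pos[OF assms(1) g' bd] t by simp
  next
    case False
    have m: "uminus ` {-T..T} = {-T..T}"
      by simp
    have "norm (g (- (- t))) \<le> K * (- t) ^ Suc k / Suc k"
    proof (rule pos[where g = "\<lambda>t. g (- t)" and g' = "\<lambda>t. - g' (- t)"])
      fix s assume s: "s \<in> {-T..T}"
      then have "-s \<in> {-T..T}" by auto
      from g'[OF this] have "((g \<circ> uminus) has_vector_derivative (-1) *\<^sub>R g' (- s)) (at s within {-T..T})"
        by (intro vector_diff_chain_within) (auto simp: m intro!: derivative_eq_intros)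
      then show "((\<lambda>t. g (- t)) has_vector_derivative - g' (- s)) (at s within {-T..T})"
        by (simp add: o_def)
      show "norm (- g' (- s)) \<le> K * \<bar>s\<bar> ^ k"
        using bd[OF \<open>-s \<in> {-T..T}\<close>] by simp
    qed (use False t assms(1) in auto)
    then show ?thesis using False by simp
  qed
qed

text \<open>The primitive is written over the fixed interval \<open>[0,1]\<close> so that its joint continuity
  and its holomorphy in \<open>z\<close> follow from the theorems on parameter integrals.\<close>

definition primitive :: "(real \<Rightarrow> complex \<Rightarrow> complex) \<Rightarrow> real \<Rightarrow> complex \<Rightarrow> complex" where
  "primitive f t z = of_real t * integral (cbox 0 1) (\<lambda>s. f (t * s) z)"

lemma primitive_0 [simp]: "primitive f 0 z = 0"
  by (simp add: primitive_def)

lemma mult_unit_mem: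
  fixes s t T :: real
  assumes "t \<in> {-T..T}" "s \<in> {0..1}"
  shows "t * s \<in> {-T..T}"
proof -
  have "\<bar>t * s\<bar> \<le> \<bar>t\<bar>"
    using assms by (simp add: abs_mult mult_left_le)
  then show ?thesis using assms by (auto simp: abs_le_iff)
qed

lemma primitive_deriv:
  assumes "continuous_on {-T..T} (\<lambda>t. f t z)" "t \<in> {-T..T}"
  shows "((\<lambda>t. primitive f t z) has_vector_derivative f t z) (at t within {-T..T})"
proof -
  \<comment> \<open>\<open>G\<close> is an ordinary primitive. The substitution \<open>x * s\<close>
    identifies \<open>primitive\<close> with \<open>G x - G 0\<close>, so the derivative comes from
    the fundamental theorem of calculus.\<close>
  define G where "G = (\<lambda>x. integral {-T..x} (\<lambda>t. f t z))"
  have G: "(G has_vector_derivative f x z) (at x within {-T..T})" if "x \<in> {-T..T}" for x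
    unfolding G_def using integral_has_vector_derivative[OF assms(1) that] by simp
  have eq: "primitive f x z = G x - G 0" if x: "x \<in> {-T..T}" for x
  proof -
    have "((\<lambda>s. x *\<^sub>R f (x * s) z) has_integral ((G \<circ> (\<lambda>s. x * s)) 1 - (G \<circ> (\<lambda>s. x * s)) 0)) {0..1}"
    proof (rule fundamental_theorem_of_calculus)
      fix s :: real assume s: "s \<in> {0..1}"
      have "(\<lambda>s. x * s) ` {0..1} \<subseteq> {-T..T}"
        using mult_unit_mem[OF x] by auto
      then have "(G has_vector_derivative f (x * s) z) (at (x * s) within (\<lambda>s. x * s) ` {0..1})"
        using has_vector_derivative_within_subset[OF G[OF mult_unit_mem[OF x s]]] by blast
      moreover have "((\<lambda>s. x * s) has_vector_derivative x) (at s within {0..1})"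
        by (auto intro!: derivative_eq_intros)
      ultimately show "((G \<circ> (\<lambda>s. x * s)) has_vector_derivative x *\<^sub>R f (x * s) z) (at s within {0..1})"
        by (intro vector_diff_chain_within)
    qed simp
    from integral_unique[OF this] show ?thesis
      by (simp add: primitive_def scaleR_conv_of_real)
  qed
  have "((\<lambda>x. G x - G 0) has_vector_derivative f t z) (at t within {-T..T})"
    using G[OF assms(2)] by (auto intro!: derivative_eq_intros)
  then show ?thesis
    by (rule has_vector_derivative_transform[OF assms(2), rotated]) (use eq in auto)
qed

lemma hol_family_primitive:
  assumes f: "hol_family {-T..T} r f"
  shows "hol_family {-T..T} r (primitive f)"
proof -
  have c: "continuous_on (({-T..T} \<times> ball 0 r) \<times> cbox 0 1) (\<lambda>x. h (fst (fst x) * snd x) (snd (fst x)))"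
    if "hol_family {-T..T} r h" for h
  proof -
    have "continuous_on (({-T..T} \<times> ball 0 r) \<times> cbox 0 1)
        (\<lambda>x. (\<lambda>(p, z). h p z) (fst (fst x) * snd x, snd (fst x)))"
    proof (rule continuous_on_compose2[OF hol_family_cont[OF that]])
      show "(\<lambda>x. (fst (fst x) * snd x, snd (fst x))) ` (({-T..T} \<times> ball 0 r) \<times> cbox 0 1) \<subseteq> {-T..T} \<times> ball 0 r"
        using mult_unit_mem[of _ T] by (auto simp del: atLeastAtMost_iff simp: cbox_interval)
    qed (intro continuous_intros)
    then show ?thesis by simp
  qed
  show ?thesis
    unfolding hol_family_def
  proof (intro conjI ballI)
    have "continuous_on ({-T..T} \<times> ball 0 r) (\<lambda>x. integral (cbox 0 1) (\<lambda>s. f (fst x * s) (snd x)))"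
      by (rule integral_continuous_on_param) (use c[OF f] in \<open>simp add: split_beta\<close>)
    then show "continuous_on ({-T..T} \<times> ball 0 r) (\<lambda>(p, z). primitive f p z)"
      unfolding primitive_def split_beta by (intro continuous_intros)
  next
    fix t assume t: "t \<in> {-T..T}"
    have "(\<lambda>z. integral (cbox 0 1) (\<lambda>s. f (t * s) z)) holomorphic_on ball 0 r"
    proof (rule leibniz_rule_holomorphic)
      fix z s assume z: "z \<in> ball (0::complex) r" and s: "s \<in> cbox (0::real) 1"
      show "((\<lambda>z. f (t * s) z) has_field_derivative deriv (f (t * s)) z) (at z within ball 0 r)"
        using holomorphic_derivI[OF hol_family_hol[OF f mult_unit_mem[OF t]] open_ball z] s
        by (auto intro: has_field_derivative_at_within)
    next
      fix z assume z: "z \<in> ball (0::complex) r"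
      have "continuous_on (cbox 0 1) ((\<lambda>x. f (fst (fst x) * snd x) (snd (fst x))) \<circ> (\<lambda>s. ((t, z), s)))"
        by (intro continuous_on_compose continuous_intros continuous_on_subset[OF c[OF f]])
          (use t z in auto)
      then show "(\<lambda>s. f (t * s) z) integrable_on cbox 0 1"
        by (intro integrable_continuous) (simp add: o_def)
    next
      have "continuous_on (ball 0 r \<times> cbox 0 1)
          ((\<lambda>x. deriv (f (fst (fst x) * snd x)) (snd (fst x))) \<circ> (\<lambda>x. ((t, fst x), snd x)))"
        by (intro continuous_on_compose continuous_intros continuous_on_subset[OF c[OF hol_family_deriv[OF f]]])
          (use t in auto)
      then show "continuous_on (ball 0 r \<times> cbox 0 1) (\<lambda>(z, s). deriv (f (t * s)) z)"
        by (simp add: o_def split_beta)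
    qed simp
    then show "primitive f t holomorphic_on ball 0 r"
      unfolding primitive_def by (intro holomorphic_intros)
  qed
qed

lemma exp_Lipschitz:
  fixes v w :: complex
  assumes "norm v \<le> B" "norm w \<le> B"
  shows "norm (exp v - exp w) \<le> exp B * norm (v - w)"
proof (rule field_differentiable_bound[of "cball 0 B"])
  show "norm (exp z) \<le> exp B" if "z \<in> cball 0 B" for z :: complex
    using that norm_exp[of z] by (auto intro: order_trans)
qed (use assms in \<open>auto intro!: derivative_eq_intros\<close>)

text \<open>Real values are those fixed by conjugation, and conjugation commutes with the
  integral.\<close>

lemma primitive_Reals:
  assumes "\<And>s. s \<in> {0..1} \<Longrightarrow> f (t * s) z \<in> \<real>"
  shows "primitive f t z \<in> \<real>"
proof -
  have "integral (cbox 0 1) (\<lambda>s. cnj (f (t * s) z)) = integral (cbox 0 1) (\<lambda>s. f (t * s) z)"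
    by (rule integral_cong) (use assms in \<open>simp add: Reals_cnj_iff\<close>)
  then have "integral (cbox 0 1) (\<lambda>s. f (t * s) z) \<in> \<real>"
    by (simp add: Reals_cnj_iff integral_cnj)
  then show ?thesis
    unfolding primitive_def by (intro Reals_mult Reals_of_real)
qed

text \<open>With \<open>r = z exp u\<close> the equation \<open>dr/dt = r H(t,r)\<close> becomes \<open>du/dt = H(t, z exp u)\<close>,
  whose Picard iterates stay bounded by \<open>M T\<close> without any cutoff.\<close>

lemma exp_picard:
  assumes H: "hol_family {-T..T} r H" and "0 < T" "0 < r" and "0 \<le> L"
    and bd: "\<And>t z. t \<in> {-T..T} \<Longrightarrow> norm z < r \<Longrightarrow> norm (H t z) \<le> M"
    and lip: "\<And>t z w. t \<in> {-T..T} \<Longrightarrow> norm z < r \<Longrightarrow> norm w < r \<Longrightarrow>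
        norm (H t z - H t w) \<le> L * norm (z - w)"
    and real: "\<And>t x. t \<in> {-T..T} \<Longrightarrow> \<bar>x\<bar> < r \<Longrightarrow> H t (of_real x) \<in> \<real>"
    and \<rho>: "\<rho> = r * exp (- (M * T))"
  shows "\<exists>u. hol_family {-T..T} \<rho> u \<and> (\<forall>z\<in>ball 0 \<rho>. u 0 z = 0 \<and> (\<forall>t\<in>{-T..T}. norm (u t z) \<le> M * T \<and>
      ((\<lambda>t. u t z) has_vector_derivative H t (z * exp (u t z))) (at t within {-T..T}))) \<and>
      (\<forall>t\<in>{-T..T}. \<forall>x. \<bar>x\<bar> < \<rho> \<longrightarrow> u t (of_real x) \<in> \<real>)"
proof -
  have M: "0 \<le> M"
    using bd[of 0 0] \<open>0 < T\<close> \<open>0 < r\<close> by (auto intro: order_trans[OF norm_ge_zero])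
  \<comment> \<open>This is the origin of \<rho>: \<open>norm (exp v) \<le> exp (M * T)\<close>, so
    an initial value below \<open>r * exp (- (M * T))\<close> stays in the domain of
    \<open>H\<close> for every admissible \<open>v\<close>.\<close>
  have in_ball: "norm (z * exp v) < r" if "norm z < \<rho>" "norm v \<le> M * T" for z v :: complex
  proof -
    have "norm (z * exp v) \<le> norm z * exp (M * T)"
      unfolding norm_mult using that norm_exp[of v] by (intro mult_left_mono) (auto intro: order_trans)
    also have "\<dots> < \<rho> * exp (M * T)"
      using that by simp
    also have "\<dots> = r" by (simp add: \<rho> exp_minus)
    finally show ?thesis .
  qed
  \<comment> \<open>The Lipschitz constant in \<open>v\<close> is \<open>L * r\<close> with no
    further exponential: the factor \<open>exp (M * T)\<close> from \<open>exp_Lipschitz\<close> is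
    absorbed by \<open>norm z < \<rho>\<close>.\<close>
  have expdiff: "norm (H t (z * exp v) - H t (z * exp w)) \<le> L * r * norm (v - w)"
    if "t \<in> {-T..T}" "norm z < \<rho>" "norm v \<le> M * T" "norm w \<le> M * T" for t z v w
  proof -
    have "norm z * exp (M * T) \<le> \<rho> * exp (M * T)"
      using that(2) by (intro mult_right_mono) auto
    also have "\<rho> * exp (M * T) = r" by (simp add: \<rho> exp_minus)
    finally have zr: "norm z * exp (M * T) \<le> r" .
    have "norm (H t (z * exp v) - H t (z * exp w)) \<le> L * norm (z * exp v - z * exp w)"
      using that by (intro lip in_ball)
    also have "norm (z * exp v - z * exp w) = norm z * norm (exp v - exp w)"
      by (simp add: norm_mult flip: right_diff_distrib)
    also have "\<dots> \<le> norm z * (exp (M * T) * norm (v - w))"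
      using that by (intro mult_left_mono exp_Lipschitz) auto
    also have "\<dots> \<le> r * norm (v - w)"
      using mult_right_mono[OF zr norm_ge_zero[of "v - w"]] by (simp add: mult.assoc)
    finally show ?thesis using \<open>0 \<le> L\<close> by (simp add: mult_left_mono mult.assoc)
  qed
  have comp: "hol_family {-T..T} \<rho> (\<lambda>t z. H t (z * exp (v t z)))"
    if v: "hol_family {-T..T} \<rho> v" and vb: "\<And>t z. t \<in> {-T..T} \<Longrightarrow> norm z < \<rho> \<Longrightarrow> norm (v t z) \<le> M * T" for v
    unfolding hol_family_def
  proof (intro conjI ballI)
    have c1: "continuous_on ({-T..T} \<times> ball 0 \<rho>) (\<lambda>x. snd x * exp ((\<lambda>(t, z). v t z) x))"
      by (intro continuous_intros hol_family_cont[OF v])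
    have "continuous_on ({-T..T} \<times> ball 0 \<rho>) (\<lambda>x. (\<lambda>(t, z). H t z) (fst x, snd x * exp ((\<lambda>(t, z). v t z) x)))"
      by (rule continuous_on_compose2[OF hol_family_cont[OF H]
            continuous_on_Pair[OF continuous_on_fst[OF continuous_on_id] c1]])
        (use in_ball vb in auto)
    then show "continuous_on ({-T..T} \<times> ball 0 \<rho>) (\<lambda>(t, z). H t (z * exp (v t z)))"
      by (simp add: split_beta)
  next
    fix t assume t: "t \<in> {-T..T}"
    have "(H t \<circ> (\<lambda>z. z * exp (v t z))) holomorphic_on ball 0 \<rho>"
      by (rule holomorphic_on_compose_gen[OF _ hol_family_hol[OF H t]])
        (use hol_family_hol[OF v t] in_ball vb t in \<open>auto intro!: holomorphic_intros\<close>)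
    then show "(\<lambda>z. H t (z * exp (v t z))) holomorphic_on ball 0 \<rho>"
      by (simp add: o_def)
  qed
  have slice: "continuous_on {-T..T} (\<lambda>t. f t z)" if f: "hol_family {-T..T} \<rho> f" and z: "norm z < \<rho>" for f z
  proof -
    have "continuous_on {-T..T} (\<lambda>t. (\<lambda>(t, z). f t z) (t, z))"
      by (intro continuous_on_compose2[OF hol_family_cont[OF f]] continuous_intros) (use z in auto)
    then show ?thesis by simp
  qed
  have pd: "((\<lambda>t. primitive f t z) has_vector_derivative f t z) (at t within {-T..T})"
    if f: "hol_family {-T..T} \<rho> f" and z: "norm z < \<rho>" and t: "t \<in> {-T..T}" for f z t
    using primitive_deriv[where f = f and z = z and T = T and t = t] slice[OF f z] t by blast
  \<comment> \<open>Each iterate integrates \<open>H (t, z exp u)\<close> along the previous one,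
    starting from 0. The bound on \<open>H\<close> keeps every iterate below \<open>M * T\<close>,
    which is the condition under which \<open>comp\<close> and \<open>expdiff\<close> apply.\<close>
  define U where "U = rec_nat (\<lambda>_ _. 0) (\<lambda>_ v. primitive (\<lambda>t z. H t (z * exp (v t z))))"
  define h where "h = (\<lambda>k t z. H t (z * exp (U k t z)))"
  have U0: "U 0 = (\<lambda>_ _. 0)" and US: "U (Suc k) = primitive (h k)" for k
    by (simp_all add: U_def h_def)
  have U: "hol_family {-T..T} \<rho> (U k) \<and> (\<forall>t\<in>{-T..T}. \<forall>z. norm z < \<rho> \<longrightarrow> norm (U k t z) \<le> M * T)" for k
  proof (induction k)
    case 0
    then show ?case using M \<open>0 < T\<close> by (auto simp: U0 hol_family_def split_beta)
  next
    case (Suc k)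
    have hk: "hol_family {-T..T} \<rho> (h k)"
      unfolding h_def using Suc by (intro comp) auto
    have "norm (U (Suc k) t z) \<le> M * T" if "t \<in> {-T..T}" "norm z < \<rho>" for t z
    proof -
      have "norm (primitive (h k) t z) \<le> M * \<bar>t\<bar> ^ Suc 0 / Suc 0"
      proof (rule norm_le_power_integral)
        show "((\<lambda>t. primitive (h k) t z) has_vector_derivative h k t z) (at t within {-T..T})"
          if "t \<in> {-T..T}" for t
          using pd[OF hk \<open>norm z < \<rho>\<close> that] .
        show "norm (h k t z) \<le> M * \<bar>t\<bar> ^ 0" if "t \<in> {-T..T}" for t
          unfolding h_def using bd in_ball Suc that \<open>norm z < \<rho>\<close> by simp
      qed (use that in auto)
      also have "\<dots> \<le> M * T"
        using that M by (auto intro!: mult_left_mono)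
      finally show ?thesis by (simp add: US)
    qed
    then show ?case using hol_family_primitive[OF hk] by (simp add: US)
  qed
  have hk: "hol_family {-T..T} \<rho> (h k)" for k
    unfolding h_def using U by (intro comp) auto
  have diff: "norm (U (Suc k) t z - U k t z) \<le> M * (L * r) ^ k / fact k * \<bar>t\<bar> ^ Suc k"
    if t: "t \<in> {-T..T}" and z: "norm z < \<rho>" for k t z
    using t
  proof (induction k arbitrary: t)
    case 0
    have "norm (primitive (h 0) t z) \<le> M * \<bar>t\<bar> ^ Suc 0 / Suc 0"
    proof (rule norm_le_power_integral)
      show "((\<lambda>t. primitive (h 0) t z) has_vector_derivative h 0 t z) (at t within {-T..T})"
        if "t \<in> {-T..T}" for t
        using pd[OF hk z that] .
      show "norm (h 0 t z) \<le> M * \<bar>t\<bar> ^ 0" if "t \<in> {-T..T}" for t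
        unfolding h_def using bd in_ball U that z by simp
    qed (use 0 in auto)
    then show ?case by (simp add: US U0)
  next
    case (Suc k)
    have "norm (primitive (h (Suc k)) t z - primitive (h k) t z)
       \<le> (L * r * (M * (L * r) ^ k / fact k)) * \<bar>t\<bar> ^ Suc (Suc k) / Suc (Suc k)"
    proof (rule norm_le_power_integral)
      show "((\<lambda>t. primitive (h (Suc k)) t z - primitive (h k) t z) has_vector_derivative
          h (Suc k) t z - h k t z) (at t within {-T..T})" if "t \<in> {-T..T}" for t
        using pd[OF hk z that] by (intro has_vector_derivative_diff)
      show "norm (h (Suc k) t z - h k t z) \<le> L * r * (M * (L * r) ^ k / fact k) * \<bar>t\<bar> ^ Suc k"
        if t: "t \<in> {-T..T}" for t
      proof -
        have "norm (h (Suc k) t z - h k t z) \<le> L * r * norm (U (Suc k) t z - U k t z)"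
          unfolding h_def using U t z by (intro expdiff) auto
        also have "\<dots> \<le> L * r * (M * (L * r) ^ k / fact k * \<bar>t\<bar> ^ Suc k)"
          using Suc.IH[OF t] \<open>0 \<le> L\<close> \<open>0 < r\<close> by (intro mult_left_mono) auto
        finally show ?thesis by (simp add: mult.assoc)
      qed
    qed (use Suc in auto)
    \<comment> \<open>Integration yields the factor \<open>k + 2\<close>; replacing it by the
      smaller \<open>k + 1\<close> gives a clean factorial, and the bounds then sum to an
      exponential series.\<close>
    also have "\<dots> = M * (L * r) ^ Suc k / (fact k * (real k + 2)) * \<bar>t\<bar> ^ Suc (Suc k)"
      by (simp add: field_simps)
    also have "\<dots> \<le> M * (L * r) ^ Suc k / fact (Suc k) * \<bar>t\<bar> ^ Suc (Suc k)"
    proof -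
      have "fact (Suc k) \<le> fact k * (real k + 2)"
        by (simp add: algebra_simps)
      then show ?thesis
        using M \<open>0 \<le> L\<close> \<open>0 < r\<close>
        by (intro mult_right_mono divide_left_mono mult_pos_pos) (auto simp del: fact_Suc)
    qed
    finally show ?case by (simp add: US)
  qed
  have sm: "summable (\<lambda>k. M * T * ((L * r * T) ^ k / fact k))"
    using summable_exp[of "L * r * T"] by (intro summable_mult) (simp add: field_simps)
  have "\<exists>g. uniform_limit ({-T..T} \<times> ball 0 \<rho>) (\<lambda>k (t, z). U k t z) g sequentially"
  proof (rule uniform_limit_telescoping[OF _ sm])
    fix k and x :: "real \<times> complex" assume "x \<in> {-T..T} \<times> ball 0 \<rho>"
    then obtain t z where x: "x = (t, z)" "t \<in> {-T..T}" "norm z < \<rho>" by auto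
    have "norm (U (Suc k) t z - U k t z) \<le> M * (L * r) ^ k / fact k * \<bar>t\<bar> ^ Suc k"
      using diff x by simp
    also have "\<dots> \<le> M * (L * r) ^ k / fact k * T ^ Suc k"
      using x M \<open>0 \<le> L\<close> \<open>0 < r\<close> by (intro mult_left_mono power_mono) auto
    also have "\<dots> = M * T * ((L * r * T) ^ k / fact k)"
      by (simp add: power_mult_distrib)
    finally show "norm ((\<lambda>(t, z). U (Suc k) t z) x - (\<lambda>(t, z). U k t z) x) \<le> M * T * ((L * r * T) ^ k / fact k)"
      by (simp add: x)
  qed
  then obtain g where "uniform_limit ({-T..T} \<times> ball 0 \<rho>) (\<lambda>k (t, z). U k t z) g sequentially" by blast
  then have lim: "uniform_limit ({-T..T} \<times> ball 0 \<rho>) (\<lambda>k (t, z). U k t z) (\<lambda>(t, z). curry g t z) sequentially"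
    by simp
  define u where "u = curry g"
  have u: "hol_family {-T..T} \<rho> u"
    unfolding u_def by (rule hol_family_uniform_limit[OF _ lim]) (use U in auto)
  have ptw: "(\<lambda>k. U k t z) \<longlonglongrightarrow> u t z" if "t \<in> {-T..T}" "norm z < \<rho>" for t z
    using tendsto_uniform_limitI[OF lim, of "(t, z)"] that by (simp add: u_def)
  have ub: "norm (u t z) \<le> M * T" if "t \<in> {-T..T}" "norm z < \<rho>" for t z
    by (rule Lim_bounded[OF tendsto_norm[OF ptw[OF that]], of 0]) (use U that in auto)
  define hh where "hh = (\<lambda>t z. H t (z * exp (u t z)))"
  have hh: "hol_family {-T..T} \<rho> hh"
    unfolding hh_def using u ub by (intro comp)
  have ueq: "u t z = primitive hh t z" if t: "t \<in> {-T..T}" and z: "norm z < \<rho>" for t z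
  proof -
    have "(\<lambda>k. U (Suc k) t z) \<longlonglongrightarrow> primitive hh t z"
    proof (rule tendstoI)
      fix e :: real assume e: "e > 0"
      \<comment> \<open>The summand 1 keeps the divisor positive when \<open>L = 0\<close> and makes
        the final inequality strict.\<close>
      define e' where "e' = e / (L * r * T + 1)"
      have pos: "L * r * T + 1 > 0"
        using \<open>0 \<le> L\<close> \<open>0 < r\<close> \<open>0 < T\<close> by (smt (verit) mult_nonneg_nonneg)
      have e': "e' > 0" using e pos by (simp add: e'_def)
      from uniform_limitD[OF lim e']
      show "\<forall>\<^sub>F k in sequentially. dist (U (Suc k) t z) (primitive hh t z) < e"
      proof eventually_elim
        case (elim k)
        have "norm (primitive (h k) t z - primitive hh t z) \<le> (L * r * e') * \<bar>t\<bar> ^ Suc 0 / Suc 0"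
        proof (rule norm_le_power_integral)
          show "((\<lambda>t. primitive (h k) t z - primitive hh t z) has_vector_derivative
              h k t z - hh t z) (at t within {-T..T})" if "t \<in> {-T..T}" for t
            using pd[OF hk z that] pd[OF hh z that]
            by (intro has_vector_derivative_diff)
          show "norm (h k t z - hh t z) \<le> L * r * e' * \<bar>t\<bar> ^ 0" if t: "t \<in> {-T..T}" for t
          proof -
            have "norm (h k t z - hh t z) \<le> L * r * norm (U k t z - u t z)"
              unfolding h_def hh_def using U t z ub by (intro expdiff) auto
            also have "\<dots> \<le> L * r * e'"
              using elim t z \<open>0 \<le> L\<close> \<open>0 < r\<close>
              by (intro mult_left_mono) (auto simp: u_def dist_norm intro: less_imp_le)
            finally show ?thesis by simp
          qed
        qed (use t in auto)
        also have "\<dots> \<le> L * r * e' * T"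
          using t e' \<open>0 \<le> L\<close> \<open>0 < r\<close> by (auto intro!: mult_left_mono)
        also have "\<dots> = (L * r * T) * e'" by simp
        also have "\<dots> < (L * r * T + 1) * e'" using e' by (simp add: algebra_simps)
        also have "\<dots> = e" using pos by (simp add: e'_def)
        finally show ?case by (simp add: US dist_norm)
      qed
    qed
    moreover have "(\<lambda>k. U (Suc k) t z) \<longlonglongrightarrow> u t z"
      using LIMSEQ_Suc[OF ptw[OF t z]] .
    ultimately show ?thesis by (rule LIMSEQ_unique[rotated])
  qed
  \<comment> \<open>The iterates are real for real initial values because \<open>H\<close> is real
    there; the limit is then real because the reals are closed.\<close>
  have Ureal: "U k t (of_real x) \<in> \<real>" if x: "\<bar>x\<bar> < \<rho>" and "t \<in> {-T..T}" for k t x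
    using that(2)
  proof (induction k arbitrary: t)
    case (Suc k)
    show ?case
      unfolding US
    proof (rule primitive_Reals)
      fix s :: real assume "s \<in> {0..1}"
      then have ts: "t * s \<in> {-T..T}" using mult_unit_mem Suc.prems by blast
      from Suc.IH[OF ts] obtain y where y: "U k (t * s) (of_real x) = of_real y" by (auto elim: Reals_cases)
      have "norm (of_real x * exp (U k (t * s) (of_real x))) < r"
        using in_ball U ts x by simp
      then have "\<bar>x * exp y\<bar> < r"
        by (simp add: y norm_mult abs_mult)
      then have "H (t * s) (of_real (x * exp y)) \<in> \<real>"
        by (rule real[OF ts])
      then show "h k (t * s) (of_real x) \<in> \<real>"
        by (simp add: h_def y exp_of_real)
    qed
  qed (simp add: U0)
  have "u t (of_real x) \<in> \<real>" if "t \<in> {-T..T}" "\<bar>x\<bar> < \<rho>" for t x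
    using closed_sequentially[OF closed_complex_Reals _ ptw[OF that(1), of "of_real x"]] Ureal that by simp
  moreover have "((\<lambda>t. u t z) has_vector_derivative H t (z * exp (u t z))) (at t within {-T..T})"
    if "t \<in> {-T..T}" "norm z < \<rho>" for t z
  proof -
    have "((\<lambda>t. u t z) has_vector_derivative hh t z) (at t within {-T..T})"
      by (rule has_vector_derivative_transform[OF that(1) _ pd[OF hh that(2,1)]]) (use ueq that in auto)
    then show ?thesis by (simp add: hh_def)
  qed
  moreover have "u 0 z = 0" if "norm z < \<rho>" for z
    using ueq[of 0 z] that \<open>0 < T\<close> by simp
  ultimately show ?thesis
    using u ub by (intro exI[of _ u]) auto
qed

section \<open>The implicit function\<close>

text \<open>Moving one of the two variables into the parameter makes the results on one-variable
  families available for partial derivatives.\<close>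

lemma hol_family_of_bihol:
  assumes b: "\<And>\<delta>. \<delta> \<in> D \<Longrightarrow> bihol \<rho> (\<lambda>x y. H x y \<delta>)"
    and c: "continuous_on (ball 0 \<rho> \<times> ball 0 \<rho> \<times> D) (\<lambda>(x, y, \<delta>). H x y \<delta>)"
  shows "hol_family (ball 0 \<rho> \<times> D) \<rho> (\<lambda>(x, \<delta>) y. H x y \<delta>)"
    and "hol_family (ball 0 \<rho> \<times> D) \<rho> (\<lambda>(y, \<delta>) x. H x y \<delta>)"
proof -
  have "continuous_on ((ball 0 \<rho> \<times> D) \<times> ball 0 \<rho>)
      ((\<lambda>(x, y, \<delta>). H x y \<delta>) \<circ> (\<lambda>p. (fst (fst p), snd p, snd (fst p))))"
    by (intro continuous_on_compose continuous_intros continuous_on_subset[OF c]) auto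
  then show "hol_family (ball 0 \<rho> \<times> D) \<rho> (\<lambda>(x, \<delta>) y. H x y \<delta>)"
    unfolding hol_family_def by (auto simp: o_def split_beta intro!: biholD[OF b] holomorphic_intros)
  have "continuous_on ((ball 0 \<rho> \<times> D) \<times> ball 0 \<rho>)
      ((\<lambda>(x, y, \<delta>). H x y \<delta>) \<circ> (\<lambda>p. (snd p, fst (fst p), snd (fst p))))"
    by (intro continuous_on_compose continuous_intros continuous_on_subset[OF c]) auto
  then show "hol_family (ball 0 \<rho> \<times> D) \<rho> (\<lambda>(y, \<delta>) x. H x y \<delta>)"
    unfolding hol_family_def by (auto simp: o_def split_beta intro!: biholD[OF b] holomorphic_intros)
qed

text \<open>Uniform continuity on the compact product gives one \<open>d\<close> for all \<delta>.
  Radii independent of the parameter are obtained in this way.\<close>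

lemma continuous_on_uniform_near:
  fixes g :: "'a::metric_space \<times> 'b::metric_space \<Rightarrow> 'c::metric_space"
  assumes g: "continuous_on (K \<times> D) g" and "compact K" "compact D" "x0 \<in> K" "0 < e"
  shows "\<exists>d>0. \<forall>x\<in>K. \<forall>\<delta>\<in>D. dist x x0 < d \<longrightarrow> dist (g (x, \<delta>)) (g (x0, \<delta>)) < e"
proof -
  have "uniformly_continuous_on (K \<times> D) g"
    using assms by (intro compact_uniformly_continuous compact_Times)
  then obtain d where "0 < d" and d: "\<forall>p\<in>K \<times> D. \<forall>q\<in>K \<times> D. dist q p < d \<longrightarrow> dist (g q) (g p) < e"
    using \<open>0 < e\<close> unfolding uniformly_continuous_on_def by blast
  show ?thesis
  proof (intro exI[of _ d] conjI ballI impI \<open>0 < d\<close>)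
    fix x \<delta> assume "x \<in> K" "\<delta> \<in> D" "dist x x0 < d"
    then show "dist (g (x, \<delta>)) (g (x0, \<delta>)) < e"
      using d[rule_format, of "(x0, \<delta>)" "(x, \<delta>)"] \<open>x0 \<in> K\<close> by (simp add: dist_Pair_Pair)
  qed
qed

text \<open>The vanishing derivative in \<open>y\<close> at the origin makes
  \<open>y \<mapsto> - H x y \<delta>\<close> a contraction with constant 1/2 nearby, uniformly in
  \<delta>, and its iterates are families that converge uniformly. The contraction estimate is
  handed out as well: it identifies the given \<open>F\<close> with the fixed point, and later it
  shows that \<open>x'\<close> has the sign of \<open>y - F(x)\<close>.\<close>

lemma hol_implicit:
  fixes H :: "complex \<Rightarrow> complex \<Rightarrow> 'd::metric_space \<Rightarrow> complex"
  assumes D: "compact D" and \<rho>: "0 < \<rho>"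
    and b: "\<And>\<delta>. \<delta> \<in> D \<Longrightarrow> bihol \<rho> (\<lambda>x y. H x y \<delta>)"
    and c: "continuous_on (ball 0 \<rho> \<times> ball 0 \<rho> \<times> D) (\<lambda>(x, y, \<delta>). H x y \<delta>)"
    and zero: "\<And>\<delta>. \<delta> \<in> D \<Longrightarrow> H 0 0 \<delta> = 0"
    and dzero: "\<And>\<delta>. \<delta> \<in> D \<Longrightarrow> deriv (\<lambda>y. H 0 y \<delta>) 0 = 0"
  obtains s s1 G where "0 < s1" "s1 \<le> s" "s < \<rho>" "hol_family D s1 (\<lambda>\<delta> x. G x \<delta>)"
    "\<And>\<delta> x y y'. \<delta> \<in> D \<Longrightarrow> norm x \<le> s \<Longrightarrow> norm y \<le> s \<Longrightarrow> norm y' \<le> s \<Longrightarrow>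
       norm (H x y \<delta> - H x y' \<delta>) \<le> 1/2 * norm (y - y')"
    "\<And>\<delta> x. \<delta> \<in> D \<Longrightarrow> norm x < s1 \<Longrightarrow> norm (G x \<delta>) \<le> s \<and> G x \<delta> + H x (G x \<delta>) \<delta> = 0"
proof -
  note hy = hol_family_of_bihol(1)[OF b c]
  let ?K = "cball (0::complex) (\<rho>/2)"
  have cdy: "continuous_on ((?K \<times> ?K) \<times> D) (\<lambda>((x, y), \<delta>). deriv (\<lambda>y. H x y \<delta>) y)"
  proof -
    have "continuous_on ((?K \<times> ?K) \<times> D)
      ((\<lambda>(p, z). deriv ((\<lambda>(x, \<delta>) y. H x y \<delta>) p) z) \<circ> (\<lambda>q. ((fst (fst q), snd q), snd (fst q))))"
      by (intro continuous_on_compose continuous_intros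
          continuous_on_subset[OF hol_family_cont[OF hol_family_deriv[OF hy]]]) (use \<rho> in auto)
    then show ?thesis by (simp add: o_def split_beta)
  qed
  have 00: "(0, 0) \<in> ?K \<times> ?K" using \<rho> by simp
  obtain d where d: "0 < d" "\<forall>p\<in>?K \<times> ?K. \<forall>\<delta>\<in>D. dist p (0, 0) < d \<longrightarrow>
      dist ((\<lambda>((x, y), \<delta>). deriv (\<lambda>y. H x y \<delta>) y) (p, \<delta>)) ((\<lambda>((x, y), \<delta>). deriv (\<lambda>y. H x y \<delta>) y) ((0, 0), \<delta>)) < 1/2"
    using continuous_on_uniform_near[OF cdy compact_Times[OF compact_cball compact_cball] D 00, of "1/2"] by auto
  \<comment> \<open>With \<open>d/3\<close> the pair \<open>(x, z)\<close> has norm at most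
    \<open>2 * s\<close>, hence below \<open>d\<close>; with \<open>\<rho>/2\<close> the closed
    discs stay inside the domain of \<open>H\<close>.\<close>
  define s where "s = min (\<rho>/2) (d/3)"
  have s: "0 < s" "s < \<rho>" "s \<le> \<rho>/2" "s \<le> d/3" using \<rho> d by (auto simp: s_def)
  have lip: "norm (H x y \<delta> - H x y' \<delta>) \<le> 1/2 * norm (y - y')"
    if \<delta>: "\<delta> \<in> D" and x: "norm x \<le> s" and y: "norm y \<le> s" "norm y' \<le> s" for \<delta> x y y'
  proof (rule field_differentiable_bound[of "cball 0 s"])
    fix z :: complex assume z: "z \<in> cball 0 s"
    have "(\<lambda>y. H x y \<delta>) holomorphic_on ball 0 \<rho>"
      using hol_family_hol[OF hy, of "(x, \<delta>)"] \<delta> x s by auto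
    then show "((\<lambda>y. H x y \<delta>) has_field_derivative deriv (\<lambda>y. H x y \<delta>) z) (at z within cball 0 s)"
      by (rule has_field_derivative_at_within[OF holomorphic_derivI[OF _ open_ball]]) (use s z in auto)
    have "dist (x, z) (0, 0) \<le> norm x + norm z"
      using norm_Pair_le[of x z] by (simp add: dist_norm)
    also have "\<dots> < d" using x z s d(1) by auto
    finally show "norm (deriv (\<lambda>y. H x y \<delta>) z) \<le> 1/2"
      using d(2)[rule_format, of "(x, z)" \<delta>] \<delta> x z s by (simp add: dzero)
  qed (use y in auto)
  have cH0: "continuous_on (?K \<times> D) (\<lambda>(x, \<delta>). H x 0 \<delta>)"
  proof -
    have "continuous_on (?K \<times> D) ((\<lambda>(x, y, \<delta>). H x y \<delta>) \<circ> (\<lambda>p. (fst p, 0, snd p)))"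
      by (intro continuous_on_compose continuous_intros continuous_on_subset[OF c]) (use \<rho> in auto)
    then show ?thesis by (simp add: o_def split_beta)
  qed
  have 0: "0 \<in> ?K" using \<rho> by simp
  obtain d' where d': "0 < d'" "\<forall>x\<in>?K. \<forall>\<delta>\<in>D. dist x 0 < d' \<longrightarrow>
      dist ((\<lambda>(x, \<delta>). H x 0 \<delta>) (x, \<delta>)) ((\<lambda>(x, \<delta>). H x 0 \<delta>) (0, \<delta>)) < s/2"
    using continuous_on_uniform_near[OF cH0 compact_cball D 0, of "s/2"] s by auto
  \<comment> \<open>On this disc \<open>norm (H x 0 \<delta>) \<le> s/2\<close>; the contraction
    adds at most another \<open>s/2\<close>, so every iterate stays within \<open>s\<close>.\<close>
  define s1 where "s1 = min s d'"
  have s1: "0 < s1" "s1 \<le> s" using s d' by (auto simp: s1_def)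
  have H0: "norm (H x 0 \<delta>) \<le> s/2" if "\<delta> \<in> D" "norm x < s1" for x \<delta>
    using d'(2)[rule_format, of x \<delta>] that s zero by (auto simp: s1_def)
  define U where "U = rec_nat (\<lambda>_ _. 0) (\<lambda>_ v x \<delta>. - H x (v x \<delta>) \<delta>)"
  have U0: "U 0 = (\<lambda>_ _. 0)" and US: "U (Suc k) = (\<lambda>x \<delta>. - H x (U k x \<delta>) \<delta>)" for k
    by (simp_all add: U_def)
  have U: "hol_family D s1 (\<lambda>\<delta> x. U k x \<delta>) \<and> (\<forall>\<delta>\<in>D. \<forall>x. norm x < s1 \<longrightarrow> norm (U k x \<delta>) \<le> s)" for k
  proof (induction k)
    case 0
    then show ?case using s by (simp add: U0 hol_family_def split_beta)
  next
    case (Suc k)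
    have cU: "continuous_on (D \<times> ball 0 s1) (\<lambda>(\<delta>, x). U k x \<delta>)"
      using Suc hol_family_cont by fastforce
    have hU: "(\<lambda>x. U k x \<delta>) holomorphic_on ball 0 s1" if "\<delta> \<in> D" for \<delta>
      using Suc hol_family_hol that by fastforce
    have Ub: "norm (U k x \<delta>) \<le> s" if "\<delta> \<in> D" "norm x < s1" for x \<delta>
      using Suc that by blast
    have Ub': "norm (U k x \<delta>) < \<rho>" if "\<delta> \<in> D" "norm x < s1" for x \<delta>
      using Ub[OF that] s by linarith
    have "continuous_on (D \<times> ball 0 s1) (\<lambda>p. - (\<lambda>(x, y, \<delta>). H x y \<delta>) (snd p, (\<lambda>(\<delta>, x). U k x \<delta>) p, fst p))"
    proof (rule continuous_on_minus, rule continuous_on_compose2[OF c])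
      show "(\<lambda>p. (snd p, (\<lambda>(\<delta>, x). U k x \<delta>) p, fst p)) ` (D \<times> ball 0 s1) \<subseteq> ball 0 \<rho> \<times> ball 0 \<rho> \<times> D"
        using Ub' s s1 by auto
    qed (intro continuous_intros cU)
    moreover have "(\<lambda>x. - H x (U k x \<delta>) \<delta>) holomorphic_on ball 0 s1" if "\<delta> \<in> D" for \<delta>
      using that hU Ub' s s1
      by (intro holomorphic_intros biholD[OF b]) auto
    moreover have "norm (- H x (U k x \<delta>) \<delta>) \<le> s" if "\<delta> \<in> D" "norm x < s1" for x \<delta>
    proof -
      have "norm (H x (U k x \<delta>) \<delta> - H x 0 \<delta>) \<le> 1/2 * norm (U k x \<delta> - 0)"
        using that Ub s1 s by (intro lip) auto
      also have "\<dots> \<le> s/2" using Ub[OF that] by simp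
      finally show ?thesis
        using H0[OF that] norm_triangle_sub[of "H x (U k x \<delta>) \<delta>" "H x 0 \<delta>"] by simp
    qed
    ultimately show ?case
      by (simp add: US hol_family_def split_beta)
  qed
  have diff: "norm (U (Suc k) x \<delta> - U k x \<delta>) \<le> s * (1/2) ^ k" if "\<delta> \<in> D" "norm x < s1" for k x \<delta>
  proof (induction k)
    case 0
    then show ?case using U[of "Suc 0"] that by (simp add: U0)
  next
    case (Suc k)
    have "norm (U (Suc (Suc k)) x \<delta> - U (Suc k) x \<delta>) = norm (H x (U (Suc k) x \<delta>) \<delta> - H x (U k x \<delta>) \<delta>)"
      using US[of "Suc k"] US[of k] by (simp add: norm_minus_commute)
    also have "\<dots> \<le> 1/2 * norm (U (Suc k) x \<delta> - U k x \<delta>)"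
      using U that s1 by (intro lip) auto
    finally show ?case using Suc by simp
  qed
  have "\<exists>g. uniform_limit (D \<times> ball 0 s1) (\<lambda>k (\<delta>, x). U k x \<delta>) g sequentially"
    by (rule uniform_limit_telescoping[where M = "\<lambda>k. s * (1/2) ^ k"])
      (use diff in \<open>auto intro!: summable_mult\<close>)
  then obtain g where "uniform_limit (D \<times> ball 0 s1) (\<lambda>k (\<delta>, x). U k x \<delta>) g sequentially" by blast
  then have lim: "uniform_limit (D \<times> ball 0 s1) (\<lambda>k (\<delta>, x). U k x \<delta>) (\<lambda>(\<delta>, x). curry g \<delta> x) sequentially"
    by simp
  define G where "G = (\<lambda>x \<delta>. g (\<delta>, x))"
  have hG: "hol_family D s1 (\<lambda>\<delta> x. G x \<delta>)"
    using hol_family_uniform_limit[OF _ lim] U by (simp add: G_def curry_def)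
  have ptw: "(\<lambda>k. U k x \<delta>) \<longlonglongrightarrow> G x \<delta>" if "\<delta> \<in> D" "norm x < s1" for x \<delta>
    using tendsto_uniform_limitI[OF lim, of "(\<delta>, x)"] that by (simp add: G_def)
  have Gb: "norm (G x \<delta>) \<le> s" if "\<delta> \<in> D" "norm x < s1" for x \<delta>
    by (rule Lim_bounded[OF tendsto_norm[OF ptw[OF that]], of 0]) (use U that in auto)
  have "G x \<delta> + H x (G x \<delta>) \<delta> = 0" if x: "\<delta> \<in> D" "norm x < s1" for x \<delta>
  proof -
    have "(\<lambda>k. H x (U k x \<delta>) \<delta> - H x (G x \<delta>) \<delta>) \<longlonglongrightarrow> 0"
    proof (rule Lim_null_comparison)
      show "\<forall>\<^sub>F k in sequentially. norm (H x (U k x \<delta>) \<delta> - H x (G x \<delta>) \<delta>) \<le> 1/2 * norm (U k x \<delta> - G x \<delta>)"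
        using U Gb x s1 by (intro always_eventually allI lip) auto
      show "(\<lambda>k. 1/2 * norm (U k x \<delta> - G x \<delta>)) \<longlonglongrightarrow> 0"
        using ptw[OF x] by (intro tendsto_mult_right_zero tendsto_norm_zero) (simp add: LIM_zero)
    qed
    then have "(\<lambda>k. H x (U k x \<delta>) \<delta>) \<longlonglongrightarrow> H x (G x \<delta>) \<delta>"
      by (simp add: LIM_zero_iff)
    then have "(\<lambda>k. U (Suc k) x \<delta>) \<longlonglongrightarrow> - H x (G x \<delta>) \<delta>"
      unfolding US by (rule tendsto_minus)
    then have "G x \<delta> = - H x (G x \<delta>) \<delta>"
      using LIMSEQ_Suc[OF ptw[OF x]] by (rule LIMSEQ_unique[rotated])
    then show ?thesis by (rule eq_neg_iff_add_eq_0[THEN iffD1])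
  qed
  then show ?thesis
    using that[OF s1 s(2) hG lip] Gb by blast
qed

section \<open>The complexified system\<close>

text \<open>Along the real axis \<open>f\<close> is a real-valued path, so its derivative has
  imaginary part 0 and real part the derivative of \<open>g\<close>. This links the real derivatives
  in \<open>f_fun\<close> with complex partial derivatives.\<close>

lemma real_deriv_of_holomorphic:
  assumes f: "f holomorphic_on ball 0 r" and x: "\<bar>x\<bar> < r"
    and g: "\<And>u. \<bar>u\<bar> < r \<Longrightarrow> f (of_real u) = complex_of_real (g u)"
  shows "(g has_real_derivative deriv g x) (at x)" "deriv f (of_real x) = of_real (deriv g x)"
proof -
  let ?d = "deriv f (of_real x)"
  have "(f has_field_derivative ?d) (at (of_real x))"
    using x by (intro holomorphic_derivI[OF f open_ball]) simp
  then have v: "((\<lambda>u. f (of_real u)) has_vector_derivative ?d) (at x)"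
    by (rule has_vector_derivative_real_field)
  have ev: "\<forall>\<^sub>F u in nhds x. \<bar>u\<bar> < r"
    using x by (intro eventually_nhds_in_open[of "{u. \<bar>u\<bar> < r}", simplified]) (auto intro!: open_Collect_less continuous_intros)
  have re: "((\<lambda>u. Re (f (of_real u))) has_vector_derivative Re ?d) (at x)"
    and im: "((\<lambda>u. Im (f (of_real u))) has_vector_derivative Im ?d) (at x)"
    using bounded_linear.has_vector_derivative[OF bounded_linear_Re v]
      bounded_linear.has_vector_derivative[OF bounded_linear_Im v] by simp_all
  have "((\<lambda>u. Im (f (of_real u))) has_vector_derivative 0) (at x) \<longleftrightarrow> ((\<lambda>u. 0::real) has_vector_derivative 0) (at x)"
    by (rule has_vector_derivative_cong_ev)
      (use ev x g in \<open>auto elim!: eventually_mono\<close>)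
  then have "((\<lambda>u. Im (f (of_real u))) has_vector_derivative 0) (at x)"
    by simp
  with im have "Im ?d = 0"
    using vector_derivative_unique_at by blast
  have "((\<lambda>u. Re (f (of_real u))) has_vector_derivative Re ?d) (at x) \<longleftrightarrow> (g has_vector_derivative Re ?d) (at x)"
    by (rule has_vector_derivative_cong_ev)
      (use ev x g in \<open>auto elim!: eventually_mono\<close>)
  with re have 1: "(g has_real_derivative Re ?d) (at x)"
    by (simp add: has_real_derivative_iff_has_vector_derivative)
  then have "deriv g x = Re ?d" by (rule DERIV_imp_deriv)
  with 1 \<open>Im ?d = 0\<close> show "(g has_real_derivative deriv g x) (at x)" "?d = of_real (deriv g x)"
    by (simp_all add: complex_eq_iff)
qed

text \<open>Applied with \<open>c = cos \<phi>\<close>. The value \<open>c = 0\<close> is separate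
  because the limit at 0 says nothing about \<open>h 0\<close>; there \<open>h 0 = 0\<close> and
  \<open>0 < m\<close> make both sides vanish.\<close>

lemma tendsto_power_quotient_scale:
  fixes h :: "real \<Rightarrow> real"
  assumes h: "((\<lambda>x. h x / x ^ m) \<longlongrightarrow> l) (at 0)" and "h 0 = 0" "0 < m"
  shows "((\<lambda>r. h (r * c) / r ^ m) \<longlongrightarrow> l * c ^ m) (at_right 0)"
proof (cases "c = 0")
  case True
  then show ?thesis using assms by (simp add: zero_power)
next
  case False
  have "filterlim (\<lambda>r. r * c) (at 0) (at_right 0)"
    using False by (auto simp: filterlim_at eventually_at_filter intro!: tendsto_eq_intros)
  from filterlim_compose[OF h this]
  have "((\<lambda>r. h (r * c) / (r * c) ^ m * c ^ m) \<longlongrightarrow> l * c ^ m) (at_right 0)"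
    by (intro tendsto_intros)
  then show ?thesis
    using False by (simp add: power_mult_distrib)
qed

text \<open>The second derivatives form a family again and are bounded on a compact set, so a single
  \<open>C\<close> serves all parameters.\<close>

lemma hol_family_Taylor2:
  assumes f: "hol_family P r f" "compact P" "s < r"
  shows "\<exists>C\<ge>0. \<forall>p\<in>P. \<forall>y w. norm y \<le> s \<longrightarrow> norm w \<le> s \<longrightarrow>
     norm (f p w - f p y - deriv (f p) y * (w - y)) \<le> C * norm (w - y) ^ 2"
proof -
  note f1 = hol_family_deriv[OF f(1)]
  note f2 = hol_family_deriv[OF f1]
  obtain C where C: "0 < C" "\<And>p z. p \<in> P \<Longrightarrow> norm z \<le> s \<Longrightarrow> norm (deriv (deriv (f p)) z) \<le> C"
    using hol_family_bounded[OF f2 f(2,3)] by blast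
  have "norm (f p w - f p y - deriv (f p) y * (w - y)) \<le> C * norm (w - y) ^ 2"
    if p: "p \<in> P" and yw: "norm y \<le> s" "norm w \<le> s" for p y w
  proof -
    define h where "h = (\<lambda>i::nat. if i = 0 then f p else if i = 1 then deriv (f p) else deriv (deriv (f p)))"
    have "norm (h 0 w - (\<Sum>i\<le>1. h i y * (w - y) ^ i / fact i)) \<le> C * norm (w - y) ^ Suc 1 / fact 1"
    proof (rule complex_Taylor[of "cball 0 s"])
      fix i x assume x: "x \<in> cball (0::complex) s" and i: "i \<le> (1::nat)"
      have x': "x \<in> ball 0 r" using x f(3) by simp
      have "i = 0 \<or> i = 1" using i by auto
      then show "(h i has_field_derivative h (Suc i) x) (at x within cball 0 s)"
        using holomorphic_derivI[OF hol_family_hol[OF f(1) p] open_ball x', of "cball 0 s"]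
          holomorphic_derivI[OF hol_family_hol[OF f1 p] open_ball x', of "cball 0 s"]
        by (auto simp: h_def)
    next
      show "norm (h (Suc 1) x) \<le> C" if "x \<in> cball 0 s" for x
        using C(2)[OF p] that by (simp add: h_def)
    qed (use yw in auto)
    then show ?thesis
      by (simp add: h_def power2_eq_square diff_diff_eq)
  qed
  then show ?thesis using C by (intro exI[of _ C]) auto
qed

text \<open>\<open>XC\<close>, \<open>YC\<close>, \<open>FC\<close> are complex extensions of
  \<open>X\<close>, \<open>Y\<close>, \<open>F\<close>. The bounds \<open>R \<le> s / 2\<close> and
  \<open>norm (FC x \<delta>) \<le> s / 2\<close> leave room for \<open>F + v\<close> with
  \<open>norm v < R\<close> to stay within \<open>s\<close>, where the contraction and the Taylor
  estimates hold. The assumptions on \<open>g\<close> and \<open>f\<close> appear as limits of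
  quotients at 0, and \<open>b\<close> stands for the coefficient of \<open>x^(n-1)\<close> in
  \<open>f\<close>.\<close>

locale complex_system =
  fixes X Y :: "real \<Rightarrow> real \<Rightarrow> real ^ 'm::finite \<Rightarrow> real"
    and F :: "real \<Rightarrow> real ^ 'm \<Rightarrow> real"
    and D :: "(real ^ 'm) set"
    and XC YC :: "complex \<Rightarrow> complex \<Rightarrow> real ^ 'm \<Rightarrow> complex"
    and FC :: "complex \<Rightarrow> real ^ 'm \<Rightarrow> complex"
    and \<rho> s R :: real and n :: nat and a b :: "real ^ 'm \<Rightarrow> real"
  assumes compact_D: "compact D"
    and n2: "n \<ge> 2"
    and R: "0 < R" "R \<le> s / 2" "R \<le> 1" "s < \<rho>"
    and bX: "\<And>\<delta>. \<delta> \<in> D \<Longrightarrow> bihol \<rho> (\<lambda>x y. XC x y \<delta>)"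
    and bY: "\<And>\<delta>. \<delta> \<in> D \<Longrightarrow> bihol \<rho> (\<lambda>x y. YC x y \<delta>)"
    and cX: "continuous_on (ball 0 \<rho> \<times> ball 0 \<rho> \<times> D) (\<lambda>(x, y, \<delta>). XC x y \<delta>)"
    and cY: "continuous_on (ball 0 \<rho> \<times> ball 0 \<rho> \<times> D) (\<lambda>(x, y, \<delta>). YC x y \<delta>)"
    and rX: "\<And>\<delta> x y. \<delta> \<in> D \<Longrightarrow> \<bar>x\<bar> < \<rho> \<Longrightarrow> \<bar>y\<bar> < \<rho> \<Longrightarrow> XC (of_real x) (of_real y) \<delta> = of_real (X x y \<delta>)"
    and rY: "\<And>\<delta> x y. \<delta> \<in> D \<Longrightarrow> \<bar>x\<bar> < \<rho> \<Longrightarrow> \<bar>y\<bar> < \<rho> \<Longrightarrow> YC (of_real x) (of_real y) \<delta> = of_real (Y x y \<delta>)"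
    and hF: "hol_family D R (\<lambda>\<delta> x. FC x \<delta>)"
    and F_small: "\<And>\<delta> x. \<delta> \<in> D \<Longrightarrow> norm x < R \<Longrightarrow> norm (FC x \<delta>) \<le> s / 2"
    and F_eq: "\<And>\<delta> x. \<delta> \<in> D \<Longrightarrow> norm x < R \<Longrightarrow> FC x \<delta> + XC x (FC x \<delta>) \<delta> = 0"
    and rF: "\<And>\<delta> x. \<delta> \<in> D \<Longrightarrow> \<bar>x\<bar> < R \<Longrightarrow> FC (of_real x) \<delta> = of_real (F x \<delta>)"
    and F0: "\<And>\<delta>. \<delta> \<in> D \<Longrightarrow> F 0 \<delta> = 0"
    and contr: "\<And>\<delta> x y y'. \<delta> \<in> D \<Longrightarrow> norm x \<le> s \<Longrightarrow> norm y \<le> s \<Longrightarrow> norm y' \<le> s \<Longrightarrow>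
       norm (XC x y \<delta> - XC x y' \<delta>) \<le> 1/2 * norm (y - y')"
    and Xy0: "\<And>\<delta>. \<delta> \<in> D \<Longrightarrow> deriv (\<lambda>y. XC 0 y \<delta>) 0 = 0"
    and Y0: "\<And>\<delta>. \<delta> \<in> D \<Longrightarrow> Y 0 0 \<delta> = 0"
    and g_lim: "\<And>\<delta>. \<delta> \<in> D \<Longrightarrow> ((\<lambda>x. g_fun Y F x \<delta> / x ^ (2 * n - 1)) \<longlongrightarrow> a \<delta>) (at 0)"
    and f_lim: "\<And>\<delta>. \<delta> \<in> D \<Longrightarrow> ((\<lambda>x. f_fun X Y F x \<delta> / x ^ (n - 1)) \<longlongrightarrow> b \<delta>) (at 0)"
    and f0: "\<And>\<delta>. \<delta> \<in> D \<Longrightarrow> f_fun X Y F 0 \<delta> = 0"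
    and a_pos: "\<And>\<delta>. \<delta> \<in> D \<Longrightarrow> 0 < a \<delta>"
    and disc: "\<And>\<delta>. \<delta> \<in> D \<Longrightarrow> (b \<delta>)\<^sup>2 - 4 * real n * a \<delta> < 0"
begin

lemma s_pos: "0 < s" using R by linarith

lemmas famXy = hol_family_of_bihol(1)[OF bX cX]
lemmas famXx = hol_family_of_bihol(2)[OF bX cX]
lemmas famYy = hol_family_of_bihol(1)[OF bY cY]

abbreviation Xy where "Xy x y \<delta> \<equiv> deriv (\<lambda>y. XC x y \<delta>) y"
abbreviation Xx where "Xx x y \<delta> \<equiv> deriv (\<lambda>x. XC x y \<delta>) x"
abbreviation Yy where "Yy x y \<delta> \<equiv> deriv (\<lambda>y. YC x y \<delta>) y"
abbreviation F' where "F' x \<delta> \<equiv> deriv (\<lambda>x. FC x \<delta>) x"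

lemma Taylor_X:
  "\<exists>C\<ge>0. \<forall>\<delta>\<in>D. \<forall>x y w. norm x \<le> s \<longrightarrow> norm y \<le> s \<longrightarrow> norm w \<le> s \<longrightarrow>
     norm (XC x w \<delta> - XC x y \<delta> - Xy x y \<delta> * (w - y)) \<le> C * norm (w - y) ^ 2"
proof -
  have h: "hol_family (cball 0 s \<times> D) \<rho> (\<lambda>(x, \<delta>) y. XC x y \<delta>)"
    by (rule hol_family_subset[OF famXy]) (use R in auto)
  show ?thesis
    using hol_family_Taylor2[OF h compact_Times[OF compact_cball compact_D] R(4)] by fastforce
qed

lemma Taylor_Y:
  "\<exists>C\<ge>0. \<forall>\<delta>\<in>D. \<forall>x y w. norm x \<le> s \<longrightarrow> norm y \<le> s \<longrightarrow> norm w \<le> s \<longrightarrow>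
     norm (YC x w \<delta> - YC x y \<delta> - Yy x y \<delta> * (w - y)) \<le> C * norm (w - y) ^ 2"
proof -
  have h: "hol_family (cball 0 s \<times> D) \<rho> (\<lambda>(x, \<delta>) y. YC x y \<delta>)"
    by (rule hol_family_subset[OF famYy]) (use R in auto)
  show ?thesis
    using hol_family_Taylor2[OF h compact_Times[OF compact_cball compact_D] R(4)] by fastforce
qed

lemma F_lt: "\<delta> \<in> D \<Longrightarrow> norm x < R \<Longrightarrow> norm (FC x \<delta>) < \<rho>"
  using F_small[of \<delta> x] R by linarith

lemma Xy_tendsto:
  assumes \<delta>: "\<delta> \<in> D" and u: "(u \<longlongrightarrow> x) G" and v: "(v \<longlongrightarrow> y) G" and xy: "norm x < \<rho>" "norm y < \<rho>"
  shows "((\<lambda>t. Xy (u t) (v t) \<delta>) \<longlongrightarrow> Xy x y \<delta>) G"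
proof -
  have "continuous_on (ball 0 \<rho> \<times> ball 0 \<rho>) (\<lambda>q. Xy (fst q) (snd q) \<delta>)"
  proof -
    have "continuous_on (ball 0 \<rho> \<times> ball 0 \<rho>)
      ((\<lambda>(p, z). deriv ((\<lambda>(x, \<delta>) y. XC x y \<delta>) p) z) \<circ> (\<lambda>q. ((fst q, \<delta>), snd q)))"
      by (intro continuous_on_compose continuous_intros
          continuous_on_subset[OF hol_family_cont[OF hol_family_deriv[OF famXy]]]) (use \<delta> in auto)
    then show ?thesis by (simp add: o_def split_beta)
  qed
  then have "isCont (\<lambda>q. Xy (fst q) (snd q) \<delta>) (x, y)"
    using xy by (simp add: continuous_on_eq_continuous_at open_Times)
  from isCont_tendsto_compose[OF this tendsto_Pair[OF u v]] show ?thesis by simp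
qed

text \<open>Differentiation of \<open>F + X(x, F) = 0\<close>. In place of total differentiability
  of \<open>XC\<close> the difference quotient is split into a Taylor remainder quadratic in the
  increment of \<open>F\<close>, a part linear in that increment, and an increment in
  \<open>x\<close> alone. The identity serves to eliminate \<open>Xx\<close> from
  \<open>f\<close>.\<close>

lemma F_chain:
  assumes \<delta>: "\<delta> \<in> D" and x: "norm x < R"
  shows "Xx x (FC x \<delta>) \<delta> + F' x \<delta> * (1 + Xy x (FC x \<delta>) \<delta>) = 0"
proof -
  obtain C where C: "C \<ge> 0" "\<And>x y w. norm x \<le> s \<Longrightarrow> norm y \<le> s \<Longrightarrow> norm w \<le> s \<Longrightarrow>
     norm (XC x w \<delta> - XC x y \<delta> - Xy x y \<delta> * (w - y)) \<le> C * norm (w - y) ^ 2"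
    using Taylor_X \<delta> by blast
  let ?G = "\<lambda>x. FC x \<delta>"
  have G': "(?G has_field_derivative F' x \<delta>) (at x)"
    using x by (intro holomorphic_derivI[OF hol_family_hol[OF hF \<delta>] open_ball]) simp
  have X': "((\<lambda>u. XC u (?G x) \<delta>) has_field_derivative Xx x (?G x) \<delta>) (at x)"
    using hol_family_hol[OF famXx, of "(?G x, \<delta>)"] F_lt[OF \<delta> x] \<delta> x R
    by (intro holomorphic_derivI[OF _ open_ball[of 0 \<rho>]]) auto
  have evx: "\<forall>\<^sub>F u in at x. norm u < R"
    using x eventually_at_in_open'[of "ball 0 R" x] by (simp add: eventually_mono)
  \<comment> \<open>The expansion in the second argument is made at the abscissa \<open>u\<close>;
    what remains is an increment in \<open>x\<close> with the second argument fixed. Continuity of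
    \<open>Xy\<close> then moves the linear coefficient from \<open>u\<close> to
    \<open>x\<close>.\<close>
  let ?E = "\<lambda>u. XC u (?G u) \<delta> - XC u (?G x) \<delta> - Xy u (?G x) \<delta> * (?G u - ?G x)"
  have quot: "((\<lambda>u. (?G u - ?G x) / (u - x)) \<longlongrightarrow> F' x \<delta>) (at x)"
    using G' by (simp add: has_field_derivative_iff)
  have Glim: "(?G \<longlongrightarrow> ?G x) (at x)"
    using DERIV_isCont[OF G'] by (simp add: isCont_def)
  have E: "((\<lambda>u. ?E u / (u - x)) \<longlongrightarrow> 0) (at x)"
  proof (rule Lim_null_comparison)
    show "((\<lambda>u. C * (norm ((?G u - ?G x) / (u - x)) * norm (?G u - ?G x))) \<longlongrightarrow> 0) (at x)"
    proof -
      have "((\<lambda>u. C * (norm ((?G u - ?G x) / (u - x)) * norm (?G u - ?G x))) \<longlongrightarrow>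
          C * (norm (F' x \<delta>) * norm (?G x - ?G x))) (at x)"
        by (intro tendsto_intros quot Glim)
      then show ?thesis by simp
    qed
    show "\<forall>\<^sub>F u in at x. norm (?E u / (u - x)) \<le> C * (norm ((?G u - ?G x) / (u - x)) * norm (?G u - ?G x))"
      using evx
    proof eventually_elim
      case (elim u)
      have "norm (?E u) \<le> C * norm (?G u - ?G x) ^ 2"
        using elim x F_small[OF \<delta> elim] F_small[OF \<delta> x] R s_pos by (intro C) auto
      then have "norm (?E u) / norm (u - x) \<le> C * norm (?G u - ?G x) ^ 2 / norm (u - x)"
        by (rule divide_right_mono) simp
      then show ?case by (simp add: norm_divide power2_eq_square)
    qed
  qed
  have "((\<lambda>u. ?E u / (u - x) + Xy u (?G x) \<delta> * ((?G u - ?G x) / (u - x)) +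
      (XC u (?G x) \<delta> - XC x (?G x) \<delta>) / (u - x) + (?G u - ?G x) / (u - x)) \<longlongrightarrow>
      0 + Xy x (?G x) \<delta> * F' x \<delta> + Xx x (?G x) \<delta> + F' x \<delta>) (at x)"
    using X' F_lt[OF \<delta> x] x R
    by (intro tendsto_intros E quot Xy_tendsto[OF \<delta>]) (auto simp: has_field_derivative_iff)
  moreover have "\<forall>\<^sub>F u in at x. ?E u / (u - x) + Xy u (?G x) \<delta> * ((?G u - ?G x) / (u - x)) +
      (XC u (?G x) \<delta> - XC x (?G x) \<delta>) / (u - x) + (?G u - ?G x) / (u - x) = 0"
    using evx
  proof eventually_elim
    case (elim u)
    have "?E u / (u - x) + Xy u (?G x) \<delta> * ((?G u - ?G x) / (u - x)) +
      (XC u (?G x) \<delta> - XC x (?G x) \<delta>) / (u - x) + (?G u - ?G x) / (u - x)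
      = ((?G u + XC u (?G u) \<delta>) - (?G x + XC x (?G x) \<delta>)) / (u - x)"
      by (simp add: add_divide_distrib diff_divide_distrib algebra_simps)
    then show ?case using F_eq[OF \<delta> elim] F_eq[OF \<delta> x] by simp
  qed
  ultimately have "((\<lambda>u. 0) \<longlongrightarrow> 0 + Xy x (?G x) \<delta> * F' x \<delta> + Xx x (?G x) \<delta> + F' x \<delta>) (at x)"
    by (rule Lim_transform_eventually)
  then have "0 + Xy x (?G x) \<delta> * F' x \<delta> + Xx x (?G x) \<delta> + F' x \<delta> = 0"
    using tendsto_unique[OF _ _ tendsto_const] by (metis trivial_limit_at)
  then show ?thesis by (simp add: algebra_simps)
qed

end

lemma hol_family_cong:
  assumes "hol_family P r f" "\<And>p z. p \<in> P \<Longrightarrow> norm z < r \<Longrightarrow> f p z = g p z"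
  shows "hol_family P r g"
proof -
  have "continuous_on (P \<times> ball 0 r) (\<lambda>(p, z). g p z) \<longleftrightarrow> continuous_on (P \<times> ball 0 r) (\<lambda>(p, z). f p z)"
    by (rule continuous_on_cong[OF refl]) (use assms(2) in auto)
  moreover have "g p holomorphic_on ball 0 r \<longleftrightarrow> f p holomorphic_on ball 0 r" if "p \<in> P" for p
    by (rule holomorphic_cong[OF refl]) (use assms(2)[OF that] in auto)
  ultimately show ?thesis
    using assms(1) by (simp add: hol_family_def)
qed

lemma hol_family_quotient:
  assumes "hol_family P r f" "0 < r"
    and "\<And>p. p \<in> P \<Longrightarrow> ((\<lambda>x. f p (of_real x) / of_real x ^ m) \<longlongrightarrow> l p) (at_right 0)"
  shows "hol_family P r (\<lambda>p z. if z = 0 then l p else f p z / z ^ m)"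
proof -
  obtain f1 where f1: "hol_family P r f1"
    "\<forall>p\<in>P. f1 p 0 = l p \<and> (\<forall>z\<in>ball 0 r. f p z = z ^ m * f1 p z)"
    using hol_family_divide_power[OF assms] by blast
  show ?thesis
    by (rule hol_family_cong[OF f1(1)]) (use f1(2) in auto)
qed

section \<open>Weighted polar coordinates and the orders of vanishing at the origin\<close>

context complex_system
begin

definition xp :: "real \<Rightarrow> complex \<Rightarrow> complex" where
  "xp \<phi> r = r * of_real (cos \<phi>)"

text \<open>This is \<open>v = y - F(x)\<close>. The orbits turn clockwise, and the minus sign makes
  \<phi> increase with time for \<open>r > 0\<close>.\<close>

definition vp :: "real \<Rightarrow> complex \<Rightarrow> complex" where
  "vp \<phi> r = - (r ^ n * of_real (sin \<phi>))"

text \<open>\<open>Ac\<close> is \<open>x' = y + X\<close> after subtraction of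
  \<open>F + X(x, F) = 0\<close>, which exhibits that it vanishes with \<open>v\<close>.
  \<open>Vc\<close> below is \<open>v' = y' - F'(x) x'\<close>.\<close>

definition Ac :: "real \<Rightarrow> real ^ 'm \<Rightarrow> complex \<Rightarrow> complex" where
  "Ac \<phi> \<delta> r = vp \<phi> r + XC (xp \<phi> r) (FC (xp \<phi> r) \<delta> + vp \<phi> r) \<delta> - XC (xp \<phi> r) (FC (xp \<phi> r) \<delta>) \<delta>"

definition Vc :: "real \<Rightarrow> real ^ 'm \<Rightarrow> complex \<Rightarrow> complex" where
  "Vc \<phi> \<delta> r = YC (xp \<phi> r) (FC (xp \<phi> r) \<delta> + vp \<phi> r) \<delta> - F' (xp \<phi> r) \<delta> * Ac \<phi> \<delta> r"

lemma xp_le: "norm (xp \<phi> r) \<le> norm r"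
  by (simp add: xp_def norm_mult mult_left_le)

lemma vp_le:
  assumes "norm r < R"
  shows "norm (vp \<phi> r) \<le> norm r ^ n" "norm (vp \<phi> r) < R"
proof -
  show 1: "norm (vp \<phi> r) \<le> norm r ^ n"
    by (simp add: vp_def norm_mult norm_power mult_left_le)
  have "norm r ^ n \<le> norm r ^ 1"
    using assms R n2 by (intro power_decreasing) auto
  with 1 assms show "norm (vp \<phi> r) < R" by simp
qed

lemma Fv_le:
  assumes "\<delta> \<in> D" "norm x < R" "norm r < R"
  shows "norm (FC x \<delta> + vp \<phi> r) \<le> s"
  using norm_triangle_ineq[of "FC x \<delta>" "vp \<phi> r"] F_small[OF assms(1,2)] vp_le(2)[OF assms(3), of \<phi>] R
  by linarith

lemma dom_facts:
  assumes "\<delta> \<in> D" "norm r < R"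
  shows "norm (xp \<phi> r) < R" "norm (xp \<phi> r) < \<rho>" "norm (FC (xp \<phi> r) \<delta>) < \<rho>"
    "norm (FC (xp \<phi> r) \<delta> + vp \<phi> r) < \<rho>"
proof -
  show x: "norm (xp \<phi> r) < R" using xp_le[of \<phi> r] assms by linarith
  then show "norm (xp \<phi> r) < \<rho>" using R by linarith
  show "norm (FC (xp \<phi> r) \<delta>) < \<rho>" using F_lt[OF assms(1) x] .
  show "norm (FC (xp \<phi> r) \<delta> + vp \<phi> r) < \<rho>" using Fv_le[OF assms(1) x assms(2), of \<phi>] R by linarith
qed

lemma hol_xp: "xp \<phi> holomorphic_on S" and hol_vp: "vp \<phi> holomorphic_on S"
  unfolding xp_def[abs_def] vp_def[abs_def] by (intro holomorphic_intros)+

lemma hol_F_comp: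
  assumes "\<delta> \<in> D" and f: "f holomorphic_on ball 0 R"
  shows "(\<lambda>r. f (xp \<phi> r)) holomorphic_on ball 0 R"
proof -
  have "(f \<circ> xp \<phi>) holomorphic_on ball 0 R"
    by (rule holomorphic_on_compose_gen[OF hol_xp f]) (use dom_facts(1)[OF assms(1)] in auto)
  then show ?thesis by (simp add: o_def)
qed

lemma cont_xp: "continuous_on (S :: ((real \<times> (real ^ 'm)) \<times> complex) set) (\<lambda>q. xp (fst (fst q)) (snd q))"
  and cont_vp: "continuous_on (S :: ((real \<times> (real ^ 'm)) \<times> complex) set) (\<lambda>q. vp (fst (fst q)) (snd q))"
  unfolding xp_def vp_def by (intro continuous_intros)+

lemma cont_FC: "continuous_on ((UNIV \<times> D) \<times> ball 0 R) (\<lambda>q. FC (xp (fst (fst q)) (snd q)) (snd (fst q)))"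
  and cont_F': "continuous_on ((UNIV \<times> D) \<times> ball 0 R) (\<lambda>q. F' (xp (fst (fst q)) (snd q)) (snd (fst q)))"
proof -
  have *: "continuous_on ((UNIV \<times> D) \<times> ball 0 R)
    (\<lambda>q. (\<lambda>(\<delta>, x). f \<delta> x) (snd (fst q), xp (fst (fst q)) (snd q)))" if "hol_family D R f" for f
    by (rule continuous_on_compose2[OF hol_family_cont[OF that]])
      (auto intro!: continuous_intros cont_xp dom_facts)
  show "continuous_on ((UNIV \<times> D) \<times> ball 0 R) (\<lambda>q. FC (xp (fst (fst q)) (snd q)) (snd (fst q)))"
    using *[OF hF] by simp
  show "continuous_on ((UNIV \<times> D) \<times> ball 0 R) (\<lambda>q. F' (xp (fst (fst q)) (snd q)) (snd (fst q)))"
    using *[OF hol_family_deriv[OF hF]] by simp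
qed

lemma fam_Ac: "hol_family (UNIV \<times> D) R (\<lambda>(\<phi>, \<delta>). Ac \<phi> \<delta>)"
  unfolding hol_family_def
proof (intro conjI ballI)
  let ?S = "(UNIV \<times> D) \<times> ball (0::complex) R"
  have "continuous_on ?S (\<lambda>q. (\<lambda>(x, y, \<delta>). XC x y \<delta>) (xp (fst (fst q)) (snd q),
      FC (xp (fst (fst q)) (snd q)) (snd (fst q)) + vp (fst (fst q)) (snd q), snd (fst q)))"
    by (rule continuous_on_compose2[OF cX])
      (auto intro!: continuous_intros cont_xp cont_vp cont_FC dom_facts)
  moreover have "continuous_on ?S (\<lambda>q. (\<lambda>(x, y, \<delta>). XC x y \<delta>) (xp (fst (fst q)) (snd q),
      FC (xp (fst (fst q)) (snd q)) (snd (fst q)), snd (fst q)))"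
    by (rule continuous_on_compose2[OF cX])
      (auto intro!: continuous_intros cont_xp cont_vp cont_FC dom_facts)
  ultimately have "continuous_on ?S (\<lambda>q. Ac (fst (fst q)) (snd (fst q)) (snd q))"
    unfolding Ac_def by (intro continuous_intros cont_vp) simp_all
  then show "continuous_on ?S (\<lambda>(p, r). (case p of (\<phi>, \<delta>) \<Rightarrow> Ac \<phi> \<delta>) r)"
    by (simp add: split_beta)
next
  fix p :: "real \<times> (real ^ 'm)" assume "p \<in> UNIV \<times> D"
  then obtain \<phi> \<delta> where p: "p = (\<phi>, \<delta>)" "\<delta> \<in> D" by auto
  have "Ac \<phi> \<delta> holomorphic_on ball 0 R"
    unfolding Ac_def[abs_def]
    by (intro holomorphic_intros biholD[OF bX[OF p(2)] open_ball] hol_xp hol_vp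
        hol_F_comp[OF p(2) hol_family_hol[OF hF p(2)]]) (use dom_facts[OF p(2)] in auto)
  then show "(case p of (\<phi>, \<delta>) \<Rightarrow> Ac \<phi> \<delta>) holomorphic_on ball 0 R"
    by (simp add: p)
qed

lemma fam_Vc: "hol_family (UNIV \<times> D) R (\<lambda>(\<phi>, \<delta>). Vc \<phi> \<delta>)"
  unfolding hol_family_def
proof (intro conjI ballI)
  let ?S = "(UNIV \<times> D) \<times> ball (0::complex) R"
  have "continuous_on ?S (\<lambda>q. (\<lambda>(x, y, \<delta>). YC x y \<delta>) (xp (fst (fst q)) (snd q),
      FC (xp (fst (fst q)) (snd q)) (snd (fst q)) + vp (fst (fst q)) (snd q), snd (fst q)))"
    by (rule continuous_on_compose2[OF cY])
      (auto intro!: continuous_intros cont_xp cont_vp cont_FC dom_facts)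
  moreover have "continuous_on ?S (\<lambda>q. Ac (fst (fst q)) (snd (fst q)) (snd q))"
    using hol_family_cont[OF fam_Ac] by (simp add: split_beta)
  ultimately have "continuous_on ?S (\<lambda>q. Vc (fst (fst q)) (snd (fst q)) (snd q))"
    unfolding Vc_def by (intro continuous_intros cont_F') simp_all
  then show "continuous_on ?S (\<lambda>(p, r). (case p of (\<phi>, \<delta>) \<Rightarrow> Vc \<phi> \<delta>) r)"
    by (simp add: split_beta)
next
  fix p :: "real \<times> (real ^ 'm)" assume p': "p \<in> UNIV \<times> D"
  then obtain \<phi> \<delta> where p: "p = (\<phi>, \<delta>)" "\<delta> \<in> D" by auto
  have Ah: "Ac \<phi> \<delta> holomorphic_on ball 0 R"
    using hol_family_hol[OF fam_Ac p'] p by simp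
  have "Vc \<phi> \<delta> holomorphic_on ball 0 R"
    unfolding Vc_def[abs_def]
    by (intro holomorphic_intros biholD[OF bY[OF p(2)] open_ball] hol_xp hol_vp Ah
        hol_F_comp[OF p(2) hol_family_hol[OF hF p(2)]]
        hol_F_comp[OF p(2) hol_family_hol[OF hol_family_deriv[OF hF] p(2)]]) (use dom_facts[OF p(2)] in auto)
  then show "(case p of (\<phi>, \<delta>) \<Rightarrow> Vc \<phi> \<delta>) holomorphic_on ball 0 R"
    by (simp add: p)
qed

text \<open>Second-order Taylor remainders in \<open>v\<close>. Since \<open>v\<close> has order
  \<open>r^n\<close>, they have order \<open>r^(2n)\<close>, one beyond the leading order
  \<open>2n - 1\<close> of \<open>v'\<close>.\<close>

definition RX :: "real \<Rightarrow> real ^ 'm \<Rightarrow> complex \<Rightarrow> complex" where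
  "RX \<phi> \<delta> r = XC (xp \<phi> r) (FC (xp \<phi> r) \<delta> + vp \<phi> r) \<delta> - XC (xp \<phi> r) (FC (xp \<phi> r) \<delta>) \<delta>
     - Xy (xp \<phi> r) (FC (xp \<phi> r) \<delta>) \<delta> * vp \<phi> r"

definition RY :: "real \<Rightarrow> real ^ 'm \<Rightarrow> complex \<Rightarrow> complex" where
  "RY \<phi> \<delta> r = YC (xp \<phi> r) (FC (xp \<phi> r) \<delta> + vp \<phi> r) \<delta> - YC (xp \<phi> r) (FC (xp \<phi> r) \<delta>) \<delta>
     - Yy (xp \<phi> r) (FC (xp \<phi> r) \<delta>) \<delta> * vp \<phi> r"

lemma remainder_bound:
  obtains C where "0 \<le> C" "\<And>\<phi> \<delta> r. \<delta> \<in> D \<Longrightarrow> norm r < R \<Longrightarrow> norm (RX \<phi> \<delta> r) \<le> C * norm r ^ (2 * n)"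
    "\<And>\<phi> \<delta> r. \<delta> \<in> D \<Longrightarrow> norm r < R \<Longrightarrow> norm (RY \<phi> \<delta> r) \<le> C * norm r ^ (2 * n)"
proof -
  obtain C1 where C1: "C1 \<ge> 0" "\<And>\<delta> x y w. \<delta> \<in> D \<Longrightarrow> norm x \<le> s \<Longrightarrow> norm y \<le> s \<Longrightarrow> norm w \<le> s \<Longrightarrow>
     norm (XC x w \<delta> - XC x y \<delta> - Xy x y \<delta> * (w - y)) \<le> C1 * norm (w - y) ^ 2"
    using Taylor_X by blast
  obtain C2 where C2: "C2 \<ge> 0" "\<And>\<delta> x y w. \<delta> \<in> D \<Longrightarrow> norm x \<le> s \<Longrightarrow> norm y \<le> s \<Longrightarrow> norm w \<le> s \<Longrightarrow>
     norm (YC x w \<delta> - YC x y \<delta> - Yy x y \<delta> * (w - y)) \<le> C2 * norm (w - y) ^ 2"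
    using Taylor_Y by blast
  have v2: "norm (vp \<phi> r) ^ 2 \<le> norm r ^ (2 * n)" if "norm r < R" for \<phi> r
    using power_mono[OF vp_le(1)[OF that, of \<phi>], of 2] by (simp add: power_mult mult.commute[of 2] flip: power_mult)
  have dom: "norm (xp \<phi> r) \<le> s" "norm (FC (xp \<phi> r) \<delta>) \<le> s" "norm (FC (xp \<phi> r) \<delta> + vp \<phi> r) \<le> s"
    if "\<delta> \<in> D" "norm r < R" for \<phi> \<delta> r
    using dom_facts(1)[OF that, of \<phi>] F_small[OF that(1) dom_facts(1)[OF that], of \<phi>]
      Fv_le[OF that(1) dom_facts(1)[OF that] that(2), of \<phi> \<phi>] R s_pos by linarith+
  show ?thesis
  proof (rule that[of "C1 + C2"])
    fix \<phi> \<delta> and r :: complex assume h: "\<delta> \<in> D" "norm r < R"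
    have "norm (RX \<phi> \<delta> r) \<le> C1 * norm (vp \<phi> r) ^ 2"
      using C1(2)[OF h(1) dom[OF h], of \<phi> \<phi> \<phi>] by (simp add: RX_def)
    also have "\<dots> \<le> (C1 + C2) * norm r ^ (2 * n)"
      using C1(1) C2(1) v2[OF h(2)] by (intro mult_mono) auto
    finally show "norm (RX \<phi> \<delta> r) \<le> (C1 + C2) * norm r ^ (2 * n)" .
    have "norm (RY \<phi> \<delta> r) \<le> C2 * norm (vp \<phi> r) ^ 2"
      using C2(2)[OF h(1) dom[OF h], of \<phi> \<phi> \<phi>] by (simp add: RY_def)
    also have "\<dots> \<le> (C1 + C2) * norm r ^ (2 * n)"
      using C1(1) C2(1) v2[OF h(2)] by (intro mult_mono) auto
    finally show "norm (RY \<phi> \<delta> r) \<le> (C1 + C2) * norm r ^ (2 * n)" .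
  qed (use C1 C2 in auto)
qed

lemma ev_R: "\<forall>\<^sub>F x in at_right (0::real). 0 < x \<and> x < e" if "0 < e" for e
  by (rule eventually_at_rightI[OF _ that]) auto

text \<open>\<open>x' = v (1 + Xy) + RX\<close> with \<open>v = - r^n sin \<phi>\<close>, and
  \<open>Xy\<close> tends to 0 at the origin.\<close>

lemma Ac_lim:
  assumes \<delta>: "\<delta> \<in> D"
  shows "((\<lambda>x. Ac \<phi> \<delta> (of_real x) / of_real x ^ n) \<longlongrightarrow> of_real (- sin \<phi>)) (at_right 0)"
proof -
  obtain C where C: "0 \<le> C" "\<And>\<phi> \<delta> r. \<delta> \<in> D \<Longrightarrow> norm r < R \<Longrightarrow> norm (RX \<phi> \<delta> r) \<le> C * norm r ^ (2 * n)"
    using remainder_bound by metis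
  let ?x = "\<lambda>x::real. xp \<phi> (of_real x)"
  have xl: "(?x \<longlongrightarrow> 0) (at_right 0)"
    unfolding xp_def by (auto intro!: tendsto_eq_intros)
  have "isCont (\<lambda>x. FC x \<delta>) 0"
    using hol_family_hol[OF hF \<delta>] R(1)
    by (metis centre_in_ball continuous_on_eq_continuous_at holomorphic_on_imp_continuous_on open_ball)
  from isCont_tendsto_compose[OF this xl]
  have Gl: "((\<lambda>x. FC (?x x) \<delta>) \<longlongrightarrow> 0) (at_right 0)"
    using rF[OF \<delta>, of 0] F0[OF \<delta>] R(1) by simp
  have E: "((\<lambda>x. RX \<phi> \<delta> (of_real x) / of_real x ^ n) \<longlongrightarrow> 0) (at_right 0)"
  proof (rule Lim_null_comparison)
    show "\<forall>\<^sub>F x in at_right 0. norm (RX \<phi> \<delta> (of_real x) / of_real x ^ n) \<le> C * x ^ n"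
      using ev_R[OF R(1)]
    proof eventually_elim
      case (elim x)
      have "norm (RX \<phi> \<delta> (of_real x)) \<le> C * x ^ (2 * n)"
        using C(2)[OF \<delta>, of "of_real x" \<phi>] elim by simp
      then show ?case
        using elim by (simp add: norm_divide norm_power divide_le_eq mult_2 power_add mult.assoc)
    qed
    show "((\<lambda>x. C * x ^ n) \<longlongrightarrow> 0) (at_right 0)"
      using n2 by (auto intro!: tendsto_eq_intros)
  qed
  have "((\<lambda>x. of_real (- sin \<phi>) * (1 + Xy (?x x) (FC (?x x) \<delta>) \<delta>) + RX \<phi> \<delta> (of_real x) / of_real x ^ n)
     \<longlongrightarrow> of_real (- sin \<phi>) * (1 + Xy 0 0 \<delta>) + 0) (at_right 0)"
    using R s_pos by (intro tendsto_intros E Xy_tendsto[OF \<delta> xl Gl]) auto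
  then have "((\<lambda>x. of_real (- sin \<phi>) * (1 + Xy (?x x) (FC (?x x) \<delta>) \<delta>) + RX \<phi> \<delta> (of_real x) / of_real x ^ n)
     \<longlongrightarrow> of_real (- sin \<phi>)) (at_right 0)"
    by (simp add: Xy0[OF \<delta>])
  moreover have "\<forall>\<^sub>F x in at_right 0.
     of_real (- sin \<phi>) * (1 + Xy (?x x) (FC (?x x) \<delta>) \<delta>) + RX \<phi> \<delta> (of_real x) / of_real x ^ n
     = Ac \<phi> \<delta> (of_real x) / of_real x ^ n"
    using ev_R[OF R(1)]
  proof eventually_elim
    case (elim x)
    have "Ac \<phi> \<delta> (of_real x) = vp \<phi> (of_real x) * (1 + Xy (?x x) (FC (?x x) \<delta>) \<delta>) + RX \<phi> \<delta> (of_real x)"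
      by (simp add: Ac_def RX_def algebra_simps)
    then show ?case
      using elim by (simp add: vp_def add_divide_distrib diff_divide_distrib)
  qed
  ultimately show ?thesis by (rule Lim_transform_eventually)
qed

text \<open>Expansion in \<open>v\<close> gives \<open>v' = - g(x) - f(x) v + (RY - F' RX)\<close>:
  the constant term is \<open>Y(x, F) = - g\<close>, and the linear coefficient
  \<open>Yy - F' (1 + Xy)\<close> is \<open>- f\<close> by \<open>F_chain\<close>. At
  \<open>x = r cos \<phi>\<close>, \<open>v = - r^n sin \<phi>\<close> the first two terms have
  order \<open>2n - 1\<close>, and the remainder has order \<open>2n\<close>.\<close>

lemma Vc_lim:
  assumes \<delta>: "\<delta> \<in> D"
  shows "((\<lambda>x. Vc \<phi> \<delta> (of_real x) / of_real x ^ (2 * n - 1)) \<longlongrightarrow>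
     of_real (b \<delta> * cos \<phi> ^ (n - 1) * sin \<phi> - a \<delta> * cos \<phi> ^ (2 * n - 1))) (at_right 0)"
proof -
  obtain C where C: "0 \<le> C" "\<And>\<phi> \<delta> r. \<delta> \<in> D \<Longrightarrow> norm r < R \<Longrightarrow> norm (RX \<phi> \<delta> r) \<le> C * norm r ^ (2 * n)"
    "\<And>\<phi> \<delta> r. \<delta> \<in> D \<Longrightarrow> norm r < R \<Longrightarrow> norm (RY \<phi> \<delta> r) \<le> C * norm r ^ (2 * n)"
    using remainder_bound by metis
  obtain B where B: "0 < B" "\<And>\<delta> x. \<delta> \<in> D \<Longrightarrow> norm x \<le> R/2 \<Longrightarrow> norm (F' x \<delta>) \<le> B"
    using hol_family_bounded[OF hol_family_deriv[OF hF] compact_D, of "R/2"] R(1) by auto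
  let ?x = "\<lambda>x::real. xp \<phi> (of_real x)"
  let ?E = "\<lambda>x::real. RY \<phi> \<delta> (of_real x) - F' (?x x) \<delta> * RX \<phi> \<delta> (of_real x)"
  have E: "((\<lambda>x. ?E x / of_real x ^ (2 * n - 1)) \<longlongrightarrow> 0) (at_right 0)"
  proof (rule Lim_null_comparison)
    show "\<forall>\<^sub>F x in at_right 0. norm (?E x / of_real x ^ (2 * n - 1)) \<le> (1 + B) * C * x"
      using ev_R[OF half_gt_zero[OF R(1)]]
    proof eventually_elim
      case (elim x)
      have F'b: "norm (F' (?x x) \<delta>) \<le> B"
        using B(2)[OF \<delta>, of "?x x"] xp_le[of \<phi> "of_real x"] elim by simp
      have "norm (?E x) \<le> norm (RY \<phi> \<delta> (of_real x)) + norm (F' (?x x) \<delta>) * norm (RX \<phi> \<delta> (of_real x))"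
        by (metis norm_mult norm_triangle_ineq4)
      also have "\<dots> \<le> C * x ^ (2 * n) + B * (C * x ^ (2 * n))"
        using C(2,3)[OF \<delta>, of "of_real x" \<phi>] elim F'b B(1) R(1) by (intro add_mono mult_mono) auto
      also have "\<dots> = (1 + B) * C * x * x ^ (2 * n - 1)"
        using n2 by (cases n) (simp_all add: algebra_simps)
      finally show ?case
        using elim by (simp add: norm_divide norm_power divide_le_eq)
    qed
    show "((\<lambda>x. (1 + B) * C * x) \<longlongrightarrow> 0) (at_right 0)"
      by (auto intro!: tendsto_eq_intros)
  qed
  let ?g = "\<lambda>x. g_fun Y F x \<delta>" and ?f = "\<lambda>x. f_fun X Y F x \<delta>"
  have g: "((\<lambda>x. ?g (x * cos \<phi>) / x ^ (2 * n - 1)) \<longlongrightarrow> a \<delta> * cos \<phi> ^ (2 * n - 1)) (at_right 0)"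
    by (rule tendsto_power_quotient_scale[OF g_lim[OF \<delta>]])
      (use n2 F0[OF \<delta>] Y0[OF \<delta>] in \<open>auto simp: g_fun_def\<close>)
  have f: "((\<lambda>x. ?f (x * cos \<phi>) / x ^ (n - 1)) \<longlongrightarrow> b \<delta> * cos \<phi> ^ (n - 1)) (at_right 0)"
    by (rule tendsto_power_quotient_scale[OF f_lim[OF \<delta>]]) (use n2 f0[OF \<delta>] in auto)
  have "((\<lambda>x. of_real (- (?g (x * cos \<phi>) / x ^ (2 * n - 1))) +
      of_real (?f (x * cos \<phi>) / x ^ (n - 1)) * of_real (sin \<phi>) + ?E x / of_real x ^ (2 * n - 1))
     \<longlongrightarrow> of_real (- (a \<delta> * cos \<phi> ^ (2 * n - 1))) + of_real (b \<delta> * cos \<phi> ^ (n - 1)) * of_real (sin \<phi>) + 0)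
     (at_right 0)"
    by (intro tendsto_intros g f E)
  moreover have "of_real (- (a \<delta> * cos \<phi> ^ (2 * n - 1))) + of_real (b \<delta> * cos \<phi> ^ (n - 1)) * of_real (sin \<phi>) + 0
     = complex_of_real (b \<delta> * cos \<phi> ^ (n - 1) * sin \<phi> - a \<delta> * cos \<phi> ^ (2 * n - 1))"
    by simp
  moreover have "\<forall>\<^sub>F x in at_right 0. of_real (- (?g (x * cos \<phi>) / x ^ (2 * n - 1))) +
      of_real (?f (x * cos \<phi>) / x ^ (n - 1)) * of_real (sin \<phi>) + ?E x / of_real x ^ (2 * n - 1)
      = Vc \<phi> \<delta> (of_real x) / of_real x ^ (2 * n - 1)"
    using ev_R[OF R(1)]
  proof eventually_elim
    case (elim x)
    define X0 where "X0 = x * cos \<phi>"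
    have xX: "?x x = of_real X0" by (simp add: xp_def X0_def)
    have nx: "norm (complex_of_real x) < R" using elim by simp
    note df = dom_facts[OF \<delta> nx, of \<phi>]
    have X0: "\<bar>X0\<bar> < R" "\<bar>X0\<bar> < \<rho>" using df(1,2) by (simp_all add: xX)
    have FX: "FC (?x x) \<delta> = of_real (F X0 \<delta>)" using rF[OF \<delta> X0(1)] by (simp add: xX)
    have FX0: "\<bar>F X0 \<delta>\<bar> < \<rho>" using df(3) by (simp add: FX)
    have Yx: "YC (?x x) (FC (?x x) \<delta>) \<delta> = - of_real (?g X0)"
      unfolding FX unfolding xX using rY[OF \<delta> X0(2) FX0] by (simp add: g_fun_def)
    have Yd: "Yy (?x x) (FC (?x x) \<delta>) \<delta> = of_real (deriv (\<lambda>v. Y X0 v \<delta>) (F X0 \<delta>))"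
      unfolding FX unfolding xX
      by (rule real_deriv_of_holomorphic(2)[OF _ FX0])
        (use hol_family_hol[OF famYy, of "(of_real X0, \<delta>)"] X0 \<delta> rY[OF \<delta> X0(2)] in auto)
    have Xd: "Xx (?x x) (FC (?x x) \<delta>) \<delta> = of_real (deriv (\<lambda>u. X u (F X0 \<delta>) \<delta>) X0)"
      unfolding FX unfolding xX
      by (rule real_deriv_of_holomorphic(2)[OF _ X0(2)])
        (use hol_family_hol[OF famXx, of "(of_real (F X0 \<delta>), \<delta>)"] FX0 \<delta> rX[OF \<delta> _ FX0] in auto)
    \<comment> \<open>\<open>F_chain\<close> replaces the \<open>Xx\<close> in \<open>f\<close> by
      \<open>- F' (1 + Xy)\<close>, which is the coefficient that \<open>F'(x) x'\<close>
      contributes to \<open>Vc\<close>.\<close>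
    have ff: "of_real (?f X0) = F' (?x x) \<delta> * (1 + Xy (?x x) (FC (?x x) \<delta>) \<delta>) - Yy (?x x) (FC (?x x) \<delta>) \<delta>"
      using F_chain[OF \<delta> df(1)] unfolding Yd Xd by (simp add: f_fun_def) (metis add_eq_0_iff diff_conv_add_uminus minus_add_distrib)
    have VV: "Vc \<phi> \<delta> (of_real x) = - of_real (?g X0) - of_real (?f X0) * vp \<phi> (of_real x) + ?E x"
      unfolding ff Yx[symmetric] by (simp add: Vc_def Ac_def RX_def RY_def algebra_simps)
    have vv: "vp \<phi> (of_real x) / of_real x ^ (2 * n - 1) = - of_real (sin \<phi>) / of_real x ^ (n - 1)"
    proof -
      have "2 * n - 1 = n + (n - 1)" using n2 by simp
      then show ?thesis using elim by (simp add: vp_def power_add)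
    qed
    have "Vc \<phi> \<delta> (of_real x) / of_real x ^ (2 * n - 1) = - of_real (?g X0) / of_real x ^ (2 * n - 1)
        - of_real (?f X0) * (vp \<phi> (of_real x) / of_real x ^ (2 * n - 1)) + ?E x / of_real x ^ (2 * n - 1)"
      unfolding VV by (simp add: add_divide_distrib diff_divide_distrib)
    then show ?case
      unfolding vv X0_def[symmetric] by simp
  qed
  ultimately show ?thesis
    using Lim_transform_eventually by fastforce
qed

end

section \<open>The angular equation and its flow\<close>

context complex_system
begin

text \<open>With \<open>v = y - F(x)\<close> the system reads \<open>x' = r\<^sup>n A1\<close>, \<open>v' = r\<^bsup>2n-1\<^esup> V1\<close>.  Solving for \<open>r'\<close> and \<open>\<phi>'\<close>
  gives \<open>(cos\<^sup>2 \<phi> + n sin\<^sup>2 \<phi>) \<phi>' = r\<^bsup>n-1\<^esup> Wc\<close> and \<open>dr/d\<phi> = r Hc\<close>.\<close>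

definition A1 :: "real \<Rightarrow> real ^ 'm \<Rightarrow> complex \<Rightarrow> complex" where
  "A1 \<phi> \<delta> r = (if r = 0 then of_real (- sin \<phi>) else Ac \<phi> \<delta> r / r ^ n)"

definition V1 :: "real \<Rightarrow> real ^ 'm \<Rightarrow> complex \<Rightarrow> complex" where
  "V1 \<phi> \<delta> r = (if r = 0 then of_real (b \<delta> * cos \<phi> ^ (n - 1) * sin \<phi> - a \<delta> * cos \<phi> ^ (2 * n - 1))
     else Vc \<phi> \<delta> r / r ^ (2 * n - 1))"

definition Wc :: "real \<Rightarrow> real ^ 'm \<Rightarrow> complex \<Rightarrow> complex" where
  "Wc \<phi> \<delta> r = - (of_nat n * of_real (sin \<phi>) * A1 \<phi> \<delta> r + of_real (cos \<phi>) * V1 \<phi> \<delta> r)"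

definition Hc :: "real \<Rightarrow> real ^ 'm \<Rightarrow> complex \<Rightarrow> complex" where
  "Hc \<phi> \<delta> r = (of_real (cos \<phi>) * A1 \<phi> \<delta> r - of_real (sin \<phi>) * V1 \<phi> \<delta> r) / Wc \<phi> \<delta> r"

lemma fam_A1: "hol_family (UNIV \<times> D) R (\<lambda>(\<phi>, \<delta>). A1 \<phi> \<delta>)"
proof -
  have "hol_family (UNIV \<times> D) R (\<lambda>p z. if z = 0 then (\<lambda>(\<phi>, \<delta>). of_real (- sin \<phi>)) p
      else (\<lambda>(\<phi>, \<delta>). Ac \<phi> \<delta>) p z / z ^ n)"
    by (rule hol_family_quotient[OF fam_Ac R(1)]) (use Ac_lim in auto)
  then show ?thesis
    by (rule hol_family_cong) (auto simp: A1_def)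
qed

lemma fam_V1: "hol_family (UNIV \<times> D) R (\<lambda>(\<phi>, \<delta>). V1 \<phi> \<delta>)"
proof -
  have "hol_family (UNIV \<times> D) R (\<lambda>p z. if z = 0 then
      (\<lambda>(\<phi>, \<delta>). of_real (b \<delta> * cos \<phi> ^ (n - 1) * sin \<phi> - a \<delta> * cos \<phi> ^ (2 * n - 1))) p
      else (\<lambda>(\<phi>, \<delta>). Vc \<phi> \<delta>) p z / z ^ (2 * n - 1))"
    by (rule hol_family_quotient[OF fam_Vc R(1)]) (use Vc_lim in auto)
  then show ?thesis
    by (rule hol_family_cong) (auto simp: V1_def)
qed

lemma cont_A1: "continuous_on ((UNIV \<times> D) \<times> ball 0 R) (\<lambda>q. A1 (fst (fst q)) (snd (fst q)) (snd q))"
  and cont_V1: "continuous_on ((UNIV \<times> D) \<times> ball 0 R) (\<lambda>q. V1 (fst (fst q)) (snd (fst q)) (snd q))"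
  using hol_family_cont[OF fam_A1] hol_family_cont[OF fam_V1] by (simp_all add: split_beta)

lemma cont_trig:
  "continuous_on (S :: ((real \<times> (real ^ 'm)) \<times> complex) set) (\<lambda>q. complex_of_real (cos (fst (fst q))))"
  "continuous_on (S :: ((real \<times> (real ^ 'm)) \<times> complex) set) (\<lambda>q. complex_of_real (sin (fst (fst q))))"
  by (intro continuous_intros)+

lemma cont_Wc: "continuous_on ((UNIV \<times> D) \<times> ball 0 R) (\<lambda>q. Wc (fst (fst q)) (snd (fst q)) (snd q))"
  unfolding Wc_def by (intro continuous_intros cont_A1 cont_V1 cont_trig)

lemma hol_A1: "\<delta> \<in> D \<Longrightarrow> A1 \<phi> \<delta> holomorphic_on ball 0 R"
  and hol_V1: "\<delta> \<in> D \<Longrightarrow> V1 \<phi> \<delta> holomorphic_on ball 0 R"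
  using hol_family_hol[OF fam_A1, of "(\<phi>, \<delta>)"] hol_family_hol[OF fam_V1, of "(\<phi>, \<delta>)"] by auto

lemma hol_Wc: "\<delta> \<in> D \<Longrightarrow> Wc \<phi> \<delta> holomorphic_on ball 0 R"
  unfolding Wc_def[abs_def] by (intro holomorphic_intros hol_A1 hol_V1)

lemma Wc_0: "Wc \<phi> \<delta> 0 = of_real (n * sin \<phi> ^ 2 - b \<delta> * cos \<phi> ^ n * sin \<phi> + a \<delta> * cos \<phi> ^ (2 * n))"
proof -
  have "cos \<phi> ^ n = cos \<phi> * cos \<phi> ^ (n - 1)" "cos \<phi> ^ (2 * n) = cos \<phi> * cos \<phi> ^ (2 * n - 1)"
    using n2 by (simp_all flip: power_Suc)
  then show ?thesis
    by (simp add: Wc_def A1_def V1_def power2_eq_square algebra_simps)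
qed

text \<open>This is where the focus-or-center condition \<open>b\<^sup>2 < 4na\<close> enters: the quadratic form in
  \<open>(sin \<phi>, cos\<^sup>n \<phi>)\<close> is positive definite.\<close>

lemma Wc_0_pos:
  assumes \<delta>: "\<delta> \<in> D"
  shows "0 < Re (Wc \<phi> \<delta> 0)"
proof -
  define u where "u = cos \<phi> ^ n"
  define v where "v = sin \<phi>"
  have w: "Re (Wc \<phi> \<delta> 0) = n * v ^ 2 - b \<delta> * u * v + a \<delta> * u ^ 2"
  proof -
    have "cos \<phi> ^ (2 * n) = u ^ 2"
      unfolding u_def by (metis mult.commute power_mult)
    then show ?thesis
      unfolding Wc_0 Re_complex_of_real by (simp add: u_def v_def)
  qed
  \<comment> \<open>Completing the square after multiplication by \<open>4 * a \<delta>\<close>; the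
    coefficient left over at \<open>v^2\<close> is the negative of the discriminant. If
    \<open>v = 0\<close>, then \<open>cos \<phi>\<close> and hence \<open>u\<close> is nonzero, and
    the square itself is positive.\<close>
  have "4 * a \<delta> * (n * v ^ 2 - b \<delta> * u * v + a \<delta> * u ^ 2) =
      (2 * a \<delta> * u - b \<delta> * v) ^ 2 + (4 * real n * a \<delta> - (b \<delta>) ^ 2) * v ^ 2"
    by (simp add: power2_eq_square algebra_simps)
  moreover have "0 < (2 * a \<delta> * u - b \<delta> * v) ^ 2 + (4 * real n * a \<delta> - (b \<delta>) ^ 2) * v ^ 2"
  proof (cases "v = 0")
    case True
    then have "cos \<phi> \<noteq> 0" using sin_zero_norm_cos_one[of \<phi>] by (auto simp: v_def)
    then have "2 * a \<delta> * u - b \<delta> * v \<noteq> 0" using True a_pos[OF \<delta>] by (simp add: u_def)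
    then show ?thesis using True by simp
  next
    case False
    then show ?thesis using disc[OF \<delta>] by (intro add_nonneg_pos mult_pos_pos) auto
  qed
  ultimately have "0 < 4 * a \<delta> * (n * v ^ 2 - b \<delta> * u * v + a \<delta> * u ^ 2)"
    by linarith
  then show ?thesis
    unfolding w by (rule zero_less_mult_pos) (simp add: a_pos[OF \<delta>])
qed

abbreviation J :: "real set" where "J \<equiv> {-7..7}"

text \<open>At \<open>r = 0\<close> the real part of \<open>Wc\<close> has a positive minimum
  \<open>m\<close> on the compact \<open>J \<times> D\<close>, and within \<open>d\<close> of 0 it
  changes by less than \<open>m\<close>. So the denominator of \<open>Hc\<close> does not vanish for
  small complex \<open>r\<close>.\<close>

lemma Wc_pos_near:
  obtains R1 where "0 < R1" "R1 \<le> R / 2"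
    "\<And>\<phi> \<delta> r. \<phi> \<in> J \<Longrightarrow> \<delta> \<in> D \<Longrightarrow> norm r < R1 \<Longrightarrow> 0 < Re (Wc \<phi> \<delta> r)"
proof (cases "D = {}")
  case True
  then show ?thesis using that[of "R/2"] R(1) by auto
next
  case False
  let ?P = "J \<times> D"
  have cP: "compact ?P" by (intro compact_Times compact_Icc compact_D)
  have "continuous_on ?P ((\<lambda>q. Wc (fst (fst q)) (snd (fst q)) (snd q)) \<circ> (\<lambda>p. (p, 0)))"
    by (intro continuous_on_compose continuous_intros continuous_on_subset[OF cont_Wc]) (use R in auto)
  then have "continuous_on ?P (\<lambda>p. Re (Wc (fst p) (snd p) 0))"
    by (intro continuous_intros) (simp add: o_def)
  moreover have neP: "?P \<noteq> {}" using False by auto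
  ultimately obtain p0 where p0: "p0 \<in> ?P" "\<And>p. p \<in> ?P \<Longrightarrow> Re (Wc (fst p0) (snd p0) 0) \<le> Re (Wc (fst p) (snd p) 0)"
    using continuous_attains_inf[OF cP neP] by blast
  define m where "m = Re (Wc (fst p0) (snd p0) 0)"
  have m: "0 < m" using Wc_0_pos p0(1) by (auto simp: m_def)
  have cW: "continuous_on (cball 0 (R/2) \<times> ?P) (\<lambda>(r, p). Wc (fst p) (snd p) r)"
  proof -
    have "continuous_on (cball 0 (R/2) \<times> ?P)
       ((\<lambda>q. Wc (fst (fst q)) (snd (fst q)) (snd q)) \<circ> (\<lambda>q. (snd q, fst q)))"
      by (intro continuous_on_compose continuous_intros continuous_on_subset[OF cont_Wc]) (use R in auto)
    then show ?thesis by (simp add: o_def split_beta)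
  qed
  have "0 \<in> cball (0::complex) (R/2)" using R by simp
  from continuous_on_uniform_near[OF cW compact_cball cP this m]
  obtain d where d: "0 < d" "\<forall>r\<in>cball 0 (R/2). \<forall>p\<in>?P. dist r 0 < d \<longrightarrow>
      dist (Wc (fst p) (snd p) r) (Wc (fst p) (snd p) 0) < m"
    by auto
  show ?thesis
  proof (rule that[of "min d (R/2)"])
    fix \<phi> \<delta> and r :: complex assume h: "\<phi> \<in> J" "\<delta> \<in> D" "norm r < min d (R/2)"
    then have "norm (Wc \<phi> \<delta> r - Wc \<phi> \<delta> 0) < m"
      using d(2)[rule_format, of r "(\<phi>, \<delta>)"] by (simp add: dist_norm)
    then have "\<bar>Re (Wc \<phi> \<delta> r) - Re (Wc \<phi> \<delta> 0)\<bar> < m"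
      using abs_Re_le_cmod[of "Wc \<phi> \<delta> r - Wc \<phi> \<delta> 0"] by simp
    then show "0 < Re (Wc \<phi> \<delta> r)"
      using p0(2)[of "(\<phi>, \<delta>)"] h by (simp add: m_def)
  qed (use d R in auto)
qed

section \<open>Restriction to real \<open>r\<close>\<close>

definition yr :: "real \<Rightarrow> real ^ 'm \<Rightarrow> real \<Rightarrow> real" where
  "yr \<phi> \<delta> r = F (r * cos \<phi>) \<delta> - r ^ n * sin \<phi>"

definition Ar :: "real \<Rightarrow> real ^ 'm \<Rightarrow> real \<Rightarrow> real" where
  "Ar \<phi> \<delta> r = yr \<phi> \<delta> r + X (r * cos \<phi>) (yr \<phi> \<delta> r) \<delta>"

definition Vr :: "real \<Rightarrow> real ^ 'm \<Rightarrow> real \<Rightarrow> real" where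
  "Vr \<phi> \<delta> r = Y (r * cos \<phi>) (yr \<phi> \<delta> r) \<delta> - deriv (\<lambda>x. F x \<delta>) (r * cos \<phi>) * Ar \<phi> \<delta> r"

lemma F_real_deriv:
  assumes "\<delta> \<in> D" "\<bar>x\<bar> < R"
  shows "((\<lambda>x. F x \<delta>) has_real_derivative deriv (\<lambda>x. F x \<delta>) x) (at x)"
    "F' (of_real x) \<delta> = of_real (deriv (\<lambda>x. F x \<delta>) x)"
  using real_deriv_of_holomorphic[OF hol_family_hol[OF hF assms(1)] assms(2) rF[OF assms(1)]] by auto

lemma Ac_real:
  assumes \<delta>: "\<delta> \<in> D" and r: "\<bar>r\<bar> < R"
  shows "Ac \<phi> \<delta> (of_real r) = of_real (Ar \<phi> \<delta> r)" "Vc \<phi> \<delta> (of_real r) = of_real (Vr \<phi> \<delta> r)"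
    "\<bar>yr \<phi> \<delta> r\<bar> < \<rho>" "\<bar>yr \<phi> \<delta> r\<bar> \<le> s"
proof -
  define x where "x = r * cos \<phi>"
  have nr: "norm (complex_of_real r) < R" using r by simp
  note df = dom_facts[OF \<delta> nr, of \<phi>]
  have xx: "xp \<phi> (of_real r) = of_real x" by (simp add: xp_def x_def)
  have x: "\<bar>x\<bar> < R" "\<bar>x\<bar> < \<rho>" using df(1,2) by (simp_all add: xx)
  note Fx = rF[OF \<delta> x(1)]
  have yy: "FC (of_real x) \<delta> + vp \<phi> (of_real r) = of_real (yr \<phi> \<delta> r)"
    by (simp add: Fx yr_def vp_def flip: x_def)
  show y: "\<bar>yr \<phi> \<delta> r\<bar> < \<rho>" using df(4) by (simp only: xx yy) simp
  show "\<bar>yr \<phi> \<delta> r\<bar> \<le> s" using Fv_le[OF \<delta> df(1) nr, of \<phi>] by (simp only: xx yy) simp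
  have "XC (of_real x) (FC (of_real x) \<delta>) \<delta> = - FC (of_real x) \<delta>"
    using F_eq[OF \<delta>, of "of_real x"] x by (simp add: add_eq_0_iff)
  then have "Ac \<phi> \<delta> (of_real r) = of_real (yr \<phi> \<delta> r) + XC (of_real x) (of_real (yr \<phi> \<delta> r)) \<delta>"
    unfolding Ac_def xx yy by (simp add: yy[symmetric])
  then show A: "Ac \<phi> \<delta> (of_real r) = of_real (Ar \<phi> \<delta> r)"
    using rX[OF \<delta> x(2) y] by (simp add: Ar_def x_def)
  show "Vc \<phi> \<delta> (of_real r) = of_real (Vr \<phi> \<delta> r)"
    unfolding Vc_def xx yy A F_real_deriv(2)[OF \<delta> x(1)] using rY[OF \<delta> x(2) y] by (simp add: Vr_def x_def)
qed

definition Wr :: "real \<Rightarrow> real ^ 'm \<Rightarrow> real \<Rightarrow> real" where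
  "Wr \<phi> \<delta> r = Re (Wc \<phi> \<delta> (of_real r))"

definition Hr :: "real \<Rightarrow> real ^ 'm \<Rightarrow> real \<Rightarrow> real" where
  "Hr \<phi> \<delta> r = Re (Hc \<phi> \<delta> (of_real r))"

lemma A1_real:
  assumes "\<delta> \<in> D" "\<bar>r\<bar> < R"
  shows "A1 \<phi> \<delta> (of_real r) \<in> \<real>" "V1 \<phi> \<delta> (of_real r) \<in> \<real>"
  unfolding A1_def V1_def by (auto simp: Ac_real[OF assms] simp flip: of_real_power)

lemma Hc_real:
  assumes "\<delta> \<in> D" "\<bar>r\<bar> < R"
  shows "Hc \<phi> \<delta> (of_real r) = of_real (Hr \<phi> \<delta> r)"
proof -
  have "Hc \<phi> \<delta> (of_real r) \<in> \<real>"
    unfolding Hc_def Wc_def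
    by (intro Reals_divide Reals_diff Reals_mult Reals_add Reals_of_real Reals_minus A1_real assms Reals_of_nat)
  then show ?thesis by (simp add: Hr_def)
qed

lemma Wr_eq:
  assumes "\<delta> \<in> D" "\<bar>r\<bar> < R" "r \<noteq> 0"
  shows "Wr \<phi> \<delta> r = - (n * sin \<phi> * (Ar \<phi> \<delta> r / r ^ n) + cos \<phi> * (Vr \<phi> \<delta> r / r ^ (2 * n - 1)))"
proof -
  have "Wc \<phi> \<delta> (of_real r) = of_real (- (n * sin \<phi> * (Ar \<phi> \<delta> r / r ^ n) + cos \<phi> * (Vr \<phi> \<delta> r / r ^ (2 * n - 1))))"
    using assms by (simp add: Wc_def A1_def V1_def Ac_real)
  then show ?thesis unfolding Wr_def by (simp only: Re_complex_of_real)
qed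

lemma Hr_eq:
  assumes "\<delta> \<in> D" "\<bar>r\<bar> < R" "r \<noteq> 0"
  shows "Hr \<phi> \<delta> r = (cos \<phi> * (Ar \<phi> \<delta> r / r ^ n) - sin \<phi> * (Vr \<phi> \<delta> r / r ^ (2 * n - 1))) / Wr \<phi> \<delta> r"
proof -
  have W: "Wc \<phi> \<delta> (of_real r) = of_real (Wr \<phi> \<delta> r)"
    unfolding Wr_eq[OF assms] using assms by (simp add: Wc_def A1_def V1_def Ac_real)
  have "Hc \<phi> \<delta> (of_real r) = of_real ((cos \<phi> * (Ar \<phi> \<delta> r / r ^ n) - sin \<phi> * (Vr \<phi> \<delta> r / r ^ (2 * n - 1))) / Wr \<phi> \<delta> r)"
    using assms unfolding Hc_def W by (simp add: A1_def V1_def Ac_real)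
  then show ?thesis unfolding Hr_def by (simp only: Re_complex_of_real)
qed

text \<open>All facts about real trajectories are put into one statement so that \<open>R1\<close>,
  \<open>M\<close> and \<open>L\<close> are fixed before \<delta>. The trajectory is
  \<open>x * exp (u \<phi> \<delta> x)\<close>, obtained from \<open>exp_picard\<close> with
  \<open>T = 7\<close>; at the angle \<open>2 * pi\<close> it is the restriction of a holomorphic
  function of the initial value, whose Taylor coefficients at 0 yield \<open>v\<close>.\<close>

lemma flow_exists:
  "\<exists>R1 M L u. 0 < R1 \<and> R1 \<le> R / 2 \<and> 0 \<le> M \<and> 0 \<le> L \<and> (\<forall>\<delta>\<in>D.
     (\<forall>\<phi>\<in>J. \<forall>r. \<bar>r\<bar> < R1 \<longrightarrow> 0 < Wr \<phi> \<delta> r) \<and>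
     (\<forall>\<phi>\<in>J. \<forall>r r'. \<bar>r\<bar> < R1 \<longrightarrow> \<bar>r'\<bar> < R1 \<longrightarrow> \<bar>Hr \<phi> \<delta> r - Hr \<phi> \<delta> r'\<bar> \<le> L * \<bar>r - r'\<bar>) \<and>
     (\<forall>\<phi>\<in>J. \<forall>r. \<bar>r\<bar> < R1 \<longrightarrow> \<bar>Hr \<phi> \<delta> r\<bar> \<le> M) \<and>
     continuous_on (J \<times> {-R1<..<R1}) (\<lambda>(\<phi>, r). Wr \<phi> \<delta> r) \<and>
     (\<forall>x. \<bar>x\<bar> < R1 * exp (- (M * 7)) \<longrightarrow> u 0 \<delta> x = 0 \<and> (\<forall>\<phi>\<in>J. \<bar>u \<phi> \<delta> x\<bar> \<le> M * 7 \<and>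
        ((\<lambda>\<phi>. u \<phi> \<delta> x) has_real_derivative Hr \<phi> \<delta> (x * exp (u \<phi> \<delta> x))) (at \<phi> within J))) \<and>
     (\<exists>v. \<forall>x. \<bar>x\<bar> < R1 * exp (- (M * 7)) \<longrightarrow>
        (\<lambda>j. v (Suc j) * x ^ Suc j) sums (x * exp (u (2 * pi) \<delta> x) - x)) \<and>
     ((\<lambda>x. x * exp (u (2 * pi) \<delta> x)) has_real_derivative exp (u (2 * pi) \<delta> 0)) (at 0))"
proof -
  obtain R0 where R0: "0 < R0" "R0 \<le> R / 2"
    "\<And>\<phi> \<delta> r. \<phi> \<in> J \<Longrightarrow> \<delta> \<in> D \<Longrightarrow> norm r < R0 \<Longrightarrow> 0 < Re (Wc \<phi> \<delta> r)"
    using Wc_pos_near by blast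
  have W0: "Wc \<phi> \<delta> r \<noteq> 0" if "\<phi> \<in> J" "\<delta> \<in> D" "norm r < R0" for \<phi> \<delta> r
    using R0(3)[OF that] by auto
  have sub: "(J \<times> D) \<times> ball 0 R0 \<subseteq> (UNIV \<times> D) \<times> ball (0::complex) R"
    using R0 R(1) by auto
  have fam: "hol_family (J \<times> D) R0 (\<lambda>(\<phi>, \<delta>). Hc \<phi> \<delta>)"
    unfolding hol_family_def
  proof (intro conjI ballI)
    have "continuous_on ((J \<times> D) \<times> ball 0 R0) (\<lambda>q. Hc (fst (fst q)) (snd (fst q)) (snd q))"
      unfolding Hc_def
      by (intro continuous_intros cont_trig continuous_on_subset[OF cont_A1 sub]
          continuous_on_subset[OF cont_V1 sub] continuous_on_subset[OF cont_Wc sub]) (use W0 in auto)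
    then show "continuous_on ((J \<times> D) \<times> ball 0 R0) (\<lambda>(p, r). (case p of (\<phi>, \<delta>) \<Rightarrow> Hc \<phi> \<delta>) r)"
      by (simp add: split_beta)
    fix p assume "p \<in> J \<times> D"
    then obtain \<phi> \<delta> where p: "p = (\<phi>, \<delta>)" "\<phi> \<in> J" "\<delta> \<in> D" by auto
    have sb: "ball 0 R0 \<subseteq> ball (0::complex) R" using R0 R(1) by auto
    have "Hc \<phi> \<delta> holomorphic_on ball 0 R0"
      unfolding Hc_def[abs_def]
      by (intro holomorphic_intros holomorphic_on_subset[OF hol_A1[OF p(3)] sb]
          holomorphic_on_subset[OF hol_V1[OF p(3)] sb] holomorphic_on_subset[OF hol_Wc[OF p(3)] sb])
        (use W0 p in auto)
    then show "(case p of (\<phi>, \<delta>) \<Rightarrow> Hc \<phi> \<delta>) holomorphic_on ball 0 R0" by (simp add: p)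
  qed
  have cP: "compact (J \<times> D)" by (intro compact_Times compact_Icc compact_D)
  \<comment> \<open>The closed disc of radius \<open>R1\<close> lies inside the open one of radius
    \<open>R0\<close>, so the bounds \<open>M\<close> and \<open>L\<close> exist by
    compactness.\<close>
  define R1 where "R1 = R0 / 2"
  have R1: "0 < R1" "R1 < R0" "R1 \<le> R / 2" "R1 < R" using R0 R(1) by (auto simp: R1_def)
  obtain M where M: "0 < M" "\<And>\<phi> \<delta> r. \<phi> \<in> J \<Longrightarrow> \<delta> \<in> D \<Longrightarrow> norm r \<le> R1 \<Longrightarrow> norm (Hc \<phi> \<delta> r) \<le> M"
    using hol_family_bounded[OF fam cP R1(2)] by (metis (no_types, lifting) SigmaI case_prod_conv)
  obtain L where L: "0 < L" "\<And>\<phi> \<delta> r r'. \<phi> \<in> J \<Longrightarrow> \<delta> \<in> D \<Longrightarrow> norm r \<le> R1 \<Longrightarrow> norm r' \<le> R1 \<Longrightarrow>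
      norm (Hc \<phi> \<delta> r - Hc \<phi> \<delta> r') \<le> L * norm (r - r')"
    using hol_family_Lipschitz[OF fam cP R1(2)] by (metis (no_types, lifting) SigmaI case_prod_conv)
  define \<rho>0 where "\<rho>0 = R1 * exp (- (M * 7))"
  have \<rho>0: "0 < \<rho>0" using R1 by (simp add: \<rho>0_def)
  have "\<exists>u. hol_family J \<rho>0 u \<and> (\<forall>z\<in>ball 0 \<rho>0. u 0 z = 0 \<and> (\<forall>t\<in>J. norm (u t z) \<le> M * 7 \<and>
      ((\<lambda>t. u t z) has_vector_derivative Hc t \<delta> (z * exp (u t z))) (at t within J))) \<and>
      (\<forall>t\<in>J. \<forall>x. \<bar>x\<bar> < \<rho>0 \<longrightarrow> u t (of_real x) \<in> \<real>)" if \<delta>: "\<delta> \<in> D" for \<delta>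
  proof (rule exp_picard)
    show "hol_family J R1 (\<lambda>t. Hc t \<delta>)"
      unfolding hol_family_def
    proof (intro conjI ballI)
      have "continuous_on (J \<times> ball 0 R1) ((\<lambda>(p, r). (case p of (\<phi>, \<delta>) \<Rightarrow> Hc \<phi> \<delta>) r) \<circ> (\<lambda>q. ((fst q, \<delta>), snd q)))"
        by (intro continuous_on_compose continuous_intros continuous_on_subset[OF hol_family_cont[OF fam]])
          (use \<delta> R1 in auto)
      then show "continuous_on (J \<times> ball 0 R1) (\<lambda>(p, z). Hc p \<delta> z)"
        by (simp add: o_def split_beta)
      show "Hc p \<delta> holomorphic_on ball 0 R1" if "p \<in> J" for p
        using holomorphic_on_subset[OF hol_family_hol[OF fam, of "(p, \<delta>)"] subset_ball[OF less_imp_le[OF R1(2)]]]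
          that \<delta> by simp
    qed
    show "Hc t \<delta> (of_real x) \<in> \<real>" if "\<bar>x\<bar> < R1" for t x
      using Hc_real[OF \<delta>, of x t] that R1 by simp
    show "norm (Hc t \<delta> z) \<le> M" if "t \<in> J" "norm z < R1" for t z
      using M(2)[OF that(1) \<delta>] that by simp
    show "norm (Hc t \<delta> z - Hc t \<delta> w) \<le> L * norm (z - w)"
      if "t \<in> J" "norm z < R1" "norm w < R1" for t z w
      using L(2)[OF that(1) \<delta>] that by simp
  qed (use L R1 \<rho>0_def in auto)
  then obtain U where U: "\<And>\<delta>. \<delta> \<in> D \<Longrightarrow> hol_family J \<rho>0 (U \<delta>) \<and> (\<forall>z\<in>ball 0 \<rho>0. U \<delta> 0 z = 0 \<and>
      (\<forall>t\<in>J. norm (U \<delta> t z) \<le> M * 7 \<and>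
      ((\<lambda>t. U \<delta> t z) has_vector_derivative Hc t \<delta> (z * exp (U \<delta> t z))) (at t within J))) \<and>
      (\<forall>t\<in>J. \<forall>x. \<bar>x\<bar> < \<rho>0 \<longrightarrow> U \<delta> t (of_real x) \<in> \<real>)"
    by metis
  define u where "u = (\<lambda>\<phi> \<delta> x. Re (U \<delta> \<phi> (of_real x)))"
  have Uu: "U \<delta> \<phi> (of_real x) = of_real (u \<phi> \<delta> x)" if "\<delta> \<in> D" "\<phi> \<in> J" "\<bar>x\<bar> < \<rho>0" for \<delta> \<phi> x
    using U[OF that(1)] that by (auto simp: u_def)
  have pi7: "2 * pi \<in> J" using pi_less_4 pi_gt_zero pi_approx by auto
  show ?thesis
  proof (rule exI[of _ R1], rule exI[of _ M], rule exI[of _ L], rule exI[of _ u], intro conjI ballI R1(1,3) less_imp_le[OF M(1)]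
      less_imp_le[OF L(1)] allI impI; (fold \<rho>0_def)?)
    fix \<delta> assume \<delta>: "\<delta> \<in> D"
    {
      fix \<phi> r assume "\<phi> \<in> J" "\<bar>r\<bar> < R1"
      then show "0 < Wr \<phi> \<delta> r" unfolding Wr_def using \<delta> R1 by (intro R0(3)) auto
    }
    {
      fix \<phi> r r' assume "\<phi> \<in> J" "\<bar>r\<bar> < R1" "\<bar>r'\<bar> < R1"
      then have "norm (complex_of_real (Hr \<phi> \<delta> r) - of_real (Hr \<phi> \<delta> r')) \<le> L * norm (complex_of_real r - of_real r')"
        using L(2)[of \<phi> \<delta> "of_real r" "of_real r'"] Hc_real[OF \<delta>] \<delta> R1 by simp
      then show "\<bar>Hr \<phi> \<delta> r - Hr \<phi> \<delta> r'\<bar> \<le> L * \<bar>r - r'\<bar>"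
        by (simp flip: of_real_diff)
    }
    {
      fix \<phi> r assume "\<phi> \<in> J" "\<bar>r\<bar> < R1"
      then have "norm (complex_of_real (Hr \<phi> \<delta> r)) \<le> M"
        using M(2)[of \<phi> \<delta> "of_real r"] Hc_real[OF \<delta>] \<delta> R1 by simp
      then show "\<bar>Hr \<phi> \<delta> r\<bar> \<le> M" by simp
    }
    show "continuous_on (J \<times> {-R1<..<R1}) (\<lambda>(\<phi>, r). Wr \<phi> \<delta> r)"
    proof -
      have "continuous_on (J \<times> {-R1<..<R1})
         ((\<lambda>q. Wc (fst (fst q)) (snd (fst q)) (snd q)) \<circ> (\<lambda>q. ((fst q, \<delta>), complex_of_real (snd q))))"
        by (intro continuous_on_compose continuous_intros continuous_on_subset[OF cont_Wc]) (use \<delta> R1 in auto)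
      then have "continuous_on (J \<times> {-R1<..<R1}) (\<lambda>q. Re (Wc (fst q) \<delta> (of_real (snd q))))"
        by (intro continuous_intros) (simp add: o_def)
      then show ?thesis by (simp add: Wr_def split_beta)
    qed
    {
      fix x assume x: "\<bar>x\<bar> < \<rho>0"
      then have xb: "complex_of_real x \<in> ball 0 \<rho>0" by simp
      show "u 0 \<delta> x = 0" using U[OF \<delta>] xb by (simp add: u_def)
      fix \<phi> assume \<phi>: "\<phi> \<in> J"
      have "norm (complex_of_real (u \<phi> \<delta> x)) \<le> M * 7"
        using U[OF \<delta>] xb \<phi> Uu[OF \<delta> \<phi> x] by metis
      then show ub: "\<bar>u \<phi> \<delta> x\<bar> \<le> M * 7" by simp
      have "((\<lambda>t. U \<delta> t (of_real x)) has_vector_derivative Hc \<phi> \<delta> (of_real x * exp (U \<delta> \<phi> (of_real x)))) (at \<phi> within J)"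
        using U[OF \<delta>] xb \<phi> by blast
      from bounded_linear.has_vector_derivative[OF bounded_linear_Re this]
      have "((\<lambda>\<phi>. u \<phi> \<delta> x) has_real_derivative Re (Hc \<phi> \<delta> (of_real x * exp (U \<delta> \<phi> (of_real x))))) (at \<phi> within J)"
        by (simp add: u_def has_real_derivative_iff_has_vector_derivative)
      moreover have "of_real x * exp (U \<delta> \<phi> (of_real x)) = complex_of_real (x * exp (u \<phi> \<delta> x))"
        by (simp add: Uu[OF \<delta> \<phi> x] exp_of_real)
      ultimately show "((\<lambda>\<phi>. u \<phi> \<delta> x) has_real_derivative Hr \<phi> \<delta> (x * exp (u \<phi> \<delta> x))) (at \<phi> within J)"
        by (simp add: Hr_def)
    }
    define Q where "Q = (\<lambda>z. z * exp (U \<delta> (2 * pi) z))"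
    have Qh: "Q holomorphic_on ball 0 \<rho>0"
      unfolding Q_def using hol_family_hol[of J \<rho>0 "U \<delta>"] U[OF \<delta>] pi7 by (intro holomorphic_intros) auto
    have Qr: "Q (of_real x) = of_real (x * exp (u (2 * pi) \<delta> x))" if "\<bar>x\<bar> < \<rho>0" for x
      using Uu[OF \<delta> pi7 that] by (simp add: Q_def exp_of_real)
    \<comment> \<open>Real parts suffice because only real \<open>x\<close> are inserted:
      \<open>Re\<close> commutes with multiplication by the real number \<open>x^j\<close>.\<close>
    define c where "c = (\<lambda>j. Re ((deriv ^^ j) Q 0 / fact j))"
    have c: "(\<lambda>j. c j * x ^ j) sums (x * exp (u (2 * pi) \<delta> x))" if x: "\<bar>x\<bar> < \<rho>0" for x
    proof -
      have "(\<lambda>j. (deriv ^^ j) Q 0 / fact j * (of_real x - 0) ^ j) sums Q (of_real x)"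
        by (rule holomorphic_power_series[OF Qh]) (use x in simp)
      from bounded_linear.sums[OF bounded_linear_Re this]
      have "(\<lambda>j. Re ((deriv ^^ j) Q 0 / fact j * of_real (x ^ j))) sums (x * exp (u (2 * pi) \<delta> x))"
        by (simp add: Qr[OF x])
      moreover have "Re (w * of_real y) = Re w * y" for w y
        by simp
      ultimately show ?thesis
        by (simp only: c_def)
    qed
    show "\<exists>v. \<forall>x. \<bar>x\<bar> < \<rho>0 \<longrightarrow> (\<lambda>j. v (Suc j) * x ^ Suc j) sums (x * exp (u (2 * pi) \<delta> x) - x)"
    \<comment> \<open>Subtracting the identity map lowers the coefficient of index 1 by 1;
      \<open>c 0 = 0\<close> because \<open>Q\<close> vanishes at 0.\<close>
    proof (intro exI[of _ "\<lambda>j. c j - (if j = 1 then 1 else 0)"] allI impI)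
      fix x assume x: "\<bar>x\<bar> < \<rho>0"
      have "c 0 = 0" by (simp add: c_def Q_def)
      then have "(\<lambda>j. c (Suc j) * x ^ Suc j) sums (x * exp (u (2 * pi) \<delta> x))"
        using c[OF x] sums_Suc_iff[of "\<lambda>j. c j * x ^ j" "x * exp (u (2 * pi) \<delta> x)"] by simp
      moreover have "(\<lambda>j. if j = 0 then x ^ Suc j else 0) sums (x ^ Suc 0)"
        by (rule sums_single)
      ultimately have "(\<lambda>j. c (Suc j) * x ^ Suc j - (if j = 0 then x ^ Suc j else 0)) sums
          (x * exp (u (2 * pi) \<delta> x) - x ^ Suc 0)"
        by (rule sums_diff)
      moreover have "(\<lambda>j. c (Suc j) * x ^ Suc j - (if j = 0 then x ^ Suc j else 0)) =
          (\<lambda>j. (c (Suc j) - (if Suc j = 1 then 1 else 0)) * x ^ Suc j)"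
        by (auto simp: fun_eq_iff algebra_simps)
      ultimately show "(\<lambda>j. (c (Suc j) - (if Suc j = 1 then 1 else 0)) * x ^ Suc j) sums
          (x * exp (u (2 * pi) \<delta> x) - x)" by simp
    qed
    have "((\<lambda>x. x * exp (u (2 * pi) \<delta> x)) has_real_derivative deriv (\<lambda>x. x * exp (u (2 * pi) \<delta> x)) 0) (at 0)"
      and d2: "deriv Q (of_real 0) = of_real (deriv (\<lambda>x. x * exp (u (2 * pi) \<delta> x)) 0)"
      using real_deriv_of_holomorphic[OF Qh, of 0, OF _ Qr] \<rho>0 by simp_all
    \<comment> \<open>At 0 only the derivative of the factor \<open>z\<close> contributes to that of
      \<open>z * exp (U z)\<close>, so the derivative is the exponential of a real number and
      therefore positive.\<close>
    moreover have "deriv Q 0 = exp (U \<delta> (2 * pi) 0)"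
    proof (rule DERIV_imp_deriv)
      have "(U \<delta> (2 * pi) has_field_derivative deriv (U \<delta> (2 * pi)) 0) (at 0)"
        by (rule holomorphic_derivI[OF hol_family_hol open_ball]) (use U[OF \<delta>] pi7 \<rho>0 in auto)
      then show "(Q has_field_derivative exp (U \<delta> (2 * pi) 0)) (at 0)"
        unfolding Q_def by (auto intro!: derivative_eq_intros)
    qed
    then have "complex_of_real (deriv (\<lambda>x. x * exp (u (2 * pi) \<delta> x)) 0) = of_real (exp (u (2 * pi) \<delta> 0))"
      using d2 Uu[OF \<delta> pi7, of 0] \<rho>0 by (simp add: exp_of_real)
    then have "deriv (\<lambda>x. x * exp (u (2 * pi) \<delta> x)) 0 = exp (u (2 * pi) \<delta> 0)"
      by (simp only: of_real_eq_iff)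
    ultimately show "((\<lambda>x. x * exp (u (2 * pi) \<delta> x)) has_real_derivative exp (u (2 * pi) \<delta> 0)) (at 0)"
      by simp
  qed
qed

end

section \<open>Uniqueness and periodic extension of solutions\<close>

text \<open>Gronwall's argument for the squared distance \<open>g\<close>: from
  \<open>\<bar>g'\<bar> \<le> 2 * L * g\<close> it follows that
  \<open>g t * exp (- 2 * L * t)\<close> is nonincreasing, used after \<open>t0\<close>, and
  \<open>g t * exp (2 * L * t)\<close> is nondecreasing, used before \<open>t0\<close>.\<close>

lemma ode_unique_Lipschitz:
  fixes f :: "real \<Rightarrow> 'a::real_inner \<Rightarrow> 'a"
  assumes lip: "\<And>t x y. t \<in> {a..b} \<Longrightarrow> x \<in> S \<Longrightarrow> y \<in> S \<Longrightarrow> norm (f t x - f t y) \<le> L * norm (x - y)"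
    and z: "\<And>t. t \<in> {a..b} \<Longrightarrow> (z has_vector_derivative f t (z t)) (at t within {a..b})"
    and w: "\<And>t. t \<in> {a..b} \<Longrightarrow> (w has_vector_derivative f t (w t)) (at t within {a..b})"
    and S: "\<And>t. t \<in> {a..b} \<Longrightarrow> z t \<in> S" "\<And>t. t \<in> {a..b} \<Longrightarrow> w t \<in> S"
    and t0: "t0 \<in> {a..b}" "z t0 = w t0" and t: "t \<in> {a..b}"
  shows "z t = w t"
proof -
  define g where "g = (\<lambda>t. (z t - w t) \<bullet> (z t - w t))"
  define g' where "g' = (\<lambda>t. 2 * ((z t - w t) \<bullet> (f t (z t) - f t (w t))))"
  have g: "(g has_real_derivative g' t) (at t within {a..b})" if "t \<in> {a..b}" for t
  proof -
    have "((\<lambda>t. z t - w t) has_vector_derivative f t (z t) - f t (w t)) (at t within {a..b})"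
      using z[OF that] w[OF that] by (rule has_vector_derivative_diff)
    from bounded_bilinear.has_vector_derivative[OF bounded_bilinear_inner this this]
    show ?thesis
      by (simp add: g_def g'_def inner_commute has_real_derivative_iff_has_vector_derivative)
  qed
  have g'b: "\<bar>g' t\<bar> \<le> 2 * L * g t" if "t \<in> {a..b}" for t
  proof -
    have "\<bar>(z t - w t) \<bullet> (f t (z t) - f t (w t))\<bar> \<le> norm (z t - w t) * norm (f t (z t) - f t (w t))"
      by (rule Cauchy_Schwarz_ineq2)
    also have "\<dots> \<le> norm (z t - w t) * (L * norm (z t - w t))"
      using lip[OF that S(1)[OF that] S(2)[OF that]] by (intro mult_left_mono) auto
    also have "\<dots> = L * g t"
      by (simp add: g_def power2_norm_eq_inner[symmetric] power2_eq_square)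
    finally show ?thesis by (simp add: g'_def abs_mult)
  qed
  have gc: "continuous_on {a..b} g"
    using g by (meson DERIV_continuous continuous_on_eq_continuous_within)
  have gi: "(g has_real_derivative g' x) (at x)" if "a < x" "x < b" for x
    using g[of x] that at_within_Icc_at[of a x b] by auto
  have "g t \<le> 0"
  proof (cases "t0 \<le> t")
    case True
    have "g t * exp (- 2 * L * t) \<le> g t0 * exp (- 2 * L * t0)"
    proof (rule DERIV_nonpos_imp_decreasing_open[OF True])
      fix x assume x: "t0 < x" "x < t"
      then have x': "x \<in> {a..b}" "a < x" "x < b" using t t0 by auto
      have "((\<lambda>x. g x * exp (- 2 * L * x)) has_real_derivative
          (g' x - 2 * L * g x) * exp (- 2 * L * x)) (at x)"
        by (rule derivative_eq_intros gi[OF x'(2,3)] refl | simp add: algebra_simps)+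
      moreover have "(g' x - 2 * L * g x) * exp (- 2 * L * x) \<le> 0"
        using g'b[OF x'(1)] by (intro mult_nonpos_nonneg) auto
      ultimately show "\<exists>y. ((\<lambda>x. g x * exp (- 2 * L * x)) has_real_derivative y) (at x) \<and> y \<le> 0" by blast
    next
      show "continuous_on {t0..t} (\<lambda>x. g x * exp (- 2 * L * x))"
        by (intro continuous_intros continuous_on_subset[OF gc]) (use t t0 in auto)
    qed
    then show ?thesis using t0 by (simp add: g_def mult_le_0_iff)
  next
    case False
    then have le: "t \<le> t0" by simp
    have "g t * exp (2 * L * t) \<le> g t0 * exp (2 * L * t0)"
    proof (rule DERIV_nonneg_imp_increasing_open[OF le])
      fix x assume x: "t < x" "x < t0"
      then have x': "x \<in> {a..b}" "a < x" "x < b" using t t0 by auto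
      have "((\<lambda>x. g x * exp (2 * L * x)) has_real_derivative
          (g' x + 2 * L * g x) * exp (2 * L * x)) (at x)"
        by (rule derivative_eq_intros gi[OF x'(2,3)] refl | simp add: algebra_simps)+
      moreover have "(g' x + 2 * L * g x) * exp (2 * L * x) \<ge> 0"
        using g'b[OF x'(1)] by (intro mult_nonneg_nonneg) auto
      ultimately show "\<exists>y. ((\<lambda>x. g x * exp (2 * L * x)) has_real_derivative y) (at x) \<and> y \<ge> 0" by blast
    next
      show "continuous_on {t..t0} (\<lambda>x. g x * exp (2 * L * x))"
        by (intro continuous_intros continuous_on_subset[OF gc]) (use t t0 in auto)
    qed
    then show ?thesis using t0 by (simp add: g_def mult_le_0_iff)
  qed
  then have "(z t - w t) \<bullet> (z t - w t) = 0"
    using inner_ge_zero[of "z t - w t"] by (simp add: g_def)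
  then show ?thesis by simp
qed

text \<open>Only \<open>z\<close> is known to stay in \<open>S\<close>. The set of coincidence is
  closed, and it is open because near a coincidence \<open>w\<close> lies in the open set
  \<open>S\<close> too, where the Lipschitz version applies; the interval is connected. This permits
  comparison with an arbitrary competing solution.\<close>

lemma ode_unique_local:
  fixes f :: "'a::real_inner \<Rightarrow> 'a"
  assumes lip: "\<And>x y. x \<in> S \<Longrightarrow> y \<in> S \<Longrightarrow> norm (f x - f y) \<le> L * norm (x - y)"
    and "open S"
    and z: "\<And>t. t \<in> {a..b} \<Longrightarrow> (z has_vector_derivative f (z t)) (at t within {a..b})"
    and w: "\<And>t. t \<in> {a..b} \<Longrightarrow> (w has_vector_derivative f (w t)) (at t within {a..b})"
    and S: "\<And>t. t \<in> {a..b} \<Longrightarrow> z t \<in> S"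
    and t0: "t0 \<in> {a..b}" "z t0 = w t0" and t: "t \<in> {a..b}"
  shows "z t = w t"
proof -
  have zc: "continuous_on {a..b} z" and wc: "continuous_on {a..b} w"
    using z w by (meson continuous_on_eq_continuous_within has_vector_derivative_continuous)+
  define E where "E = {t \<in> {a..b}. z t - w t = 0}"
  have "closed E"
    unfolding E_def by (intro continuous_closed_preimage_constant continuous_intros zc wc)
  then have cl: "closedin (top_of_set {a..b}) E"
    by (rule closed_subset[rotated]) (auto simp: E_def)
  have op: "openin (top_of_set {a..b}) E"
    unfolding openin_euclidean_subtopology_iff
  proof (intro conjI ballI)
    show "E \<subseteq> {a..b}" by (auto simp: E_def)
    fix t1 assume "t1 \<in> E"
    then have t1: "t1 \<in> {a..b}" "z t1 = w t1" by (auto simp: E_def)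
    then obtain e where e: "e > 0" "ball (w t1) e \<subseteq> S"
      using S[OF t1(1)] \<open>open S\<close> by (metis open_contains_ball)
    obtain d where d: "d > 0" "\<And>t. t \<in> {a..b} \<Longrightarrow> dist t t1 < d \<Longrightarrow> dist (w t) (w t1) < e"
      using wc t1(1) e(1) unfolding continuous_on_iff by blast
    have "t \<in> E" if "t \<in> {a..b}" "dist t t1 < d" for t
    proof -
      let ?a = "min t t1" and ?b = "max t t1"
      have sub: "{?a..?b} \<subseteq> {a..b}" using that t1 by auto
      have wS: "w u \<in> S" if u: "u \<in> {?a..?b}" for u
      proof -
        have "dist u t1 < d" using u \<open>dist t t1 < d\<close> by (auto simp: dist_real_def)
        moreover have "u \<in> {a..b}" using u sub by blast
        ultimately have "w u \<in> ball (w t1) e" using d(2)[of u] by (simp add: dist_commute)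
        then show ?thesis using e(2) by blast
      qed
      have "z t = w t"
      proof (rule ode_unique_Lipschitz[where f = "\<lambda>_. f" and S = S and a = ?a and b = ?b and ?t0.0 = t1 and L = L])
        show "(z has_vector_derivative f (z u)) (at u within {?a..?b})" if "u \<in> {?a..?b}" for u
          using z[of u] sub that by (meson has_vector_derivative_within_subset subsetD)
        show "(w has_vector_derivative f (w u)) (at u within {?a..?b})" if "u \<in> {?a..?b}" for u
          using w[of u] sub that by (meson has_vector_derivative_within_subset subsetD)
        show "z u \<in> S" if "u \<in> {?a..?b}" for u using S sub that by blast
      qed (use lip wS t1 in auto)
      then show ?thesis using that by (simp add: E_def)
    qed
    then show "\<exists>d>0. \<forall>t\<in>{a..b}. dist t t1 < d \<longrightarrow> t \<in> E" using d(1) by blast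
  qed
  have "E = {} \<or> E = {a..b}"
    using op cl connected_clopen[THEN iffD1, OF connected_Icc[of a b], rule_format, of E] by simp
  moreover have "t0 \<in> E" using t0 by (simp add: E_def)
  ultimately have "t \<in> E" using t by blast
  then show ?thesis by (simp add: E_def)
qed

text \<open>\<open>Z t\<close> is \<open>z\<close> at the representative of \<open>t\<close> modulo
  \<open>b - a\<close>. At the seams the two pieces have the same derivative, since it is
  \<open>f\<close> of the common value.\<close>

lemma periodic_extension:
  fixes z :: "real \<Rightarrow> 'a::real_normed_vector"
  assumes ab: "a < b" and eq: "z a = z b"
    and z: "\<And>t. t \<in> {a..b} \<Longrightarrow> (z has_vector_derivative f (z t)) (at t within {a..b})"
  obtains Z where "\<And>t. (Z has_vector_derivative f (Z t)) (at t)" "\<And>t. Z (t + (b - a)) = Z t"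
    "range Z = z ` {a..b}"
proof -
  define T where "T = b - a"
  have T: "T > 0" using ab by (simp add: T_def)
  define k where "k = (\<lambda>t. of_int \<lfloor>(t - a) / T\<rfloor> * T)"
  define Z where "Z = (\<lambda>t. z (t - k t))"
  have kT: "k (t + T) = k t + T" for t
  proof -
    have "(t + T - a) / T = (t - a) / T + 1" using T by (simp add: field_simps)
    then show ?thesis by (simp add: k_def distrib_right)
  qed
  have kin: "a \<le> t - k t" "t - k t < b" for t
    using floor_divide_lower[OF T, of "t - a"] floor_divide_upper[OF T, of "t - a"]
    by (auto simp: k_def T_def algebra_simps)
  have Zj: "Z t = z (t - of_int j * T)" if t: "t \<in> {a + of_int j * T .. b + of_int j * T}" for t and j :: int
  proof (cases "t = b + of_int j * T")
    case True
    have "(t - a) / T = of_int (j + 1)"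
      using T True by (simp add: field_simps T_def)
    then have "k t = of_int (j + 1) * T"
      unfolding k_def by (metis floor_of_int)
    then have "k t = of_int j * T + T"
      by (simp add: distrib_right)
    then have "t - k t = a"
      using True T_def by linarith
    then show ?thesis
      using True eq by (simp add: Z_def)
  next
    case False
    have "\<lfloor>(t - a) / T\<rfloor> = j"
      using t False T by (intro floor_unique) (auto simp: field_simps T_def)
    then show ?thesis by (simp add: Z_def k_def)
  qed
  have Zd: "(Z has_vector_derivative f (Z t)) (at t within {a + of_int j * T .. b + of_int j * T})"
    if t: "t \<in> {a + of_int j * T .. b + of_int j * T}" for t and j :: int
  proof -
    have im: "(\<lambda>t. t - of_int j * T) ` {a + of_int j * T .. b + of_int j * T} = {a..b}"
      by (simp add: image_diff_atLeastAtMost)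
    have "(z has_vector_derivative f (z (t - of_int j * T))) (at (t - of_int j * T) within {a..b})"
      using t by (intro z) auto
    then have "((z \<circ> (\<lambda>t. t - of_int j * T)) has_vector_derivative 1 *\<^sub>R f (z (t - of_int j * T)))
        (at t within {a + of_int j * T .. b + of_int j * T})"
      by (intro vector_diff_chain_within) (auto simp: im intro!: derivative_eq_intros)
    then have "((\<lambda>t. z (t - of_int j * T)) has_vector_derivative f (Z t))
        (at t within {a + of_int j * T .. b + of_int j * T})"
      using Zj[OF t] by (simp add: o_def)
    then show ?thesis
      by (rule has_vector_derivative_transform[OF t, rotated]) (use Zj in auto)
  qed
  show ?thesis
  proof (rule that[of Z])
    show "Z (t + (b - a)) = Z t" for t
      using kT[of t] by (simp add: Z_def T_def)
    show "range Z = z ` {a..b}"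
    proof (intro equalityI subsetI)
      fix y assume "y \<in> range Z"
      then show "y \<in> z ` {a..b}" using kin unfolding Z_def by (force simp: less_imp_le)
    next
      fix y assume "y \<in> z ` {a..b}"
      then obtain t where "t \<in> {a..b}" "y = z t" by auto
      then have "y = Z t" using Zj[of t 0] by simp
      then show "y \<in> range Z" by simp
    qed
    fix t
    \<comment> \<open>\<open>t\<close> may be the left end of its period interval, so the preceding
      interval is joined to it to obtain a neighbourhood. If \<open>t\<close> lies outside that
      preceding interval, the derivative within it refers to the trivial filter.\<close>
    define j where "j = \<lfloor>(t - a) / T\<rfloor>"
    let ?A = "{a + of_int (j - 1) * T .. b + of_int (j - 1) * T}"
    let ?B = "{a + of_int j * T .. b + of_int j * T}"
    have tB: "a + of_int j * T \<le> t" "t < b + of_int j * T"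
      using kin[of t] by (auto simp: k_def j_def)
    have un: "?A \<union> ?B = {a + of_int (j - 1) * T .. b + of_int j * T}"
      using T by (auto simp: T_def algebra_simps)
    have inter: "t \<in> interior (?A \<union> ?B)"
      unfolding un interior_atLeastAtMost_real using tB T by (auto simp: T_def algebra_simps)
    have B: "(Z has_vector_derivative f (Z t)) (at t within ?B)"
      using tB by (intro Zd) auto
    have A: "(Z has_vector_derivative f (Z t)) (at t within ?A)"
    proof (cases "t \<in> ?A")
      case True
      then show ?thesis by (rule Zd)
    next
      case False
      then have "at t within ?A = bot"
        by (metis closed_atLeastAtMost closed_limpt trivial_limit_within)
      then show ?thesis by (simp add: has_vector_derivative_def has_derivative_bot bounded_linear_scaleR_left)
    qed
    have "(Z has_vector_derivative f (Z t)) (at t within ?A \<union> ?B)"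
      using A B by (simp only: has_vector_derivative_def has_derivative_within Lim_within_Un simp_thms)
    then show "(Z has_vector_derivative f (Z t)) (at t)"
      unfolding at_within_interior[OF inter] .
  qed
qed

section \<open>The real flow in polar coordinates\<close>

text \<open>If \<open>p\<close> is the rate of time along a curve \<open>w\<close>, then its
  primitive \<open>T\<close> is the time, and \<open>w\<close> composed with the inverse of
  \<open>T\<close> solves the autonomous equation. Positivity of \<open>p\<close> makes
  \<open>T\<close> invertible.\<close>

lemma time_change:
  fixes w :: "real \<Rightarrow> 'a::real_normed_vector"
  assumes c: "0 < c" and p: "continuous_on {-c..c} p" "\<And>t. t \<in> {-c..c} \<Longrightarrow> 0 < p t"
    and w: "\<And>t. t \<in> {-c<..<c} \<Longrightarrow> (w has_vector_derivative p t *\<^sub>R f (w t)) (at t)"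
  obtains T z where "T 0 = 0" "strict_mono_on {-c<..<c} T" "continuous_on {-c<..<c} T"
    "\<And>t. t \<in> {-c<..<c} \<Longrightarrow> z (T t) = w t \<and> (z has_vector_derivative f (z (T t))) (at (T t))"
proof -
  \<comment> \<open>\<open>T x\<close> is the oriented integral of \<open>p\<close> from 0 to
    \<open>x\<close>; the difference of two integrals from \<open>-c\<close> gives the right sign
    for \<open>x < 0\<close>, where \<open>{0..x}\<close> is empty.\<close>
  define T where "T = (\<lambda>x. integral {-c..x} p - integral {-c..0} p)"
  have T': "(T has_real_derivative p t) (at t)" if t: "t \<in> {-c<..<c}" for t
  proof -
    have "((\<lambda>x. integral {-c..x} p) has_vector_derivative p t) (at t within {-c..c})"
      using t by (intro integral_has_vector_derivative[OF p(1)]) auto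
    moreover have "at t within {-c..c} = at t"
      using t by (intro at_within_interior) (simp add: interior_atLeastAtMost_real)
    ultimately show ?thesis
      unfolding T_def by (auto simp: has_real_derivative_iff_has_vector_derivative intro!: derivative_eq_intros)
  qed
  have Tc: "isCont T t" if "t \<in> {-c<..<c}" for t
    using DERIV_isCont[OF T'[OF that]] .
  have mono: "T s < T t" if "s \<in> {-c<..<c}" "t \<in> {-c<..<c}" "s < t" for s t
  proof (rule DERIV_pos_imp_increasing[OF that(3)])
    fix x assume "s \<le> x" "x \<le> t"
    then have "x \<in> {-c<..<c}" using that by auto
    then show "\<exists>y. (T has_real_derivative y) (at x) \<and> y > 0"
      using T' p(2)[of x] by auto
  qed
  have inj: "inj_on T {-c<..<c}"
    using mono by (metis inj_onI linorder_neq_iff less_irrefl)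
  define Phi where "Phi = the_inv_into {-c<..<c} T"
  have Phi: "Phi (T t) = t" if "t \<in> {-c<..<c}" for t
    unfolding Phi_def by (rule the_inv_into_f_f[OF inj that])
  show ?thesis
  proof (rule that[of T "w \<circ> Phi"])
    show "T 0 = 0" by (simp add: T_def)
    show "strict_mono_on {-c<..<c} T" using mono by (auto intro: strict_mono_onI)
    show "continuous_on {-c<..<c} T" using Tc by (simp add: continuous_at_imp_continuous_on)
    fix t assume t: "t \<in> {-c<..<c}"
    obtain t1 where t1: "-c < t1" "t1 < t" using t dense[of "-c" t] by auto
    obtain t2 where t2: "t < t2" "t2 < c" using t dense[of t c] by auto
    have in12: "x \<in> {-c<..<c}" if "t1 \<le> x" "x \<le> t2" for x using that t1 t2 by auto
    have "(Phi has_real_derivative inverse (p t)) (at (T t))"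
    proof (rule DERIV_inverse_function[where f = T and D = "p t" and a = "T t1" and b = "T t2"])
      show "(T has_real_derivative p t) (at (Phi (T t)))" using T'[OF t] Phi[OF t] by simp
      show "p t \<noteq> 0" using p(2)[of t] t by auto
      show "T t1 < T t" "T t < T t2" using mono in12 t t1 t2 by auto
      show "isCont Phi (T t)"
        by (rule isCont_inverse_function2[of t1 t t2]) (use t1 t2 in12 Phi Tc in auto)
      fix y assume y: "T t1 < y" "y < T t2"
      have "continuous_on {t1..t2} T"
        using Tc in12 by (intro continuous_at_imp_continuous_on) auto
      then obtain x where "t1 \<le> x" "x \<le> t2" "T x = y"
        using IVT'[of T t1 y t2] y t1 t2 by auto
      then show "T (Phi y) = y" using Phi in12 by auto
    qed
    then have "(Phi has_vector_derivative inverse (p t)) (at (T t))"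
      by (simp add: has_real_derivative_iff_has_vector_derivative)
    moreover have "(w has_vector_derivative p t *\<^sub>R f (w t)) (at (Phi (T t)))"
      using w[OF t] Phi[OF t] by simp
    ultimately have "((w \<circ> Phi) has_vector_derivative inverse (p t) *\<^sub>R (p t *\<^sub>R f (w t))) (at (T t))"
      by (rule vector_diff_chain_at)
    then show "(w \<circ> Phi) (T t) = w t \<and> (w \<circ> Phi has_vector_derivative f ((w \<circ> Phi) (T t))) (at (T t))"
      using Phi[OF t] p(2)[of t] t by auto
  qed
qed

text \<open>The bound 7 for \<open>|\<phi>|\<close> only has to exceed \<open>2\<pi>\<close>, so that one full turn in either direction
  stays in the interior of the interval.\<close>

locale polar_flow =
  fixes X Y :: "'m::finite pfun" and \<Omega> :: "'m pdom" and F :: "real \<Rightarrow> real ^ 'm \<Rightarrow> real" and \<delta> :: "real ^ 'm"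
    and n :: nat and R s q M L L2 :: real and yr A V W H u :: "real \<Rightarrow> real \<Rightarrow> real"
  assumes n2: "n \<ge> 2"
    and R: "0 < R" "R \<le> s" "R \<le> 1" "s < q" and M: "0 \<le> M" and L: "0 \<le> L"
    and dom: "\<And>x y. \<bar>x\<bar> < q \<Longrightarrow> \<bar>y\<bar> < q \<Longrightarrow> (x, y, \<delta>) \<in> \<Omega>"
    and zero: "X 0 0 \<delta> = 0" "Y 0 0 \<delta> = 0" "F 0 \<delta> = 0"
    and lip: "\<And>x y x' y'. \<bar>x\<bar> < q \<Longrightarrow> \<bar>y\<bar> < q \<Longrightarrow> \<bar>x'\<bar> < q \<Longrightarrow> \<bar>y'\<bar> < q \<Longrightarrow>
       norm ((y + X x y \<delta>, Y x y \<delta>) - (y' + X x' y' \<delta>, Y x' y' \<delta>)) \<le> L2 * norm ((x, y) - (x', y'))"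
    and Fd: "\<And>x. \<bar>x\<bar> < R \<Longrightarrow> ((\<lambda>x. F x \<delta>) has_real_derivative deriv (\<lambda>x. F x \<delta>) x) (at x)"
    and F_eq: "\<And>x. \<bar>x\<bar> < R \<Longrightarrow> F x \<delta> + X x (F x \<delta>) \<delta> = 0"
    and F_s: "\<And>x. \<bar>x\<bar> < R \<Longrightarrow> \<bar>F x \<delta>\<bar> \<le> s"
    and contr: "\<And>x y y'. \<bar>x\<bar> < R \<Longrightarrow> \<bar>y\<bar> \<le> s \<Longrightarrow> \<bar>y'\<bar> \<le> s \<Longrightarrow> \<bar>X x y \<delta> - X x y' \<delta>\<bar> \<le> 1/2 * \<bar>y - y'\<bar>"
    and yr_def: "\<And>\<phi> r. yr \<phi> r = F (r * cos \<phi>) \<delta> - r ^ n * sin \<phi>"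
    and A_def: "\<And>\<phi> r. A \<phi> r = yr \<phi> r + X (r * cos \<phi>) (yr \<phi> r) \<delta>"
    and V_def: "\<And>\<phi> r. V \<phi> r = Y (r * cos \<phi>) (yr \<phi> r) \<delta> - deriv (\<lambda>x. F x \<delta>) (r * cos \<phi>) * A \<phi> r"
    and yr_s: "\<And>\<phi> r. \<bar>r\<bar> < R \<Longrightarrow> \<bar>yr \<phi> r\<bar> \<le> s"
    and W_eq: "\<And>\<phi> r. \<bar>r\<bar> < R \<Longrightarrow> r \<noteq> 0 \<Longrightarrow>
       W \<phi> r = - (n * sin \<phi> * (A \<phi> r / r ^ n) + cos \<phi> * (V \<phi> r / r ^ (2 * n - 1)))"
    and H_eq: "\<And>\<phi> r. \<bar>r\<bar> < R \<Longrightarrow> r \<noteq> 0 \<Longrightarrow>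
       H \<phi> r = (cos \<phi> * (A \<phi> r / r ^ n) - sin \<phi> * (V \<phi> r / r ^ (2 * n - 1))) / W \<phi> r"
    and W_pos: "\<And>\<phi> r. \<phi> \<in> {-7..7} \<Longrightarrow> \<bar>r\<bar> < R \<Longrightarrow> 0 < W \<phi> r"
    and W_cont: "continuous_on ({-7..7} \<times> {-R<..<R}) (\<lambda>(\<phi>, r). W \<phi> r)"
    and H_lip: "\<And>\<phi> r r'. \<phi> \<in> {-7..7} \<Longrightarrow> \<bar>r\<bar> < R \<Longrightarrow> \<bar>r'\<bar> < R \<Longrightarrow> \<bar>H \<phi> r - H \<phi> r'\<bar> \<le> L * \<bar>r - r'\<bar>"
    and H_le: "\<And>\<phi> r. \<phi> \<in> {-7..7} \<Longrightarrow> \<bar>r\<bar> < R \<Longrightarrow> \<bar>H \<phi> r\<bar> \<le> M"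
    and u_0: "\<And>x. \<bar>x\<bar> < R * exp (- (M * 7)) \<Longrightarrow> u 0 x = 0"
    and u_le: "\<And>x \<phi>. \<bar>x\<bar> < R * exp (- (M * 7)) \<Longrightarrow> \<phi> \<in> {-7..7} \<Longrightarrow> \<bar>u \<phi> x\<bar> \<le> M * 7"
    and u_der: "\<And>x \<phi>. \<bar>x\<bar> < R * exp (- (M * 7)) \<Longrightarrow> \<phi> \<in> {-7..7} \<Longrightarrow>
        ((\<lambda>\<phi>. u \<phi> x) has_real_derivative H \<phi> (x * exp (u \<phi> x))) (at \<phi> within {-7..7})"
begin

abbreviation J :: "real set" where "J \<equiv> {-7..7}"

definition rr :: "real \<Rightarrow> real \<Rightarrow> real" where "rr \<phi> x = x * exp (u \<phi> x)"

text \<open>Trajectories grow at most by the factor \<open>exp (M * 7)\<close>. Started below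
  \<open>\<rho>0\<close> they stay below \<open>R\<close>; started below \<open>\<rho>1\<close> they
  stay below \<open>\<rho>0\<close>, so a new trajectory can be started at any value they
  take.\<close>

definition \<rho>0 :: real where "\<rho>0 = R * exp (- (M * 7))"
definition \<rho>1 :: real where "\<rho>1 = \<rho>0 * exp (- (M * 7))"

definition fld :: "real \<times> real \<Rightarrow> real \<times> real" where
  "fld p = (snd p + X (fst p) (snd p) \<delta>, Y (fst p) (snd p) \<delta>)"

definition box :: "(real \<times> real) set" where "box = {-q<..<q} \<times> {-q<..<q}"

lemma pi_J: "2 * pi \<in> J" "- (2 * pi) \<in> J" "pi \<in> J" "2 * pi < 7"
  using pi_less_4 pi_gt_zero pi_approx by auto

lemma \<rho>_pos: "0 < \<rho>1" "\<rho>1 \<le> \<rho>0" "0 < \<rho>0" "\<rho>0 \<le> R"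
proof -
  have e: "0 < exp (- (M * 7))" "exp (- (M * 7)) \<le> 1" using M by auto
  show 0: "0 < \<rho>0" "\<rho>0 \<le> R"
    using e R(1) by (auto simp: \<rho>0_def intro: mult_left_le)
  show "0 < \<rho>1" "\<rho>1 \<le> \<rho>0"
    using e 0 by (auto simp: \<rho>1_def intro: mult_left_le)
qed

lemma rr_0 [simp]: "\<bar>x\<bar> < \<rho>0 \<Longrightarrow> rr 0 x = x"
  using u_0 by (simp add: rr_def \<rho>0_def)

lemma rr_zero [simp]: "rr \<phi> 0 = 0" by (simp add: rr_def)

lemma rr_le: "\<bar>x\<bar> < \<rho>0 \<Longrightarrow> \<phi> \<in> J \<Longrightarrow> \<bar>rr \<phi> x\<bar> \<le> \<bar>x\<bar> * exp (M * 7)"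
  using u_le[of x \<phi>] by (auto simp: rr_def \<rho>0_def abs_mult intro!: mult_left_mono)

lemma rr_lt_R: "\<bar>x\<bar> < \<rho>0 \<Longrightarrow> \<phi> \<in> J \<Longrightarrow> \<bar>rr \<phi> x\<bar> < R"
proof -
  assume x: "\<bar>x\<bar> < \<rho>0" "\<phi> \<in> J"
  have "\<bar>x\<bar> * exp (M * 7) < \<rho>0 * exp (M * 7)" using x by simp
  also have "\<dots> = R" by (simp add: \<rho>0_def exp_minus)
  finally show ?thesis using rr_le[OF x] by linarith
qed

lemma rr_lt_\<rho>0: "\<bar>x\<bar> < \<rho>1 \<Longrightarrow> \<phi> \<in> J \<Longrightarrow> \<bar>rr \<phi> x\<bar> < \<rho>0"
proof -
  assume x: "\<bar>x\<bar> < \<rho>1" "\<phi> \<in> J"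
  have "\<bar>x\<bar> * exp (M * 7) < \<rho>1 * exp (M * 7)" using x by simp
  also have "\<dots> = \<rho>0" by (simp add: \<rho>1_def exp_minus)
  finally show ?thesis using rr_le[of x \<phi>] x \<rho>_pos by linarith
qed

lemma rr_pos_iff [simp]: "0 < rr \<phi> x \<longleftrightarrow> 0 < x" and rr_neg_iff [simp]: "rr \<phi> x < 0 \<longleftrightarrow> x < 0"
  and rr_eq_0_iff [simp]: "rr \<phi> x = 0 \<longleftrightarrow> x = 0"
  by (auto simp: rr_def zero_less_mult_iff mult_less_0_iff)

lemma rr_deriv:
  assumes "\<bar>x\<bar> < \<rho>0" "\<phi> \<in> J"
  shows "((\<lambda>\<phi>. rr \<phi> x) has_real_derivative rr \<phi> x * H \<phi> (rr \<phi> x)) (at \<phi> within J)"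
  unfolding rr_def
  by (rule derivative_eq_intros u_der refl | use assms in \<open>simp add: \<rho>0_def\<close>)+

text \<open>Through this lemma symmetries of the angular equation become identities between values
  of \<open>rr\<close>: a transformed trajectory solves the same equation and is compared at a
  single angle. The constant \<open>R * L + M\<close> is a Lipschitz constant of
  \<open>r H(\<phi>, r)\<close>.\<close>

lemma rr_unique:
  assumes cd: "{c..d} \<subseteq> J" and x: "\<bar>x\<bar> < \<rho>0"
    and w: "\<And>\<phi>. \<phi> \<in> {c..d} \<Longrightarrow> (w has_real_derivative w \<phi> * H \<phi> (w \<phi>)) (at \<phi> within {c..d})"
      "\<And>\<phi>. \<phi> \<in> {c..d} \<Longrightarrow> \<bar>w \<phi>\<bar> < R"
    and t: "t0 \<in> {c..d}" "w t0 = rr t0 x" "t \<in> {c..d}"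
  shows "w t = rr t x"
proof (rule ode_unique_Lipschitz[where f = "\<lambda>\<phi> r. r * H \<phi> r" and S = "{-R<..<R}" and L = "R * L + M"
      and a = c and b = d and ?t0.0 = t0 and z = w and w = "\<lambda>\<phi>. rr \<phi> x"])
  fix \<phi> r r' assume h: "\<phi> \<in> {c..d}" "r \<in> {-R<..<R}" "r' \<in> {-R<..<R}"
  then have \<phi>: "\<phi> \<in> J" "\<bar>r\<bar> < R" "\<bar>r'\<bar> < R" using cd by auto
  have "\<bar>r * H \<phi> r - r' * H \<phi> r'\<bar> = \<bar>r * (H \<phi> r - H \<phi> r') + (r - r') * H \<phi> r'\<bar>"
    by (simp add: algebra_simps)
  also have "\<dots> \<le> \<bar>r\<bar> * \<bar>H \<phi> r - H \<phi> r'\<bar> + \<bar>r - r'\<bar> * \<bar>H \<phi> r'\<bar>"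
    by (simp add: abs_mult[symmetric] abs_triangle_ineq)
  also have "\<dots> \<le> R * (L * \<bar>r - r'\<bar>) + \<bar>r - r'\<bar> * M"
    using H_lip[OF \<phi>] H_le[OF \<phi>(1,3)] \<phi> R(1) by (intro add_mono mult_mono) auto
  finally show "norm (r * H \<phi> r - r' * H \<phi> r') \<le> (R * L + M) * norm (r - r')"
    by (simp add: algebra_simps)
next
  show "(w has_vector_derivative w t * H t (w t)) (at t within {c..d})" if "t \<in> {c..d}" for t
    using w(1)[OF that] by (simp add: has_real_derivative_iff_has_vector_derivative)
  show "((\<lambda>\<phi>. rr \<phi> x) has_vector_derivative rr t x * H t (rr t x)) (at t within {c..d})" if "t \<in> {c..d}" for t
    using DERIV_subset[OF rr_deriv[OF x] cd, of t] that cd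
    by (auto simp: has_real_derivative_iff_has_vector_derivative)
  show "w t \<in> {-R<..<R}" if "t \<in> {c..d}" for t using w(2)[OF that] by auto
  show "rr t x \<in> {-R<..<R}" if "t \<in> {c..d}" for t using rr_lt_R[OF x, of t] that cd by auto
qed (use t in auto)

lemma rr_affine:
  assumes x: "\<bar>x\<bar> < \<rho>0" and I: "\<And>\<phi>. \<phi> \<in> I \<Longrightarrow> k * \<phi> + c \<in> J" and \<phi>: "\<phi> \<in> I"
  shows "((\<lambda>\<phi>. rr (k * \<phi> + c) x) has_real_derivative
    rr (k * \<phi> + c) x * H (k * \<phi> + c) (rr (k * \<phi> + c) x) * k) (at \<phi> within I)"
proof -
  have "(\<lambda>\<phi>. k * \<phi> + c) ` I \<subseteq> J" using I by blast
  then have "((\<lambda>\<phi>. rr \<phi> x) has_real_derivative rr (k * \<phi> + c) x * H (k * \<phi> + c) (rr (k * \<phi> + c) x))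
      (at (k * \<phi> + c) within (\<lambda>\<phi>. k * \<phi> + c) ` I)"
    by (rule DERIV_subset[OF rr_deriv[OF x I[OF \<phi>]]])
  moreover have "((\<lambda>\<phi>. k * \<phi> + c) has_real_derivative k) (at \<phi> within I)"
    by (auto intro!: derivative_eq_intros)
  ultimately show ?thesis
    using DERIV_image_chain[of "\<lambda>\<phi>. rr \<phi> x" _ "\<lambda>\<phi>. k * \<phi> + c"] unfolding o_def by blast
qed

lemma rr_inj:
  assumes "\<bar>x\<bar> < \<rho>0" "\<bar>y\<bar> < \<rho>0" "\<phi> \<in> J" "rr \<phi> x = rr \<phi> y"
  shows "x = y"
  using rr_unique[of "-7" 7 y "\<lambda>\<phi>. rr \<phi> x" \<phi> 0] rr_deriv rr_lt_R assms by auto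

lemma rr_cont: "\<bar>x\<bar> < \<rho>0 \<Longrightarrow> continuous_on J (\<lambda>\<phi>. rr \<phi> x)"
  using rr_deriv by (meson DERIV_continuous continuous_on_eq_continuous_within)

text \<open>The order holds at angle 0, and a reversal would force two trajectories to meet in
  between, against \<open>rr_inj\<close>.\<close>

lemma rr_mono:
  assumes x: "\<bar>x\<bar> < \<rho>0" "\<bar>y\<bar> < \<rho>0" "x < y" and \<phi>: "\<phi> \<in> J"
  shows "rr \<phi> x < rr \<phi> y"
proof (rule ccontr)
  assume "\<not> ?thesis"
  then have le: "rr \<phi> y - rr \<phi> x \<le> 0" by simp
  have c: "continuous_on J (\<lambda>\<phi>. rr \<phi> y - rr \<phi> x)"
    by (intro continuous_intros rr_cont x)
  have "\<exists>\<psi>\<in>J. rr \<psi> y - rr \<psi> x = 0"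
  proof (cases "0 \<le> \<phi>")
    case True
    then show ?thesis
      using IVT2'[of "\<lambda>\<phi>. rr \<phi> y - rr \<phi> x" \<phi> 0 0] continuous_on_subset[OF c, of "{0..\<phi>}"] \<phi> x le by force
  next
    case False
    then show ?thesis
      using IVT'[of "\<lambda>\<phi>. rr \<phi> y - rr \<phi> x" \<phi> 0 0] continuous_on_subset[OF c, of "{\<phi>..0}"] \<phi> x le by force
  qed
  then obtain \<psi> where "\<psi> \<in> J" "rr \<psi> x = rr \<psi> y" by auto
  then show False using rr_inj[OF x(1,2)] x(3) by blast
qed

section \<open>Symmetries of the angular equation\<close>

lemma H_period:
  assumes "\<bar>r\<bar> < R" "r \<noteq> 0"
  shows "H (\<phi> + 2 * pi) r = H \<phi> r"
  unfolding H_eq[OF assms] W_eq[OF assms] V_def A_def yr_def by simp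

lemma neg_power: "odd n \<Longrightarrow> (- r) ^ n = - (r ^ n :: real)" "even n \<Longrightarrow> (- r) ^ n = (r ^ n :: real)"
  "(- r) ^ (2 * n - 1) = - (r ^ (2 * n - 1) :: real)"
  using n2 by (auto simp: power_minus_odd)

text \<open>For odd \<open>n\<close> the coordinates \<open>(r, \<phi>)\<close> and
  \<open>(- r, \<phi> + pi)\<close> describe the same point.\<close>

lemma H_symm_odd:
  assumes "\<bar>r\<bar> < R" "r \<noteq> 0" "odd n"
  shows "H (\<phi> + pi) (- r) = H \<phi> r"
proof -
  have y: "yr (\<phi> + pi) (- r) = yr \<phi> r" by (simp add: yr_def neg_power assms)
  have a: "A (\<phi> + pi) (- r) = A \<phi> r" by (simp add: A_def y)
  have v: "V (\<phi> + pi) (- r) = V \<phi> r" by (simp add: V_def y a)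
  have m: "\<bar>- r\<bar> < R" "- r \<noteq> 0" using assms by auto
  show ?thesis
    unfolding H_eq[OF m] W_eq[OF m] H_eq[OF assms(1,2)] W_eq[OF assms(1,2)] a v neg_power(1)[OF assms(3)] neg_power(3)
    by (simp)
qed

text \<open>For even \<open>n\<close> the second representation of the point is
  \<open>(- r, pi - \<phi>)\<close>; reflecting the angle reverses its direction, hence the minus
  sign.\<close>

lemma H_symm_even:
  assumes "\<bar>r\<bar> < R" "r \<noteq> 0" "even n"
  shows "H (pi - \<phi>) (- r) = - H \<phi> r"
proof -
  have y: "yr (pi - \<phi>) (- r) = yr \<phi> r" by (simp add: yr_def neg_power assms)
  have a: "A (pi - \<phi>) (- r) = A \<phi> r" by (simp add: A_def y)
  have v: "V (pi - \<phi>) (- r) = V \<phi> r" by (simp add: V_def y a)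
  have m: "\<bar>- r\<bar> < R" "- r \<noteq> 0" using assms by auto
  have W: "W (pi - \<phi>) (- r) = W \<phi> r"
    unfolding W_eq[OF m] W_eq[OF assms(1,2)] a v neg_power(2)[OF assms(3)] neg_power(3) by simp
  show ?thesis
    unfolding H_eq[OF m] H_eq[OF assms(1,2)] W a v neg_power(2)[OF assms(3)] neg_power(3)
    by (simp add: diff_divide_distrib)
qed

text \<open>By periodicity \<open>\<phi> \<mapsto> rr (\<phi> + c) x\<close> is again a trajectory,
  the one started at \<open>rr c x\<close>; following it to the angle \<open>- c\<close> leads back
  to \<open>x\<close>. Thus a turn by \<open>- 2 pi\<close> inverts a turn by
  \<open>2 pi\<close>.\<close>

lemma rr_shift:
  assumes x: "\<bar>x\<bar> < \<rho>1" and c: "c = 2 * pi \<or> c = - (2 * pi)"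
  shows "rr (- c) (rr c x) = x"
proof (cases "x = 0")
  case True
  then show ?thesis by simp
next
  case False
  \<comment> \<open>The interval spanned by 0 and \<open>- c\<close> for either sign of
    \<open>c\<close>; its shift by \<open>c\<close> stays in \<open>J\<close>.\<close>
  define a where "a = min 0 (- c)"
  define b where "b = max 0 (- c)"
  have J: "c \<in> J" "{a..b} \<subseteq> J" "0 \<in> {a..b}" "- c \<in> {a..b}" and sh: "\<And>\<phi>. \<phi> \<in> {a..b} \<Longrightarrow> \<phi> + c \<in> J"
    using c pi_J by (auto simp: a_def b_def)
  have x0: "\<bar>x\<bar> < \<rho>0" using x \<rho>_pos by linarith
  have "rr (- c + c) x = rr (- c) (rr c x)"
  proof (rule rr_unique[OF J(2), where w = "\<lambda>\<phi>. rr (\<phi> + c) x" and ?t0.0 = 0])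
    fix \<phi> assume \<phi>: "\<phi> \<in> {a..b}"
    have "((\<lambda>\<phi>. rr (\<phi> + c) x) has_real_derivative rr (\<phi> + c) x * H (\<phi> + c) (rr (\<phi> + c) x) * 1) (at \<phi> within {a..b})"
      using rr_affine[OF x0, of "{a..b}" "1" "c" \<phi>] sh \<phi> by simp
    moreover have "H (\<phi> + c) (rr (\<phi> + c) x) = H \<phi> (rr (\<phi> + c) x)"
      using c H_period[of "rr (\<phi> + c) x" \<phi>] H_period[of "rr (\<phi> + c) x" "\<phi> + c"]
        rr_lt_R[OF x0 sh[OF \<phi>]] False by auto
    ultimately show "((\<lambda>\<phi>. rr (\<phi> + c) x) has_real_derivative rr (\<phi> + c) x * H \<phi> (rr (\<phi> + c) x)) (at \<phi> within {a..b})"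
      by simp
    show "\<bar>rr (\<phi> + c) x\<bar> < R" using rr_lt_R[OF x0 sh[OF \<phi>]] .
  qed (use J x rr_lt_\<rho>0 in auto)
  then show ?thesis using x0 by simp
qed

text \<open>At angle \<open>pi\<close> the curve has abscissa \<open>- rr pi x\<close>, and this
  number is the start of the same closed curve seen from the other side, where \<open>r\<close> has
  the opposite sign. For odd \<open>n\<close> the half turn from there follows the angles from
  \<open>pi\<close> to \<open>2 pi\<close> and ends at \<open>x\<close> because \<open>x\<close> is
  fixed; for even \<open>n\<close> it retraces the first half backwards.\<close>

lemma rr_half_turn:
  assumes x: "\<bar>x\<bar> < \<rho>1" and fixp: "rr (2 * pi) x = x"
  shows "rr pi (- rr pi x) = - x"
proof (cases "x = 0")
  case True
  then show ?thesis by simp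
next
  case False
  have x0: "\<bar>x\<bar> < \<rho>0" using x \<rho>_pos by linarith
  have sub: "{0..pi} \<subseteq> J" using pi_J by auto
  have s: "\<bar>- rr pi x\<bar> < \<rho>0" using rr_lt_\<rho>0[OF x pi_J(3)] by simp
  show ?thesis
  proof (cases "odd n")
    case True
    have sh: "\<phi> + pi \<in> J" if "\<phi> \<in> {0..pi}" for \<phi> using that pi_J by auto
    have "- rr (pi + pi) x = rr pi (- rr pi x)"
    proof (rule rr_unique[OF sub s, where w = "\<lambda>\<phi>. - rr (\<phi> + pi) x" and ?t0.0 = 0])
      fix \<phi> assume \<phi>: "\<phi> \<in> {0..pi}"
      have "((\<lambda>\<phi>. rr (\<phi> + pi) x) has_real_derivative rr (\<phi> + pi) x * H (\<phi> + pi) (rr (\<phi> + pi) x) * 1) (at \<phi> within {0..pi})"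
        using rr_affine[OF x0, of "{0..pi}" "1" "pi" \<phi>] sh \<phi> by simp
      moreover have "H (\<phi> + pi) (rr (\<phi> + pi) x) = H \<phi> (- rr (\<phi> + pi) x)"
        using H_symm_odd[of "- rr (\<phi> + pi) x" \<phi>] rr_lt_R[OF x0 sh[OF \<phi>]] False True by simp
      ultimately show "((\<lambda>\<phi>. - rr (\<phi> + pi) x) has_real_derivative - rr (\<phi> + pi) x * H \<phi> (- rr (\<phi> + pi) x)) (at \<phi> within {0..pi})"
        using DERIV_minus by fastforce
      show "\<bar>- rr (\<phi> + pi) x\<bar> < R" using rr_lt_R[OF x0 sh[OF \<phi>]] by simp
    qed (use s in auto)
    then show ?thesis using fixp by simp
  next
    case ev: False
    have sh: "pi - \<phi> \<in> J" if "\<phi> \<in> {0..pi}" for \<phi> using that pi_J by auto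
    have "- rr (pi - pi) x = rr pi (- rr pi x)"
    proof (rule rr_unique[OF sub s, where w = "\<lambda>\<phi>. - rr (pi - \<phi>) x" and ?t0.0 = 0])
      fix \<phi> assume \<phi>: "\<phi> \<in> {0..pi}"
      have "((\<lambda>\<phi>. rr (pi - \<phi>) x) has_real_derivative rr (pi - \<phi>) x * H (pi - \<phi>) (rr (pi - \<phi>) x) * (- 1)) (at \<phi> within {0..pi})"
        using rr_affine[OF x0, of "{0..pi}" "(- 1)" "pi" \<phi>] sh \<phi> by simp
      moreover have "H (pi - \<phi>) (rr (pi - \<phi>) x) = - H \<phi> (- rr (pi - \<phi>) x)"
        using H_symm_even[of "- rr (pi - \<phi>) x" \<phi>] rr_lt_R[OF x0 sh[OF \<phi>]] False ev by simp
      ultimately show "((\<lambda>\<phi>. - rr (pi - \<phi>) x) has_real_derivative - rr (pi - \<phi>) x * H \<phi> (- rr (pi - \<phi>) x)) (at \<phi> within {0..pi})"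
        using DERIV_minus by fastforce
      show "\<bar>- rr (pi - \<phi>) x\<bar> < R" using rr_lt_R[OF x0 sh[OF \<phi>]] by simp
    qed (use s in auto)
    then show ?thesis using x0 by simp
  qed
qed

end

section \<open>Orbits as curves over the angle, and the first return\<close>

lemma IVT_image:
  fixes T :: "real \<Rightarrow> real"
  assumes "continuous_on I T" "{a..b} \<subseteq> I" "a \<le> b" "t \<in> {T a..T b}"
  obtains x where "x \<in> {a..b}" "T x = t"
  using IVT'[of T a t b] continuous_on_subset[OF assms(1,2)] assms(3,4) by auto

context polar_flow
begin

abbreviation I where "I \<equiv> {-7<..<7::real}"

text \<open>\<open>x' = v + e\<close> with \<open>v = y - F(x)\<close>, and the contraction property
  gives \<open>\<bar>e\<bar> \<le> \<bar>v\<bar> / 2\<close>. So \<open>x'\<close> has the sign of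
  \<open>v\<close> and vanishes only on \<open>y = F(x)\<close>.\<close>

lemma field_sign:
  assumes "\<bar>x\<bar> < R" "\<bar>y\<bar> \<le> s"
  shows "(y - F x \<delta>)\<^sup>2 / 2 \<le> (y + X x y \<delta>) * (y - F x \<delta>)"
proof -
  define v where "v = y - F x \<delta>"
  define e where "e = X x y \<delta> - X x (F x \<delta>) \<delta>"
  have e: "\<bar>e\<bar> \<le> 1/2 * \<bar>v\<bar>" unfolding e_def v_def by (intro contr F_s assms)
  have "y + X x y \<delta> = v + e"
    using F_eq[OF assms(1)] by (simp add: v_def e_def)
  moreover have "\<bar>e * v\<bar> \<le> 1/2 * v\<^sup>2"
    using mult_right_mono[OF e abs_ge_zero[of v]] by (simp add: abs_mult power2_eq_square)
  ultimately show ?thesis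
    unfolding v_def[symmetric] by (simp add: distrib_right power2_eq_square)
qed

lemma curve_facts:
  assumes "\<bar>r\<bar> < R"
  shows "\<bar>r * cos \<phi>\<bar> < R" "(r * cos \<phi>, yr \<phi> r) \<in> box"
proof -
  show 1: "\<bar>r * cos \<phi>\<bar> < R"
    using mult_left_le[of "\<bar>cos \<phi>\<bar>" "\<bar>r\<bar>"] assms by (simp add: abs_mult)
  show "(r * cos \<phi>, yr \<phi> r) \<in> box"
    using 1 yr_s[OF assms, of \<phi>] R by (auto simp: box_def)
qed

text \<open>The rate \<open>dt/d\<phi>\<close> along the trajectory of \<open>x\<close>; its sign is
  that of \<open>r^(n-1)\<close>.\<close>

definition qq :: "real \<Rightarrow> real \<Rightarrow> real" where
  "qq \<phi> x = ((cos \<phi>)\<^sup>2 + n * (sin \<phi>)\<^sup>2) / (rr \<phi> x ^ (n - 1) * W \<phi> (rr \<phi> x))"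

definition cv :: "real \<Rightarrow> real \<Rightarrow> real \<times> real" where
  "cv x \<phi> = (rr \<phi> x * cos \<phi>, yr \<phi> (rr \<phi> x))"

lemma num_pos: "0 < (cos \<phi>)\<^sup>2 + real n * (sin \<phi>)\<^sup>2"
proof -
  have "1 * (sin \<phi>)\<^sup>2 \<le> real n * (sin \<phi>)\<^sup>2"
    by (rule mult_right_mono) (use n2 in auto)
  then show ?thesis using sin_cos_squared_add2[of \<phi>] by linarith
qed

lemma x_rr_pos:
  assumes "x \<noteq> 0"
  shows "0 < x * rr \<phi> x"
proof -
  have "x * rr \<phi> x = x\<^sup>2 * exp (u \<phi> x)" by (simp add: rr_def power2_eq_square)
  then show ?thesis using assms by simp
qed

text \<open>The first two parts undo the solution of the system for \<open>r'\<close> and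
  \<open>\<phi>'\<close>: the chain rule for \<open>r cos \<phi>\<close> and
  \<open>- r^n sin \<phi>\<close> gives back \<open>qq\<close> times \<open>x'\<close> and
  \<open>v'\<close>. In the third, \<open>x' v \<ge> 0\<close> with
  \<open>v = - r^n sin \<phi>\<close> fixes the sign of \<open>dx/d\<phi>\<close>, so the abscissa
  is monotone on each half turn.\<close>

lemma qq_A:
  fixes r :: real
  assumes x: "\<bar>x\<bar> < \<rho>0" "x \<noteq> 0" and \<phi>: "\<phi> \<in> J" and r_def: "r = rr \<phi> x"
  shows "qq \<phi> x * A \<phi> r = r * H \<phi> r * cos \<phi> - r * sin \<phi>"
    "qq \<phi> x * V \<phi> r = - (n * r ^ (n - 1) * (r * H \<phi> r) * sin \<phi> + r ^ n * cos \<phi>)"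
    "x * (qq \<phi> x * A \<phi> r) * sin \<phi> \<le> 0"
proof -
  have r: "\<bar>r\<bar> < R" "r \<noteq> 0" using rr_lt_R[OF x(1) \<phi>] x(2) by (auto simp: r_def)
  \<comment> \<open>All powers of \<open>r\<close> are expressed through \<open>p = r^(n-1)\<close>;
    with \<open>al\<close>, \<open>be\<close>, \<open>c\<close>, \<open>d\<close>, \<open>w\<close>
    the first two claims reduce to the polynomial identities \<open>i1\<close> and
    \<open>i2\<close>.\<close>
  define p where "p = r ^ (n - 1)"
  have p: "p \<noteq> 0" "r ^ n = r * p" "r ^ (2 * n - 1) = r * p * p"
  proof -
    show "p \<noteq> 0" using r by (simp add: p_def)
    have "n = Suc (n - 1)" "2 * n - 1 = Suc ((n - 1) + (n - 1))" using n2 by auto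
    then show "r ^ n = r * p" "r ^ (2 * n - 1) = r * p * p"
      unfolding p_def by (metis power_Suc, metis power_Suc power_add mult.assoc)
  qed
  define al where "al = A \<phi> r / r ^ n"
  define be where "be = V \<phi> r / r ^ (2 * n - 1)"
  define c where "c = cos \<phi>"
  define d where "d = sin \<phi>"
  define w where "w = W \<phi> r"
  have A: "A \<phi> r = al * (r * p)" and V: "V \<phi> r = be * (r * p * p)"
    using r p by (simp_all add: al_def be_def)
  have w: "w = - (n * d * al + c * be)" and w0: "w > 0"
    using W_eq[OF r] W_pos[OF \<phi> r(1)] by (simp_all add: w_def al_def be_def c_def d_def)
  have h: "H \<phi> r = (c * al - d * be) / w"
    using H_eq[OF r] by (simp add: w_def al_def be_def c_def d_def)
  have q: "qq \<phi> x = (c\<^sup>2 + n * d\<^sup>2) / (p * w)"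
    by (simp add: qq_def r_def[symmetric] p_def c_def d_def w_def)
  have i1: "(c * al - d * be) * c - d * w = (c\<^sup>2 + n * d\<^sup>2) * al"
    unfolding w by (simp add: power2_eq_square algebra_simps)
  have i2: "n * (c * al - d * be) * d + c * w = - ((c\<^sup>2 + n * d\<^sup>2) * be)"
    unfolding w by (simp add: power2_eq_square algebra_simps)
  have "r * H \<phi> r * c - r * d = r * (((c * al - d * be) * c - d * w) / w)"
    unfolding h using w0 by (simp add: field_simps)
  also have "\<dots> = qq \<phi> x * A \<phi> r"
    unfolding i1 q A using p by simp
  finally show "qq \<phi> x * A \<phi> r = r * H \<phi> r * cos \<phi> - r * sin \<phi>" by (simp add: c_def d_def)
  have "n * p * (r * H \<phi> r) * d + r * p * c = r * p * ((n * (c * al - d * be) * d + c * w) / w)"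
    unfolding h using w0 by (simp add: field_simps)
  also have "\<dots> = - (qq \<phi> x * V \<phi> r)"
    unfolding i2 q V using p by simp
  finally show "qq \<phi> x * V \<phi> r = - (n * r ^ (n - 1) * (r * H \<phi> r) * sin \<phi> + r ^ n * cos \<phi>)"
    unfolding p(2) p_def[symmetric] by (simp add: c_def d_def)
  have "0 \<le> (yr \<phi> r + X (r * cos \<phi>) (yr \<phi> r) \<delta>) * (yr \<phi> r - F (r * cos \<phi>) \<delta>)"
    using field_sign[OF curve_facts(1)[OF r(1)] yr_s[OF r(1)], of \<phi> \<phi>]
      zero_le_power2[of "yr \<phi> r - F (r * cos \<phi>) \<delta>"] by linarith
  then have "A \<phi> r * (r ^ n * d) \<le> 0"
    unfolding A_def[symmetric] by (simp add: yr_def d_def)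
  then have "al * d * (r * p)\<^sup>2 \<le> 0"
    unfolding A p(2) by (simp add: power2_eq_square algebra_simps)
  moreover have "0 < (r * p)\<^sup>2" using r p by simp
  ultimately have ad: "al * d \<le> 0"
    using mult_pos_pos[of "al * d" "(r * p)\<^sup>2"] by linarith
  have "0 < x * r" using x_rr_pos[OF x(2)] by (simp add: r_def)
  then have "0 \<le> x * r * ((c\<^sup>2 + n * d\<^sup>2) / w)"
    using num_pos[of \<phi>] w0 by (simp add: c_def d_def)
  from mult_nonneg_nonpos[OF this ad]
  have "x * r * ((c\<^sup>2 + n * d\<^sup>2) / w) * (al * d) \<le> 0" .
  moreover have "x * (qq \<phi> x * A \<phi> r) * sin \<phi> = x * r * ((c\<^sup>2 + n * d\<^sup>2) / w) * (al * d)"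
    unfolding q A using p by (simp add: d_def)
  ultimately show "x * (qq \<phi> x * A \<phi> r) * sin \<phi> \<le> 0" by simp
qed

lemma at_J: "\<phi> \<in> I \<Longrightarrow> at \<phi> within J = at \<phi>"
  by (rule at_within_interior) (simp add: interior_atLeastAtMost_real)

lemma curve_x_deriv:
  assumes x: "\<bar>x\<bar> < \<rho>0" "x \<noteq> 0" and \<phi>: "\<phi> \<in> I"
  shows "((\<lambda>\<phi>. rr \<phi> x * cos \<phi>) has_real_derivative qq \<phi> x * A \<phi> (rr \<phi> x)) (at \<phi>)"
proof -
  have \<phi>': "\<phi> \<in> J" using \<phi> by auto
  have "((\<lambda>\<phi>. rr \<phi> x) has_real_derivative rr \<phi> x * H \<phi> (rr \<phi> x)) (at \<phi>)"
    using rr_deriv[OF x(1) \<phi>'] at_J[OF \<phi>] by simp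
  then have "((\<lambda>\<phi>. rr \<phi> x * cos \<phi>) has_real_derivative
      rr \<phi> x * H \<phi> (rr \<phi> x) * cos \<phi> + - sin \<phi> * rr \<phi> x) (at \<phi>)"
    by (intro DERIV_mult DERIV_cos)
  then show ?thesis
    unfolding qq_A(1)[OF x \<phi>' refl] by (simp add: mult.commute)
qed

text \<open>For the second component \<open>y = F(x) + v\<close>: its derivative is
  \<open>qq\<close> times \<open>F'(x) A + V\<close>, which is \<open>Y\<close> by
  \<open>V_def\<close>.\<close>

lemma curve_deriv:
  assumes x: "\<bar>x\<bar> < \<rho>0" "x \<noteq> 0" and \<phi>: "\<phi> \<in> I"
  shows "(cv x has_vector_derivative qq \<phi> x *\<^sub>R fld (cv x \<phi>)) (at \<phi>)"
proof -
  have \<phi>': "\<phi> \<in> J" using \<phi> by auto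
  let ?r = "rr \<phi> x"
  have r: "\<bar>?r\<bar> < R" using rr_lt_R[OF x(1) \<phi>'] .
  note dx = curve_x_deriv[OF x \<phi>]
  have dr: "((\<lambda>\<phi>. rr \<phi> x) has_real_derivative ?r * H \<phi> ?r) (at \<phi>)"
    using rr_deriv[OF x(1) \<phi>'] at_J[OF \<phi>] by simp
  have "((\<lambda>\<phi>. rr \<phi> x ^ n * sin \<phi>) has_real_derivative
      n * ?r ^ (n - 1) * (?r * H \<phi> ?r) * sin \<phi> + ?r ^ n * cos \<phi>) (at \<phi>)"
    by (rule derivative_eq_intros dr refl | simp)+
  moreover have "((\<lambda>\<phi>. F (rr \<phi> x * cos \<phi>) \<delta>) has_real_derivative
      deriv (\<lambda>x. F x \<delta>) (?r * cos \<phi>) * (qq \<phi> x * A \<phi> ?r)) (at \<phi>)"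
    by (rule DERIV_chain2[OF Fd[OF curve_facts(1)[OF r]] dx])
  ultimately have "((\<lambda>\<phi>. F (rr \<phi> x * cos \<phi>) \<delta> - rr \<phi> x ^ n * sin \<phi>) has_real_derivative
      deriv (\<lambda>x. F x \<delta>) (?r * cos \<phi>) * (qq \<phi> x * A \<phi> ?r) - (n * ?r ^ (n - 1) * (?r * H \<phi> ?r) * sin \<phi> + ?r ^ n * cos \<phi>)) (at \<phi>)"
    by (intro DERIV_diff)
  moreover have "deriv (\<lambda>x. F x \<delta>) (?r * cos \<phi>) * (qq \<phi> x * A \<phi> ?r) - (n * ?r ^ (n - 1) * (?r * H \<phi> ?r) * sin \<phi> + ?r ^ n * cos \<phi>)
     = qq \<phi> x * Y (?r * cos \<phi>) (yr \<phi> ?r) \<delta>"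
  proof -
    have "deriv (\<lambda>x. F x \<delta>) (?r * cos \<phi>) * (qq \<phi> x * A \<phi> ?r) - (n * ?r ^ (n - 1) * (?r * H \<phi> ?r) * sin \<phi> + ?r ^ n * cos \<phi>)
      = deriv (\<lambda>x. F x \<delta>) (?r * cos \<phi>) * (qq \<phi> x * A \<phi> ?r) + qq \<phi> x * V \<phi> ?r"
      unfolding qq_A(2)[OF x \<phi>' refl] by simp
    also have "\<dots> = qq \<phi> x * Y (?r * cos \<phi>) (yr \<phi> ?r) \<delta>"
      by (simp add: V_def algebra_simps)
    finally show ?thesis .
  qed
  ultimately have dy: "((\<lambda>\<phi>. yr \<phi> (rr \<phi> x)) has_real_derivative qq \<phi> x * Y (?r * cos \<phi>) (yr \<phi> ?r) \<delta>) (at \<phi>)"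
    by (simp add: yr_def)
  have "((\<lambda>\<phi>. (rr \<phi> x * cos \<phi>, yr \<phi> (rr \<phi> x))) has_vector_derivative
      (qq \<phi> x * A \<phi> ?r, qq \<phi> x * Y (?r * cos \<phi>) (yr \<phi> ?r) \<delta>)) (at \<phi>)"
    using dx dy by (intro has_vector_derivative_Pair) (simp_all add: has_real_derivative_iff_has_vector_derivative)
  then show ?thesis
    unfolding cv_def by (simp add: fld_def A_def)
qed

text \<open>\<open>sg x\<close> is the direction in which \<open>\<phi>\<close> runs along the orbit through \<open>(x, F x)\<close> as time increases.\<close>

definition sg :: "real \<Rightarrow> real" where "sg x = (if odd n \<or> 0 < x then 1 else -1)"

lemma sg_cases: "sg x = 1 \<or> sg x = -1" by (simp add: sg_def)

lemma sg_J: "\<psi> \<in> J \<Longrightarrow> sg x * \<psi> \<in> J" and sg_I: "\<psi> \<in> I \<Longrightarrow> sg x * \<psi> \<in> I"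
  by (auto simp: sg_def)

lemma sg_power:
  assumes "x \<noteq> 0"
  shows "0 < sg x * rr \<phi> x ^ (n - 1)"
proof (cases "odd n \<or> 0 < x")
  case True
  then have "0 < rr \<phi> x ^ (n - 1)"
    using assms n2 by (auto simp: zero_less_power_eq)
  then show ?thesis using True by (auto simp: sg_def)
next
  case False
  then have "rr \<phi> x ^ (n - 1) < 0"
    using assms n2 by (auto simp: power_less_zero_eq)
  then show ?thesis using False by (auto simp: sg_def)
qed

text \<open>Running the angle as \<open>sg x * t\<close> makes the rate \<open>sg x * qq\<close>
  positive, so that \<open>time_change\<close> applies. The interval contains a full turn in both
  directions, so past and future of the starting point are covered.\<close>

lemma orbit:
  assumes x: "\<bar>x\<bar> < \<rho>0" "x \<noteq> 0"
  obtains T z where "T 0 = 0" "strict_mono_on I T" "continuous_on I T"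
    "\<And>t. t \<in> I \<Longrightarrow> z (T t) = cv x (sg x * t)"
    "\<And>t. t \<in> I \<Longrightarrow> (z has_vector_derivative fld (z (T t))) (at (T t))"
proof -
  let ?p = "\<lambda>t. sg x * qq (sg x * t) x"
  have rin: "rr \<phi> x \<in> {-R<..<R}" if "\<phi> \<in> J" for \<phi>
    using rr_lt_R[OF x(1) that] by auto
  have cW: "continuous_on J (\<lambda>\<phi>. W \<phi> (rr \<phi> x))"
  proof -
    have "continuous_on J (\<lambda>\<phi>. (\<lambda>(\<phi>, r). W \<phi> r) (\<phi>, rr \<phi> x))"
      by (intro continuous_on_compose2[OF W_cont] continuous_intros rr_cont x)
        (use rin in auto)
    then show ?thesis by simp
  qed
  have "continuous_on J (\<lambda>\<phi>. qq \<phi> x)"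
    unfolding qq_def using W_pos rr_lt_R[OF x(1)] x
    by (intro continuous_intros rr_cont cW) (auto simp: less_imp_neq[symmetric])
  then have "continuous_on J (\<lambda>t. qq (sg x * t) x)"
    by (rule continuous_on_compose2) (auto intro!: continuous_intros simp: sg_def)
  then have pc: "continuous_on J ?p" by (intro continuous_intros)
  have pp: "0 < ?p t" if "t \<in> J" for t
  proof -
    let ?\<phi> = "sg x * t"
    have W: "0 < W ?\<phi> (rr ?\<phi> x)" using W_pos rr_lt_R x sg_J[OF that] by simp
    have "0 < ((cos ?\<phi>)\<^sup>2 + n * (sin ?\<phi>)\<^sup>2) / (sg x * rr ?\<phi> x ^ (n - 1) * W ?\<phi> (rr ?\<phi> x))"
      by (rule divide_pos_pos[OF num_pos mult_pos_pos[OF sg_power[OF x(2)] W]])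
    also have "\<dots> = ?p t" using sg_cases[of x] by (auto simp: qq_def add_divide_distrib diff_divide_distrib)
    finally show ?thesis .
  qed
  have w: "((\<lambda>t. cv x (sg x * t)) has_vector_derivative ?p t *\<^sub>R fld (cv x (sg x * t))) (at t)" if t: "t \<in> I" for t
  proof -
    have "((\<lambda>t. sg x * t) has_vector_derivative sg x) (at t)"
      by (auto intro!: derivative_eq_intros)
    from vector_diff_chain_at[OF this curve_deriv[OF x sg_I[OF t]]]
    show ?thesis by (simp add: o_def)
  qed
  obtain T z where T: "T 0 = 0" "strict_mono_on I T" "continuous_on I T"
    and z: "\<And>t. t \<in> I \<Longrightarrow> z (T t) = cv x (sg x * t) \<and> (z has_vector_derivative fld (z (T t))) (at (T t))"
    by (rule time_change[of 7 ?p "\<lambda>t. cv x (sg x * t)" fld]) (use pc pp w in auto)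
  show ?thesis
    by (rule that[OF T, of z]) (use z in blast)+
qed

lemma fld_lip: "p \<in> box \<Longrightarrow> p' \<in> box \<Longrightarrow> norm (fld p - fld p') \<le> L2 * norm (p - p')"
  using lip[of "fst p" "snd p" "fst p'" "snd p'"] by (auto simp: box_def fld_def abs_less_iff)

lemma open_box: "open box"
  unfolding box_def by (intro open_Times open_greaterThanLessThan)

lemma cv_box: "\<bar>x\<bar> < \<rho>0 \<Longrightarrow> \<phi> \<in> J \<Longrightarrow> cv x \<phi> \<in> box"
  unfolding cv_def by (intro curve_facts rr_lt_R)

lemma is_solution_fld:
  "is_solution X Y \<Omega> \<delta> z S \<longleftrightarrow> (\<forall>t\<in>S. (fst (z t), snd (z t), \<delta>) \<in> \<Omega> \<and> (z has_vector_derivative fld (z t)) (at t within S))"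
  by (simp add: is_solution_def fld_def)

lemma box_dom: "p \<in> box \<Longrightarrow> (fst p, snd p, \<delta>) \<in> \<Omega>"
  by (intro dom) (auto simp: box_def)

lemma I_facts: "0 \<in> I" "2 * pi \<in> I" "- (2 * pi) \<in> I" "pi \<in> I" "- pi \<in> I" "{- (2 * pi)..2 * pi} \<subseteq> I" "I \<subseteq> J"
proof -
  have p: "0 < pi" "2 * pi < 7" using pi_J(4) by simp_all
  show "0 \<in> I" "2 * pi \<in> I" "- (2 * pi) \<in> I" "pi \<in> I" "- pi \<in> I"
    unfolding greaterThanLessThan_iff using p by linarith+
  show "{- (2 * pi)..2 * pi} \<subseteq> I"
    unfolding subset_iff atLeastAtMost_iff greaterThanLessThan_iff using p by (intro allI impI conjI) linarith+
  show "I \<subseteq> J" by auto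
qed

lemma sin_zero_inside:
  assumes "0 < t" "t < 2 * pi" "sin t = 0"
  shows "t = pi"
  using assms sin_gt_zero[of t] sin_lt_zero[of t] by (metis less_irrefl linorder_neqE)

lemma cv_end: "cv x (sg x * (2 * pi)) = (rr (sg x * (2 * pi)) x, F (rr (sg x * (2 * pi)) x) \<delta>)"
  using sg_cases[of x] by (auto simp: cv_def yr_def)

lemma cv_0: "\<bar>x\<bar> < \<rho>0 \<Longrightarrow> cv x 0 = (x, F x \<delta>)"
  by (simp add: cv_def yr_def)

lemma first_return_unique:
  assumes x: "\<bar>x\<bar> < \<rho>0" "x \<noteq> 0"
  shows "first_return X Y \<Omega> F \<delta> x p \<longleftrightarrow> p = rr (sg x * (2 * pi)) x"
proof -
  obtain T z where T: "T 0 = 0" "strict_mono_on I T" "continuous_on I T"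
    and z: "\<And>t. t \<in> I \<Longrightarrow> z (T t) = cv x (sg x * t)"
      "\<And>t. t \<in> I \<Longrightarrow> (z has_vector_derivative fld (z (T t))) (at (T t))"
    using orbit[OF x] by blast
  define \<tau> where "\<tau> = T (2 * pi)"
  have \<tau>: "0 < \<tau>"
    using strict_mono_onD[OF T(2) I_facts(1,2)] T(1) by (simp add: \<tau>_def)
  have sub: "{0..2 * pi} \<subseteq> I"
    by (rule subset_trans[OF _ I_facts(6)]) simp
  have par: "\<exists>\<psi>\<in>{0..2 * pi}. T \<psi> = t" if "t \<in> {0..\<tau>}" for t
  proof -
    have "0 \<le> 2 * pi" "t \<in> {T 0..T (2 * pi)}" using that T(1) by (simp_all add: \<tau>_def)
    from IVT_image[OF T(3) sub this] show ?thesis by blast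
  qed
  have zbox: "z t \<in> box" if t: "t \<in> {0..\<tau>}" for t
  proof -
    obtain \<psi> where \<psi>: "\<psi> \<in> {0..2 * pi}" "T \<psi> = t" using par[OF t] by blast
    then have I: "\<psi> \<in> I" using sub by blast
    have "sg x * \<psi> \<in> J" using sg_I[OF I] I_facts(7) by blast
    then show ?thesis using z(1)[OF I] cv_box[OF x(1)] \<psi>(2) by metis
  qed
  have zd: "(z has_vector_derivative fld (z t)) (at t)" if t: "t \<in> {0..\<tau>}" for t
    using par[OF t] z(2) sub by blast
  have z0: "z 0 = (x, F x \<delta>)" using z(1)[OF I_facts(1)] T(1) cv_0[OF x(1)] by simp
  have z\<tau>: "z \<tau> = (rr (sg x * (2 * pi)) x, F (rr (sg x * (2 * pi)) x) \<delta>)"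
    using z(1)[OF I_facts(2)] cv_end by (simp add: \<tau>_def)
  have pos: "0 < x * rr \<phi> x" for \<phi>
    using x_rr_pos[OF x(2)] .
  have cross: "\<not> (snd (z t) = F (fst (z t)) \<delta> \<and> x * fst (z t) > 0)" if t: "0 < t" "t < \<tau>" for t
  proof
    assume h: "snd (z t) = F (fst (z t)) \<delta> \<and> x * fst (z t) > 0"
    obtain \<psi> where \<psi>: "\<psi> \<in> {0..2 * pi}" "T \<psi> = t" using par[of t] t by auto
    have "\<psi> \<noteq> 0" "\<psi> \<noteq> 2 * pi" using \<psi>(2) t T(1) by (auto simp: \<tau>_def)
    then have \<psi>': "0 < \<psi>" "\<psi> < 2 * pi" using \<psi>(1) by auto
    have zt: "z t = cv x (sg x * \<psi>)" using z(1)[of \<psi>] \<psi> sub by auto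
    have "rr (sg x * \<psi>) x ^ n * sin (sg x * \<psi>) = 0"
      using h by (simp add: zt cv_def yr_def)
    then have "sin \<psi> = 0" using x(2) sg_cases[of x] by auto
    then have "\<psi> = pi" using sin_zero_inside \<psi>' by blast
    then have "fst (z t) = - rr (sg x * \<psi>) x" using sg_cases[of x] by (auto simp: zt cv_def)
    then show False using h pos[of "sg x * \<psi>"] by simp
  qed
  have zsol: "is_solution X Y \<Omega> \<delta> z {0..\<tau>}"
    unfolding is_solution_fld using zbox box_dom zd has_vector_derivative_at_within by blast
  have fr: "first_return X Y \<Omega> F \<delta> x (rr (sg x * (2 * pi)) x)"
    unfolding first_return_def
    by (intro exI[of _ z] exI[of _ \<tau>] conjI) (use \<tau> zsol z0 z\<tau> pos cross in auto)
  show ?thesis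
  proof
    assume "first_return X Y \<Omega> F \<delta> x p"
    then obtain w \<sigma> where w: "0 < \<sigma>" "is_solution X Y \<Omega> \<delta> w {0..\<sigma>}" "w 0 = (x, F x \<delta>)"
      "snd (w \<sigma>) = F (fst (w \<sigma>)) \<delta>" "x * fst (w \<sigma>) > 0"
      "\<And>t. 0 < t \<Longrightarrow> t < \<sigma> \<Longrightarrow> \<not> (snd (w t) = F (fst (w t)) \<delta> \<and> x * fst (w t) > 0)" "p = fst (w \<sigma>)"
      unfolding first_return_def by blast
    let ?m = "min \<tau> \<sigma>"
    have eq: "z t = w t" if t: "t \<in> {0..?m}" for t
    proof (rule ode_unique_local[where f = fld and S = box and a = 0 and b = ?m and ?t0.0 = 0 and L = L2])
      fix t assume t: "t \<in> {0..?m}"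
      show "(z has_vector_derivative fld (z t)) (at t within {0..?m})"
        using zd[of t] t by (auto intro: has_vector_derivative_at_within)
      have "(w has_vector_derivative fld (w t)) (at t within {0..\<sigma>})"
        using w(2) t unfolding is_solution_fld by auto
      then show "(w has_vector_derivative fld (w t)) (at t within {0..?m})"
        by (rule has_vector_derivative_within_subset) auto
      show "z t \<in> box" using zbox t by auto
    qed (use fld_lip open_box z0 w(1,3) \<tau> t in auto)
    have "\<tau> = \<sigma>"
    proof (rule linorder_cases[of \<tau> \<sigma>])
      assume "\<tau> < \<sigma>"
      then have "w \<tau> = z \<tau>" using eq[of \<tau>] \<tau> by simp
      then have "snd (w \<tau>) = F (fst (w \<tau>)) \<delta> \<and> x * fst (w \<tau>) > 0" using z\<tau> pos by simp
      then show ?thesis using w(6)[OF \<tau> \<open>\<tau> < \<sigma>\<close>] by blast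
    next
      assume "\<sigma> < \<tau>"
      then have "w \<sigma> = z \<sigma>" using eq[of \<sigma>] w(1) by simp
      then show ?thesis using cross[OF w(1) \<open>\<sigma> < \<tau>\<close>] w(4,5) by simp
    qed simp
    then show "p = rr (sg x * (2 * pi)) x"
      using eq[of \<tau>] \<tau> w(7) z\<tau> by simp
  qed (use fr in simp)
qed

lemma return_map_eq:
  assumes x: "\<bar>x\<bar> < \<rho>0"
  shows "return_map X Y \<Omega> F x \<delta> = rr (sg x * (2 * pi)) x"
  using first_return_unique[OF x] by (simp add: return_map_def)

text \<open>The second radius is \<open>\<rho>1 * exp (- (M * 7))\<close> because a turn by
  \<open>- 2 pi\<close> carries smaller values into \<open>{-\<rho>1<..<\<rho>1}\<close>; this
  yields the inclusion in the image and the value of the inverse. For even \<open>n\<close> and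
  \<open>x < 0\<close> the direction \<open>sg x = - 1\<close> makes the return map equal to this
  inverse.\<close>

lemma analytic_return_rr:
  assumes v: "\<And>x. \<bar>x\<bar> < \<rho>0 \<Longrightarrow> (\<lambda>j. v (Suc j) * x ^ Suc j) sums (rr (2 * pi) x - x)"
    and d: "((\<lambda>x. rr (2 * pi) x) has_real_derivative exp (u (2 * pi) 0)) (at 0)"
  shows "analytic_return n (\<lambda>x. return_map X Y \<Omega> F x \<delta>) \<rho>1 (\<rho>1 * exp (- (M * 7))) (\<lambda>x. rr (2 * pi) x)"
proof -
  define e where "e = \<rho>1 * exp (- (M * 7))"
  have e: "0 < e" "e \<le> \<rho>1"
    using \<rho>_pos M by (auto simp: e_def intro: mult_left_le)
  have backw: "\<bar>rr (- (2 * pi)) y\<bar> < \<rho>1" if y: "\<bar>y\<bar> < e" for y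
  proof -
    have "\<bar>y\<bar> * exp (M * 7) < e * exp (M * 7)" using y by simp
    also have "\<dots> = \<rho>1" by (simp add: e_def exp_minus)
    finally show ?thesis using rr_le[of y "- (2 * pi)"] y e \<rho>_pos pi_J by linarith
  qed
  have inv: "rr (2 * pi) (rr (- (2 * pi)) y) = y" if "\<bar>y\<bar> < e" for y
    using rr_shift[of y "- (2 * pi)"] that e by simp
  have inj: "inj_on (rr (2 * pi)) {-\<rho>1<..<\<rho>1}"
    by (rule inj_onI, rule rr_inj[of _ _ "2 * pi"]) (use \<rho>_pos pi_J in auto)
  have sums: "\<exists>v. \<forall>x\<in>{-\<rho>1<..<\<rho>1}. (\<lambda>j. v (Suc j) * x ^ Suc j) sums (rr (2 * pi) x - x)"
    using v \<rho>_pos by (intro exI[of _ v]) auto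
  have ret: "return_map X Y \<Omega> F x \<delta> = rr (sg x * (2 * pi)) x" if "x \<in> {-e<..<e}" for x
    using return_map_eq that e \<rho>_pos by auto
  show ?thesis
    unfolding analytic_return_def e_def[symmetric]
  proof (intro conjI impI ballI sums inj)
    show "deriv (rr (2 * pi)) 0 > 0" using DERIV_imp_deriv[OF d] by simp
    show "return_map X Y \<Omega> F x \<delta> = rr (2 * pi) x" if "odd n" "x \<in> {-e<..<e}" for x
      using ret that by (simp add: sg_def)
    show "return_map X Y \<Omega> F x \<delta> = rr (2 * pi) x" if "even n" "x \<in> {0<..<e}" for x
      using ret[of x] that e by (simp add: sg_def)
    show "{-e<..<e} \<subseteq> rr (2 * pi) ` {-\<rho>1<..<\<rho>1}"
    proof
      fix y assume "y \<in> {-e<..<e}"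
      then have y: "\<bar>y\<bar> < e" by auto
      then show "y \<in> rr (2 * pi) ` {-\<rho>1<..<\<rho>1}"
        using backw[OF y] inv[OF y] by (intro image_eqI[of _ _ "rr (- (2 * pi)) y"]) auto
    qed
    show "return_map X Y \<Omega> F x \<delta> = the_inv_into {-\<rho>1<..<\<rho>1} (rr (2 * pi)) x"
      if "even n" "x \<in> {-e<..<0}" for x
    proof -
      have y: "\<bar>x\<bar> < e" using that by auto
      have "the_inv_into {-\<rho>1<..<\<rho>1} (rr (2 * pi)) (rr (2 * pi) (rr (- (2 * pi)) x)) = rr (- (2 * pi)) x"
        by (rule the_inv_into_f_f[OF inj]) (use backw[OF y] in auto)
      then show ?thesis using ret[of x] inv[OF y] that y by (simp add: sg_def)
    qed
  qed (use e in auto)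
qed

end

section \<open>Periodic orbits\<close>

lemma periodic_int:
  fixes z :: "real \<Rightarrow> 'a"
  assumes "\<And>t. z (t + T) = z t"
  shows "z (t + of_int k * T) = z t"
proof -
  have nat: "z (t + of_nat j * T) = z t" for j t
  proof (induction j)
    case (Suc j)
    have "z (t + of_nat (Suc j) * T) = z ((t + of_nat j * T) + T)"
      by (simp add: algebra_simps)
    then show ?case using assms Suc by simp
  qed simp
  show ?thesis
  proof (cases "k \<ge> 0")
    case True
    then show ?thesis using nat[of t "nat k"] by simp
  next
    case False
    then show ?thesis using nat[of "t + of_int k * T" "nat (- k)"] by simp
  qed
qed

lemma periodic_range:
  fixes z :: "real \<Rightarrow> 'a"
  assumes "\<And>t. z (t + T) = z t" "0 < T"
  shows "range z = z ` {0..T}"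
proof
  show "range z \<subseteq> z ` {0..T}"
  proof
    fix y assume "y \<in> range z"
    then obtain t where t: "y = z t" by blast
    let ?k = "\<lfloor>t / T\<rfloor>"
    have "z (t + of_int (- ?k) * T) = z t" by (rule periodic_int[of z T, OF assms(1)])
    moreover have "t + of_int (- ?k) * T \<in> {0..T}"
      using floor_divide_lower[OF assms(2), of t] floor_divide_upper[OF assms(2), of t]
      by (simp add: algebra_simps)
    ultimately show "y \<in> z ` {0..T}" using t by (metis imageI)
  qed
qed auto

context polar_flow
begin

text \<open>Where \<open>x'\<close> vanishes, \<open>field_sign\<close> puts the point on
  \<open>y = F(x)\<close>, so the solution follows the curve \<open>cv\<close> through it. A full
  turn either way yields the abscissas \<open>rr (2 * pi) x\<close> and
  \<open>rr (- (2 * pi)) x\<close>, and half a turn yields one of opposite sign. With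
  \<open>x = 0\<close> the solution would be the equilibrium.\<close>

lemma critical_point:
  assumes sol: "is_solution X Y \<Omega> \<delta> z UNIV" and nonconst: "\<exists>t. z t \<noteq> z 0"
    and U: "\<And>t. z t \<in> {-\<eta><..<\<eta>} \<times> {-\<kappa><..<\<kappa>}" and \<eta>: "\<eta> \<le> \<rho>1" and \<kappa>: "\<kappa> \<le> s"
    and crit: "fst (fld (z t1)) = 0"
  defines "x \<equiv> fst (z t1)"
  shows "x \<noteq> 0" "\<exists>t. fst (z t) = rr (2 * pi) x" "\<exists>t. fst (z t) = rr (- (2 * pi)) x" "\<exists>t. fst (z t) * x < 0"
proof -
  have zd: "(z has_vector_derivative fld (z t)) (at t)" for t
    using sol by (simp add: is_solution_fld)
  have x\<eta>: "\<bar>x\<bar> < \<eta>" and y\<kappa>: "\<bar>snd (z t1)\<bar> \<le> s"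
    using U[of t1] \<kappa> by (auto simp: x_def mem_Times_iff)
  have xR: "\<bar>x\<bar> < R" and x0: "\<bar>x\<bar> < \<rho>0" and x1: "\<bar>x\<bar> < \<rho>1" using x\<eta> \<eta> \<rho>_pos by linarith+
  have "(snd (z t1) - F x \<delta>)\<^sup>2 / 2 \<le> 0"
    using field_sign[OF xR y\<kappa>] crit by (simp add: fld_def x_def)
  then have "(snd (z t1) - F x \<delta>)\<^sup>2 = 0"
    using zero_le_power2[of "snd (z t1) - F x \<delta>"] by linarith
  then have zt1: "z t1 = (x, F x \<delta>)"
    by (simp add: prod_eq_iff x_def)
  show xn: "x \<noteq> 0"
  proof
    assume "x = 0"
    then have z0: "z t1 = (0, 0)" using zt1 zero by simp
    have "z t = (0, 0)" for t
    proof -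
      have "(0, 0) = z t"
      proof (rule ode_unique_local[where f = fld and S = box and z = "\<lambda>_. (0, 0)" and a = "min t t1"
            and b = "max t t1" and ?t0.0 = t1 and L = L2 and w = z])
        show "((\<lambda>_. (0, 0)) has_vector_derivative fld (0, 0)) (at r within {min t t1..max t t1})" for r
          using zero by (simp add: fld_def zero_prod_def[symmetric])
        show "(0, 0) \<in> box" using R by (simp add: box_def)
      qed (use fld_lip open_box zd z0 in \<open>auto intro: has_vector_derivative_at_within\<close>)
      then show ?thesis by simp
    qed
    then show False using nonconst by simp
  qed
  obtain T w where T: "T 0 = 0" "strict_mono_on I T" "continuous_on I T"
    and w: "\<And>t. t \<in> I \<Longrightarrow> w (T t) = cv x (sg x * t)"
      "\<And>t. t \<in> I \<Longrightarrow> (w has_vector_derivative fld (w (T t))) (at (T t))"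
    using orbit[OF x0 xn] by blast
  let ?a = "T (- (2 * pi))" and ?b = "T (2 * pi)"
  have T0: "?a < 0" "0 < ?b"
    using strict_mono_onD[OF T(2)] I_facts T(1) pi_gt_zero by (metis neg_less_0_iff_less zero_less_mult_iff zero_less_numeral)+
  have par: "\<exists>\<psi>\<in>I. T \<psi> = t" if "t \<in> {?a..?b}" for t
  proof -
    have "- (2 * pi) \<le> 2 * pi" by simp
    from IVT_image[OF T(3) I_facts(6) this that] show ?thesis using I_facts(6) by blast
  qed
  have eq: "w t = z (t1 + t)" if t: "t \<in> {?a..?b}" for t
  proof (rule ode_unique_local[where f = fld and S = box and z = w and a = ?a
        and b = ?b and ?t0.0 = 0 and L = L2 and w = "\<lambda>t. z (t1 + t)"])
    fix t assume t: "t \<in> {?a..?b}"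
    obtain \<psi> where \<psi>: "\<psi> \<in> I" "T \<psi> = t" using par[OF t] by blast
    show "(w has_vector_derivative fld (w t)) (at t within {?a..?b})"
      using w(2)[OF \<psi>(1)] \<psi>(2) by (auto intro: has_vector_derivative_at_within)
    have "sg x * \<psi> \<in> J" using sg_I[OF \<psi>(1)] I_facts(7) by blast
    then show "w t \<in> box" using w(1)[OF \<psi>(1)] cv_box[OF x0] \<psi>(2) by metis
    have "((\<lambda>t. t1 + t) has_vector_derivative 1) (at t)" by (auto intro!: derivative_eq_intros)
    from vector_diff_chain_at[OF this zd]
    show "((\<lambda>t. z (t1 + t)) has_vector_derivative fld (z (t1 + t))) (at t within {?a..?b})"
      by (simp add: o_def has_vector_derivative_at_within)
  next
    show "w 0 = z (t1 + 0)"
      using w(1)[OF I_facts(1)] T(1) cv_0[OF x0] zt1 by simp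
  qed (use fld_lip open_box T0 t in auto)
  have pt: "fst (z (t1 + T \<psi>)) = rr (sg x * \<psi>) x * cos (sg x * \<psi>)" if "\<psi> \<in> {- (2 * pi)..2 * pi}" for \<psi>
  proof -
    have \<psi>: "\<psi> \<in> I" using that I_facts(6) by blast
    have "T \<psi> \<in> {?a..?b}"
      using that strict_mono_on_leD[OF T(2)] I_facts(2,3) \<psi> by auto
    then show ?thesis using eq w(1)[OF \<psi>] by (simp add: cv_def flip: eq)
  qed
  have full: "\<exists>t. fst (z t) = rr c x" if c: "c = 2 * pi \<or> c = - (2 * pi)" for c
  proof -
    have e: "sg x * (sg x * c) = c" "sg x * c \<in> {- (2 * pi)..2 * pi}" "cos c = 1"
      using c sg_cases[of x] by auto
    have "fst (z (t1 + T (sg x * c))) = rr c x"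
      using pt[OF e(2)] unfolding e(1,3) by simp
    then show ?thesis by blast
  qed
  show "\<exists>t. fst (z t) = rr (2 * pi) x" "\<exists>t. fst (z t) = rr (- (2 * pi)) x"
    by (rule full, simp)+
  have "fst (z (t1 + T pi)) = - rr (sg x * pi) x"
    using pt[of pi] sg_cases[of x] by auto
  then have "fst (z (t1 + T pi)) * x < 0" using x_rr_pos[OF xn, of "sg x * pi"] by (simp add: mult.commute)
  then show "\<exists>t. fst (z t) * x < 0" by blast
qed

text \<open>At a maximal abscissa both the image and the preimage of \<open>x\<close> are at most
  \<open>x\<close>; applying the increasing map \<open>rr (2 * pi)\<close> to the second inequality
  gives \<open>x \<le> rr (2 * pi) x\<close>. A minimum is symmetric. So an extreme point of a
  periodic orbit is fixed, whatever number of turns its period was assumed to contain.\<close>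

lemma rr_fixed:
  assumes x: "\<bar>x\<bar> < \<rho>1"
    and "rr (2 * pi) x \<le> x \<and> rr (- (2 * pi)) x \<le> x \<or> x \<le> rr (2 * pi) x \<and> x \<le> rr (- (2 * pi)) x"
  shows "rr (2 * pi) x = x"
proof -
  have sh: "rr (2 * pi) (rr (- (2 * pi)) x) = x"
    using rr_shift[OF x, of "- (2 * pi)"] by simp
  have b: "\<bar>x\<bar> < \<rho>0" "\<bar>rr (- (2 * pi)) x\<bar> < \<rho>0"
    using x \<rho>_pos rr_lt_\<rho>0[OF x] pi_J by auto
  have "rr (2 * pi) (rr (- (2 * pi)) x) \<le> rr (2 * pi) x" if "rr (- (2 * pi)) x \<le> x"
    using that rr_mono[OF b(2,1) _ pi_J(1)] by (cases "rr (- (2 * pi)) x = x") auto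
  moreover have "rr (2 * pi) (rr (- (2 * pi)) x) \<ge> rr (2 * pi) x" if "rr (- (2 * pi)) x \<ge> x"
    using that rr_mono[OF b(1,2) _ pi_J(1)] by (cases "rr (- (2 * pi)) x = x") auto
  ultimately show ?thesis using assms(2) sh by auto
qed

text \<open>By the sign in \<open>qq_A\<close> the product
  \<open>x * (rr \<phi> x * cos \<phi>)\<close> decreases on \<open>[0, pi]\<close> and increases on
  \<open>[pi, 2 pi]\<close>, so the abscissa lies between \<open>x\<close> and
  \<open>- rr pi x\<close>. The factor \<open>x\<close> treats both signs at once.\<close>

lemma curve_bound:
  assumes x: "\<bar>x\<bar> < \<rho>0" "x \<noteq> 0" and fixp: "rr (2 * pi) x = x" and \<phi>: "\<phi> \<in> {0..2 * pi}"
  shows "\<bar>rr \<phi> x * cos \<phi>\<bar> \<le> max \<bar>x\<bar> \<bar>rr pi x\<bar>"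
proof -
  define g where "g = (\<lambda>\<phi>. x * (rr \<phi> x * cos \<phi>))"
  have inI: "t \<in> I" if "0 \<le> t" "t \<le> 2 * pi" for t using that pi_J(4) by simp
  have g': "(g has_real_derivative x * (qq t x * A t (rr t x))) (at t)" if "t \<in> I" for t
    unfolding g_def by (rule DERIV_cmult[OF curve_x_deriv[OF x that]])
  have sgn: "x * (qq t x * A t (rr t x)) * sin t \<le> 0" if "t \<in> I" for t
    using qq_A(3)[OF x _ refl, of t] that by auto
  have gc: "continuous_on {c..d} g" if "0 \<le> c" "d \<le> 2 * pi" for c d
    using g' inI that by (intro continuous_at_imp_continuous_on ballI DERIV_isCont) (auto intro!: g' inI)
  have g0: "g 0 = x\<^sup>2" "g (2 * pi) = x\<^sup>2" "g pi = - (x * rr pi x)"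
    using x fixp by (simp_all add: g_def power2_eq_square)
  have dec: "g d \<le> g c" if "0 \<le> c" "c \<le> d" "d \<le> pi" for c d
  proof (rule DERIV_nonpos_imp_decreasing_open[OF that(2)])
    fix t assume t: "c < t" "t < d"
    then have "0 < sin t" "t \<in> I" using that pi_J(4) by (auto intro!: sin_gt_zero inI)
    then have "x * (qq t x * A t (rr t x)) \<le> 0" using sgn[of t] by (simp add: mult_le_0_iff)
    then show "\<exists>y. (g has_real_derivative y) (at t) \<and> y \<le> 0" using g' \<open>t \<in> I\<close> by blast
  qed (use gc that pi_gt_zero in auto)
  have inc: "g c \<le> g d" if "pi \<le> c" "c \<le> d" "d \<le> 2 * pi" for c d
  proof (rule DERIV_nonneg_imp_increasing_open[OF that(2)])
    fix t assume t: "c < t" "t < d"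
    then have "sin t < 0" "t \<in> I" using that pi_J(4) pi_gt_zero by (auto intro!: sin_lt_zero inI)
    then have "x * (qq t x * A t (rr t x)) \<ge> 0" using sgn[of t] by (simp add: mult_le_0_iff)
    then show "\<exists>y. (g has_real_derivative y) (at t) \<and> y \<ge> 0" using g' \<open>t \<in> I\<close> by blast
  qed (use gc that pi_gt_zero in auto)
  have "g \<phi> \<le> x\<^sup>2 \<and> - (x * rr pi x) \<le> g \<phi>"
  proof (cases "\<phi> \<le> pi")
    case True
    then show ?thesis using dec[of 0 \<phi>] dec[of \<phi> pi] \<phi> g0 by auto
  next
    case False
    then show ?thesis using inc[of pi \<phi>] inc[of \<phi> "2 * pi"] \<phi> g0 by auto
  qed
  then have le: "x * (rr \<phi> x * cos \<phi>) \<le> x * x" "x * (- rr pi x) \<le> x * (rr \<phi> x * cos \<phi>)"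
    by (simp_all add: g_def power2_eq_square)
  show ?thesis
  proof (cases "0 < x")
    case True
    then have "rr \<phi> x * cos \<phi> \<le> x" "- rr pi x \<le> rr \<phi> x * cos \<phi>"
      using mult_le_cancel_left_pos[OF True] le by blast+
    then show ?thesis by linarith
  next
    case False
    then have n: "x < 0" using x by simp
    then have "x \<le> rr \<phi> x * cos \<phi>" "rr \<phi> x * cos \<phi> \<le> - rr pi x"
      using mult_le_cancel_left_neg[OF n] le by blast+
    then show ?thesis by linarith
  qed
qed

text \<open>A fixed point closes the curve \<open>cv\<close>, and \<open>periodic_extension\<close>
  repeats it. The result is not constant because the abscissas at angles 0 and \<open>pi\<close>
  have opposite signs.\<close>

lemma periodic_from_fixed:
  assumes x: "\<bar>x\<bar> < \<rho>0" "x \<noteq> 0" and fixp: "rr (2 * pi) x = x"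
    and U: "\<And>\<phi>. \<phi> \<in> {0..2 * pi} \<Longrightarrow> cv x \<phi> \<in> U"
  shows "\<exists>z. is_periodic_solution X Y \<Omega> \<delta> z \<and> range z \<subseteq> U"
proof -
  obtain T w where T: "T 0 = 0" "strict_mono_on I T" "continuous_on I T"
    and w: "\<And>t. t \<in> I \<Longrightarrow> w (T t) = cv x (sg x * t)"
      "\<And>t. t \<in> I \<Longrightarrow> (w has_vector_derivative fld (w (T t))) (at (T t))"
    using orbit[OF x] by blast
  \<comment> \<open>\<open>c\<close> and \<open>d\<close> bound the orbit parameters for which the
    angle \<open>sg x * t\<close> runs through \<open>[0, 2 pi]\<close>; for
    \<open>sg x = - 1\<close> they are \<open>- 2 pi\<close> and 0.\<close>
  define c where "c = min 0 (sg x * (2 * pi))"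
  define d where "d = max 0 (sg x * (2 * pi))"
  have cd_all: "c < d \<and> c \<in> I \<and> d \<in> I \<and> {c..d} \<subseteq> I \<and> sg x * pi \<in> {c..d} \<and>
      (\<forall>\<psi>\<in>{c..d}. sg x * \<psi> \<in> {0..2 * pi}) \<and>
      (sg x * c = 0 \<and> sg x * d = 2 * pi \<or> sg x * c = 2 * pi \<and> sg x * d = 0)"
  proof (rule disjE[OF sg_cases[of x]])
    assume s: "sg x = 1"
    then have e: "c = 0" "d = 2 * pi" by (simp_all add: c_def d_def)
    have "{0..2 * pi} \<subseteq> I" by (rule subset_trans[OF _ I_facts(6)]) simp
    then show ?thesis using I_facts(1,2) unfolding e s by simp
  next
    assume s: "sg x = - 1"
    then have e: "c = - (2 * pi)" "d = 0" by (simp_all add: c_def d_def)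
    have "{- (2 * pi)..0} \<subseteq> I" by (rule subset_trans[OF _ I_facts(6)]) simp
    then show ?thesis using I_facts(1,3) unfolding e s by simp
  qed
  then have cd: "c < d" "c \<in> I" "d \<in> I" "{c..d} \<subseteq> I" "sg x * pi \<in> {c..d}"
    and im: "\<And>\<psi>. \<psi> \<in> {c..d} \<Longrightarrow> sg x * \<psi> \<in> {0..2 * pi}"
    and ends: "sg x * c = 0 \<and> sg x * d = 2 * pi \<or> sg x * c = 2 * pi \<and> sg x * d = 0"
    by blast+
  have cv2: "cv x (2 * pi) = cv x 0" using x by (simp add: cv_def yr_def fixp)
  have weq: "w (T c) = w (T d)" using w(1) cd ends cv2 by auto
  have TT: "T c < T d" using strict_mono_onD[OF T(2) cd(2,3,1)] .
  have par: "\<exists>\<psi>\<in>{c..d}. T \<psi> = t" if "t \<in> {T c..T d}" for t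
    using IVT_image[OF T(3) cd(4) less_imp_le[OF cd(1)] that] by blast
  have wp: "w t \<in> box \<inter> U" and wd: "(w has_vector_derivative fld (w t)) (at t within {T c..T d})"
    if t: "t \<in> {T c..T d}" for t
  proof -
    obtain \<psi> where \<psi>: "\<psi> \<in> {c..d}" "T \<psi> = t" using par[OF t] by blast
    have \<psi>I: "\<psi> \<in> I" using \<psi> cd(4) by blast
    have sJ: "sg x * \<psi> \<in> J" using sg_I[OF \<psi>I] I_facts(7) by blast
    have "w t = cv x (sg x * \<psi>)" using w(1)[OF \<psi>I] \<psi>(2) by simp
    then show "w t \<in> box \<inter> U" using cv_box[OF x(1) sJ] U[OF im[OF \<psi>(1)]] by simp
    show "(w has_vector_derivative fld (w t)) (at t within {T c..T d})"
      using w(2)[OF \<psi>I] \<psi>(2) by (auto intro: has_vector_derivative_at_within)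
  qed
  obtain z where z: "\<And>t. (z has_vector_derivative fld (z t)) (at t)"
    "\<And>t. z (t + (T d - T c)) = z t" "range z = w ` {T c..T d}"
    using periodic_extension[OF TT weq wd] by blast
  have zb: "z t \<in> box \<inter> U" for t
    using z(3) wp by (metis imageE rangeI)
  have nonconst: "\<exists>t. z t \<noteq> z 0"
  proof (rule ccontr)
    assume "\<not> ?thesis"
    then have "z t = z 0" for t by blast
    then have const: "p = p'" if "p \<in> range z" "p' \<in> range z" for p p' using that by (metis imageE)
    have "sg x * pi \<in> I" using cd by blast
    have "T (sg x * pi) \<in> {T c..T d}"
      using strict_mono_on_leD[OF T(2)] cd \<open>sg x * pi \<in> I\<close> by auto
    moreover have "T c \<in> {T c..T d}" using TT by simp
    ultimately have "w (T (sg x * pi)) \<in> range z" "w (T c) \<in> range z" unfolding z(3) by (blast intro: imageI)+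
    then have "w (T (sg x * pi)) = w (T c)" by (rule const)
    then have "cv x (sg x * (sg x * pi)) = cv x (sg x * c)" using w(1) cd \<open>sg x * pi \<in> I\<close> by simp
    moreover have "sg x * (sg x * pi) = pi" using sg_cases[of x] by auto
    moreover have "cv x (sg x * c) = cv x 0" using ends cv2 by auto
    ultimately have "- rr pi x = x" using x by (simp add: cv_def)
    then show False using x_rr_pos[OF x(2), of pi] by (metis mult_minus_right not_square_less_zero neg_0_less_iff_less minus_minus)
  qed
  have "is_solution X Y \<Omega> \<delta> z UNIV"
    unfolding is_solution_fld using z(1) zb box_dom by auto
  then have "is_periodic_solution X Y \<Omega> \<delta> z"
    unfolding is_periodic_solution_def using z(2) TT nonconst by (metis diff_gt_0_iff_gt)
  then show ?thesis using zb by (intro exI[of _ z]) auto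
qed

text \<open>The box has the same half-width \<eta> as the range of the fixed points, because these
  are the extreme abscissas of the orbit. The height is generous instead: \<open>F\<close> and
  \<open>r^n sin \<phi>\<close> each take at most half of \<kappa>, so a closed curve with abscissas
  below \<eta> cannot leave through top or bottom.\<close>

lemma periodic_iff:
  assumes \<eta>: "0 < \<eta>" "\<eta> \<le> \<rho>1" and \<kappa>: "\<kappa> \<le> s"
    and F\<eta>: "\<And>x. \<bar>x\<bar> < \<eta> \<Longrightarrow> \<bar>F x \<delta>\<bar> < \<kappa> / 2" and \<eta>\<kappa>: "\<eta> * exp (M * 7) \<le> \<kappa> / 2"
  defines "U \<equiv> {-\<eta><..<\<eta>} \<times> {-\<kappa><..<\<kappa>}"
  shows "(\<exists>z. is_periodic_solution X Y \<Omega> \<delta> z \<and> range z \<subseteq> U) \<longleftrightarrow>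
    (\<exists>x1 x2. 0 < x1 \<and> x1 < \<eta> \<and> - \<eta> < x2 \<and> x2 < 0 \<and> rr (2 * pi) x1 - x1 = 0 \<and> rr (2 * pi) x2 - x2 = 0)"
    (is "?lhs \<longleftrightarrow> ?rhs")
proof
  assume ?lhs
  then obtain z where z: "is_periodic_solution X Y \<Omega> \<delta> z" "range z \<subseteq> U" by blast
  then have zU: "z t \<in> U" for t by blast
  have sol: "is_solution X Y \<Omega> \<delta> z UNIV" and nonconst: "\<exists>t. z t \<noteq> z 0"
    using z(1) by (simp_all add: is_periodic_solution_def)
  obtain T0 where T0: "T0 > 0" "\<And>t. z (t + T0) = z t"
    using z(1) unfolding is_periodic_solution_def by blast
  have zd: "(z has_vector_derivative fld (z t)) (at t)" for t
    using sol by (simp add: is_solution_fld)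
  have fd: "((\<lambda>t. fst (z t)) has_real_derivative fst (fld (z t))) (at t)" for t
    using bounded_linear.has_vector_derivative[OF bounded_linear_fst zd]
    by (simp add: has_real_derivative_iff_has_vector_derivative)
  have ran: "\<exists>t'\<in>{0..T0}. z t = z t'" for t
    using periodic_range[of z T0, OF T0(2) T0(1)] by (metis imageE rangeI)
  have cont: "continuous_on {0..T0} (\<lambda>t. fst (z t))"
    using fd by (meson DERIV_isCont continuous_at_imp_continuous_on)
  note cp = critical_point[OF sol nonconst zU[unfolded U_def] \<eta>(2) \<kappa>]
  have ne: "{0..T0} \<noteq> {}" using T0 by simp
  obtain t1 where t1: "\<And>t. fst (z t) \<le> fst (z t1)"
    using continuous_attains_sup[OF compact_Icc ne cont] ran by metis
  obtain t2 where t2: "\<And>t. fst (z t2) \<le> fst (z t)"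
    using continuous_attains_inf[OF compact_Icc ne cont] ran by metis
  \<comment> \<open>The extrema of the abscissa over one period are global, so any radius, here 1,
    serves in the local criterion.\<close>
  have c1: "fst (fld (z t1)) = 0"
    by (rule DERIV_local_max[OF fd zero_less_one]) (use t1 in auto)
  have c2: "fst (fld (z t2)) = 0"
    by (rule DERIV_local_min[OF fd zero_less_one]) (use t2 in auto)
  have b: "\<bar>fst (z t)\<bar> < \<eta>" for t using zU[of t] by (auto simp: U_def mem_Times_iff)
  have p1: "0 < fst (z t1)"
  proof -
    obtain t where "fst (z t) * fst (z t1) < 0" using cp(4)[OF c1] by blast
    then show ?thesis using t1[of t] by (auto simp: mult_less_0_iff)
  qed
  have p2: "fst (z t2) < 0"
  proof -
    obtain t where "fst (z t) * fst (z t2) < 0" using cp(4)[OF c2] by blast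
    then show ?thesis using t2[of t] by (auto simp: mult_less_0_iff)
  qed
  have f1: "rr (2 * pi) (fst (z t1)) = fst (z t1)"
    by (rule rr_fixed) (use b[of t1] \<eta> cp(2,3)[OF c1] t1 in \<open>auto, metis+\<close>)
  have f2: "rr (2 * pi) (fst (z t2)) = fst (z t2)"
    by (rule rr_fixed) (use b[of t2] \<eta> cp(2,3)[OF c2] t2 in \<open>auto, metis+\<close>)
  show ?rhs
    using p1 p2 f1 f2 b[of t1] b[of t2]
    by (intro exI[of _ "fst (z t1)"] exI[of _ "fst (z t2)"]) auto
next
  assume ?rhs
  then obtain x1 x2 where x1: "0 < x1" "x1 < \<eta>" "rr (2 * pi) x1 = x1"
    and x2: "- \<eta> < x2" "x2 < 0" "rr (2 * pi) x2 = x2" by auto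
  have b: "\<bar>x1\<bar> < \<rho>1" "\<bar>x2\<bar> < \<rho>0" using x1 x2 \<eta> \<rho>_pos by auto
  \<comment> \<open>One closed curve with both ends below \<eta> in modulus is enough. If the curve
    of \<open>x1\<close> extends too far to the left, then \<open>- rr pi x1 < x2\<close>;
    monotonicity of the half turn and \<open>rr_half_turn\<close> give
    \<open>- x1 < rr pi x2 < 0\<close>, so the curve of \<open>x2\<close> fits.\<close>
  have "\<exists>x. x \<noteq> 0 \<and> \<bar>x\<bar> < \<eta> \<and> rr (2 * pi) x = x \<and> \<bar>rr pi x\<bar> < \<eta>"
  proof (cases "rr pi x1 < \<eta>")
    case True
    then show ?thesis using x1 by (intro exI[of _ x1]) (auto simp: abs_less_iff intro: order_less_trans[of _ 0])
  next
    case False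
    then have "- rr pi x1 < x2" using x2 by linarith
    moreover have "\<bar>- rr pi x1\<bar> < \<rho>0" using rr_lt_\<rho>0[OF b(1) pi_J(3)] by simp
    ultimately have "rr pi (- rr pi x1) < rr pi x2" using rr_mono[OF _ b(2) _ pi_J(3)] by blast
    then have "- x1 < rr pi x2" using rr_half_turn[OF b(1) x1(3)] by simp
    moreover have "rr pi x2 < 0" using x2 by simp
    ultimately have "\<bar>rr pi x2\<bar> < \<eta>" using x1 by linarith
    then show ?thesis using x2 by (intro exI[of _ x2]) auto
  qed
  then obtain x where x: "x \<noteq> 0" "\<bar>x\<bar> < \<eta>" "rr (2 * pi) x = x" "\<bar>rr pi x\<bar> < \<eta>" by blast
  have x0: "\<bar>x\<bar> < \<rho>0" using x(2) \<eta> \<rho>_pos by linarith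
  have "cv x \<phi> \<in> U" if \<phi>: "\<phi> \<in> {0..2 * pi}" for \<phi>
  proof -
    have \<phi>J: "\<phi> \<in> J" using \<phi> pi_J(4) by auto
    have X: "\<bar>rr \<phi> x * cos \<phi>\<bar> < \<eta>"
      using curve_bound[OF x0 x(1,3) \<phi>] x by linarith
    have r1: "\<bar>rr \<phi> x\<bar> \<le> 1" using rr_lt_R[OF x0 \<phi>J] R by linarith
    have "\<bar>rr \<phi> x ^ n * sin \<phi>\<bar> \<le> \<bar>rr \<phi> x\<bar> ^ n"
      by (simp add: abs_mult power_abs mult_left_le)
    also have "\<dots> \<le> \<bar>rr \<phi> x\<bar> ^ 1"
      using r1 n2 by (intro power_decreasing) auto
    also have "\<dots> \<le> \<bar>x\<bar> * exp (M * 7)" using rr_le[OF x0 \<phi>J] by simp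
    also have "\<dots> \<le> \<eta> * exp (M * 7)" using x(2) by simp
    finally have "\<bar>rr \<phi> x ^ n * sin \<phi>\<bar> \<le> \<kappa> / 2" using \<eta>\<kappa> by linarith
    then have "\<bar>yr \<phi> (rr \<phi> x)\<bar> < \<kappa>"
      using F\<eta>[OF X] by (simp add: yr_def)
    then show ?thesis using X by (auto simp: cv_def U_def)
  qed
  then show ?lhs by (intro periodic_from_fixed[OF x0 x(1,3)])
qed

end

text \<open>For \<open>x > 0\<close> the definition gives \<open>p x = q x\<close> in both parities,
  so the two functions agree to the right of 0. Their difference is a power series without constant
  term, and a nonzero coefficient would make 0 an isolated zero.\<close>

lemma analytic_return_eventually_unique:
  assumes q: "analytic_return n p \<rho> \<epsilon> q" and q': "analytic_return n p \<rho>' \<epsilon>' q'"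
  shows "\<forall>\<^sub>F x in nhds 0. q x = q' x"
proof -
  define e where "e = min \<epsilon> \<epsilon>'"
  have e: "0 < e" "e \<le> \<epsilon>" "e \<le> \<epsilon>'" "\<epsilon> \<le> \<rho>" "\<epsilon>' \<le> \<rho>'"
    using q q' by (auto simp: e_def analytic_return_def)
  have "p x = q x" if "analytic_return n p \<rho> \<epsilon> q" "0 < x" "x < \<epsilon>" for \<rho> \<epsilon> q x
    using that unfolding analytic_return_def by (cases "odd n") auto
  then have pq: "q x = q' x" if "0 < x" "x < e" for x
    using that e q q' by (metis less_le_trans)
  obtain v where v: "\<forall>x\<in>{-\<rho><..<\<rho>}. (\<lambda>j. v (Suc j) * x ^ Suc j) sums (q x - x)"
    using q unfolding analytic_return_def by blast
  obtain v' where v': "\<forall>x\<in>{-\<rho>'<..<\<rho>'}. (\<lambda>j. v' (Suc j) * x ^ Suc j) sums (q' x - x)"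
    using q' unfolding analytic_return_def by blast
  \<comment> \<open>The series in \<open>analytic_return\<close> start at exponent 1, so the
    constant coefficient of the difference is 0.\<close>
  define c where "c = (\<lambda>j. if j = 0 then 0 else v j - v' j :: real)"
  have c: "(\<lambda>j. c j * (x - 0) ^ j) sums (q x - q' x)" if x: "norm (x - 0) < e" for x
  proof -
    have "(\<lambda>j. v (Suc j) * x ^ Suc j - v' (Suc j) * x ^ Suc j) sums ((q x - x) - (q' x - x))"
      by (rule sums_diff[OF v[rule_format] v'[rule_format]]) (use x e in auto)
    then have "(\<lambda>j. c (Suc j) * x ^ Suc j) sums (q x - q' x)"
      by (simp add: c_def algebra_simps)
    then show ?thesis using sums_Suc_iff[of "\<lambda>j. c j * x ^ j" "q x - q' x"] by (simp add: c_def)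
  qed
  show ?thesis
  proof (cases "\<exists>m>0. c m \<noteq> 0")
    case True
    then obtain m where m: "c m \<noteq> 0" "m > 0" by blast
    have "q 0 - q' 0 = 0" using sums_unique2[OF c[of 0], of 0] e(1) by (simp add: c_def powser_sums_zero_iff)
    then obtain s where s: "0 < s" "\<And>z. z \<in> cball 0 s - {0} \<Longrightarrow> q z - q' z \<noteq> 0"
      using powser_0_nonzero[OF e(1) c _ m] by blast
    define x where "x = min s (e / 2)"
    have "0 < x" "x < e" "x \<le> s" using s e by (auto simp: x_def)
    then show ?thesis using s(2)[of x] pq[of x] by auto
  next
    case False
    moreover have "c 0 = 0" by (simp add: c_def)
    ultimately have "c j = 0" for j by (cases "j = 0") blast+
    then have "q x = q' x" if "norm (x - 0) < e" for x
      using sums_unique2[OF c[OF that], of 0] by simp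
    then show ?thesis
      using eventually_nhds_in_open[of "ball 0 e" "0::real"] e(1)
      by (auto elim!: eventually_mono simp: dist_norm)
  qed
qed

section \<open>The return map\<close>

lemma deriv_zero_of_quadratic_bound:
  fixes g :: "real \<Rightarrow> real"
  assumes "0 < r" "\<And>y. \<bar>y\<bar> < r \<Longrightarrow> \<bar>g y\<bar> \<le> C * y\<^sup>2"
  shows "deriv g 0 = 0"
proof (rule DERIV_imp_deriv)
  have g0: "g 0 = 0" using assms(2)[of 0] assms(1) by simp
  have "((\<lambda>y. (g y - g 0) / (y - 0)) \<longlongrightarrow> 0) (at 0)"
  proof (rule Lim_null_comparison)
    have "\<forall>\<^sub>F y in at 0. \<bar>y\<bar> < r \<and> y \<noteq> 0"
      unfolding eventually_at using assms(1) by (intro exI[of _ r]) auto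
    then show "\<forall>\<^sub>F y in at 0. norm ((g y - g 0) / (y - 0)) \<le> C * \<bar>y\<bar>"
    proof eventually_elim
      case (elim y)
      then have "\<bar>g y\<bar> \<le> (C * \<bar>y\<bar>) * \<bar>y\<bar>"
        using assms(2)[of y] by (simp add: power2_eq_square mult.assoc abs_mult_self_eq)
      then show ?case using elim by (simp add: g0 divide_le_eq)
    qed
    show "((\<lambda>y. C * \<bar>y\<bar>) \<longlongrightarrow> 0) (at 0)"
      by (auto intro!: tendsto_eq_intros)
  qed
  then show "(g has_real_derivative 0) (at 0)"
    by (simp add: has_field_derivative_iff)
qed

lemma power_series_quotient_tendsto:
  fixes c :: "nat \<Rightarrow> real"
  assumes "\<forall>\<^sub>F x in nhds 0. (\<lambda>k. c (m + k) * x ^ (m + k)) sums f x"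
  shows "((\<lambda>x. f x / x ^ m) \<longlongrightarrow> c m) (at 0)" "0 < m \<Longrightarrow> f 0 = 0"
proof -
  obtain e where e: "0 < e" "\<And>x. \<bar>x\<bar> < e \<Longrightarrow> (\<lambda>k. c (m + k) * x ^ (m + k)) sums f x"
    using assms unfolding eventually_nhds_metric by (auto simp: dist_real_def)
  have "((\<lambda>x. f x / x ^ m) \<longlongrightarrow> (\<lambda>k. c (m + k)) 0) (at 0)"
  proof (rule powser_limit_0_strong[OF e(1)])
    fix x :: real assume x: "x \<noteq> 0" "norm x < e"
    have "(\<lambda>k. c (m + k) * x ^ (m + k) / x ^ m) sums (f x / x ^ m)"
      using e(2)[of x] x by (intro sums_divide) auto
    then show "(\<lambda>k. c (m + k) * x ^ k) sums (f x / x ^ m)"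
      using x by (simp add: power_add)
  qed
  then show "((\<lambda>x. f x / x ^ m) \<longlongrightarrow> c m) (at 0)" by simp
  show "f 0 = 0" if "0 < m"
  proof -
    have "(\<lambda>k. 0) sums f 0" using e(2)[of 0] e(1) that by (simp add: power_0_left)
    then show ?thesis using sums_unique2[OF _ sums_zero] by blast
  qed
qed

text \<open>One variable is changed at a time, with the other as a parameter in a closed disc;
  \<open>q < \<rho>\<close> keeps that compact disc inside the domain of the extensions.\<close>

lemma (in complex_system) real_Lipschitz:
  assumes "q < \<rho>"
  shows "\<exists>L2. \<forall>\<delta>\<in>D. \<forall>x y x' y'. \<bar>x\<bar> < q \<longrightarrow> \<bar>y\<bar> < q \<longrightarrow> \<bar>x'\<bar> < q \<longrightarrow> \<bar>y'\<bar> < q \<longrightarrow>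
     norm ((y + X x y \<delta>, Y x y \<delta>) - (y' + X x' y' \<delta>, Y x' y' \<delta>)) \<le> L2 * norm ((x, y) - (x', y'))"
proof -
  have one: "\<exists>K>0. \<forall>\<delta>\<in>D. \<forall>x y x' y'. \<bar>x\<bar> < q \<longrightarrow> \<bar>y\<bar> < q \<longrightarrow> \<bar>x'\<bar> < q \<longrightarrow> \<bar>y'\<bar> < q \<longrightarrow>
      \<bar>Z x y \<delta> - Z x' y' \<delta>\<bar> \<le> K * norm ((x, y) - (x', y'))"
    if b: "\<And>\<delta>. \<delta> \<in> D \<Longrightarrow> bihol \<rho> (\<lambda>x y. ZC x y \<delta>)"
      and c: "continuous_on (ball 0 \<rho> \<times> ball 0 \<rho> \<times> D) (\<lambda>(x, y, \<delta>). ZC x y \<delta>)"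
      and r: "\<And>\<delta> x y. \<delta> \<in> D \<Longrightarrow> \<bar>x\<bar> < \<rho> \<Longrightarrow> \<bar>y\<bar> < \<rho> \<Longrightarrow> ZC (of_real x) (of_real y) \<delta> = of_real (Z x y \<delta>)"
    for ZC and Z :: "real \<Rightarrow> real \<Rightarrow> real ^ 'm \<Rightarrow> real"
  proof -
    have cP: "compact (cball (0::complex) q \<times> D)" by (intro compact_Times compact_cball compact_D)
    have sub: "cball (0::complex) q \<times> D \<subseteq> ball 0 \<rho> \<times> D" using assms by auto
    obtain K1 where K1: "0 < K1" "\<And>p z w. p \<in> cball 0 q \<times> D \<Longrightarrow> norm z \<le> q \<Longrightarrow> norm w \<le> q \<Longrightarrow>
        norm ((\<lambda>(x, \<delta>) y. ZC x y \<delta>) p z - (\<lambda>(x, \<delta>) y. ZC x y \<delta>) p w) \<le> K1 * norm (z - w)"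
      using hol_family_Lipschitz[OF hol_family_subset[OF hol_family_of_bihol(1)[OF b c] sub order_refl] cP assms]
      by blast
    obtain K2 where K2: "0 < K2" "\<And>p z w. p \<in> cball 0 q \<times> D \<Longrightarrow> norm z \<le> q \<Longrightarrow> norm w \<le> q \<Longrightarrow>
        norm ((\<lambda>(y, \<delta>) x. ZC x y \<delta>) p z - (\<lambda>(y, \<delta>) x. ZC x y \<delta>) p w) \<le> K2 * norm (z - w)"
      using hol_family_Lipschitz[OF hol_family_subset[OF hol_family_of_bihol(2)[OF b c] sub order_refl] cP assms]
      by blast
    have "\<bar>Z x y \<delta> - Z x' y' \<delta>\<bar> \<le> (K1 + K2) * norm ((x, y) - (x', y'))"
      if \<delta>: "\<delta> \<in> D" and q: "\<bar>x\<bar> < q" "\<bar>y\<bar> < q" "\<bar>x'\<bar> < q" "\<bar>y'\<bar> < q" for \<delta> x y x' y'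
    proof -
      have "norm (complex_of_real (Z x y \<delta>) - of_real (Z x y' \<delta>)) \<le> K1 * norm (complex_of_real y - of_real y')"
        using K1(2)[of "(of_real x, \<delta>)" "of_real y" "of_real y'"] \<delta> q r[OF \<delta>] assms by simp
      then have 1: "\<bar>Z x y \<delta> - Z x y' \<delta>\<bar> \<le> K1 * \<bar>y - y'\<bar>" by (simp flip: of_real_diff)
      have "norm (complex_of_real (Z x y' \<delta>) - of_real (Z x' y' \<delta>)) \<le> K2 * norm (complex_of_real x - of_real x')"
        using K2(2)[of "(of_real y', \<delta>)" "of_real x" "of_real x'"] \<delta> q r[OF \<delta>] assms by simp
      then have 2: "\<bar>Z x y' \<delta> - Z x' y' \<delta>\<bar> \<le> K2 * \<bar>x - x'\<bar>" by (simp flip: of_real_diff)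
      have "\<bar>x - x'\<bar> \<le> norm ((x, y) - (x', y'))" "\<bar>y - y'\<bar> \<le> norm ((x, y) - (x', y'))"
        using norm_fst_le[of "x - x'" "y - y'"] norm_snd_le[of "y - y'" "x - x'"] by simp_all
      then have "K1 * \<bar>y - y'\<bar> \<le> K1 * norm ((x, y) - (x', y'))" "K2 * \<bar>x - x'\<bar> \<le> K2 * norm ((x, y) - (x', y'))"
        using K1(1) K2(1) by (simp_all add: mult_left_mono)
      then show ?thesis using 1 2 unfolding distrib_right by linarith
    qed
    then show ?thesis using K1(1) K2(1) by (intro exI[of _ "K1 + K2"]) auto
  qed
  obtain K where K: "0 < K" "\<forall>\<delta>\<in>D. \<forall>x y x' y'. \<bar>x\<bar> < q \<longrightarrow> \<bar>y\<bar> < q \<longrightarrow> \<bar>x'\<bar> < q \<longrightarrow> \<bar>y'\<bar> < q \<longrightarrow>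
      \<bar>X x y \<delta> - X x' y' \<delta>\<bar> \<le> K * norm ((x, y) - (x', y'))"
    using one[OF bX cX rX] by blast
  obtain K' where K': "0 < K'" "\<forall>\<delta>\<in>D. \<forall>x y x' y'. \<bar>x\<bar> < q \<longrightarrow> \<bar>y\<bar> < q \<longrightarrow> \<bar>x'\<bar> < q \<longrightarrow> \<bar>y'\<bar> < q \<longrightarrow>
      \<bar>Y x y \<delta> - Y x' y' \<delta>\<bar> \<le> K' * norm ((x, y) - (x', y'))"
    using one[OF bY cY rY] by blast
  have "norm ((y + X x y \<delta>, Y x y \<delta>) - (y' + X x' y' \<delta>, Y x' y' \<delta>)) \<le> (1 + K + K') * norm ((x, y) - (x', y'))"
    if \<delta>: "\<delta> \<in> D" and q: "\<bar>x\<bar> < q" "\<bar>y\<bar> < q" "\<bar>x'\<bar> < q" "\<bar>y'\<bar> < q" for \<delta> x y x' y'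
  proof -
    have "norm ((y + X x y \<delta>, Y x y \<delta>) - (y' + X x' y' \<delta>, Y x' y' \<delta>))
        = norm (y + X x y \<delta> - (y' + X x' y' \<delta>), Y x y \<delta> - Y x' y' \<delta>)" by simp
    also have "\<dots> \<le> \<bar>y + X x y \<delta> - (y' + X x' y' \<delta>)\<bar> + \<bar>Y x y \<delta> - Y x' y' \<delta>\<bar>"
      using norm_Pair_le[of "y + X x y \<delta> - (y' + X x' y' \<delta>)" "Y x y \<delta> - Y x' y' \<delta>"] by simp
    also have "\<dots> \<le> \<bar>y - y'\<bar> + \<bar>X x y \<delta> - X x' y' \<delta>\<bar> + \<bar>Y x y \<delta> - Y x' y' \<delta>\<bar>" by linarith
    also have "\<bar>y - y'\<bar> \<le> norm ((x, y) - (x', y'))" using norm_snd_le[of "y - y'" "x - x'"] by simp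
    also have "\<bar>X x y \<delta> - X x' y' \<delta>\<bar> \<le> K * norm ((x, y) - (x', y'))" using K(2) \<delta> q by blast
    also have "\<bar>Y x y \<delta> - Y x' y' \<delta>\<bar> \<le> K' * norm ((x, y) - (x', y'))" using K'(2) \<delta> q by blast
    finally show ?thesis by (simp add: algebra_simps)
  qed
  then show ?thesis by blast
qed

text \<open>The constants precede the quantifier over \<delta>, so the radii built from
  \<open>R1\<close> and \<open>M\<close> are common to all of \<open>D\<close>.\<close>

lemma (in complex_system) polar_flow_exists:
  assumes \<Omega>: "\<And>\<delta> x y. \<delta> \<in> D \<Longrightarrow> \<bar>x\<bar> < \<rho> \<Longrightarrow> \<bar>y\<bar> < \<rho> \<Longrightarrow> (x, y, \<delta>) \<in> \<Omega>"
  shows "\<exists>R1 M L L2 q W H u. 0 < R1 \<and> 0 \<le> M \<and> (\<forall>\<delta>\<in>D.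
     polar_flow X Y \<Omega> F \<delta> n R1 s q M L L2 (\<lambda>\<phi> r. yr \<phi> \<delta> r) (\<lambda>\<phi> r. Ar \<phi> \<delta> r) (\<lambda>\<phi> r. Vr \<phi> \<delta> r)
       (W \<delta>) (H \<delta>) (\<lambda>\<phi> x. u \<phi> \<delta> x) \<and>
     (\<exists>v. \<forall>x. \<bar>x\<bar> < R1 * exp (- (M * 7)) \<longrightarrow>
        (\<lambda>j. v (Suc j) * x ^ Suc j) sums (x * exp (u (2 * pi) \<delta> x) - x)) \<and>
     ((\<lambda>x. x * exp (u (2 * pi) \<delta> x)) has_real_derivative exp (u (2 * pi) \<delta> 0)) (at 0))"
proof -
  obtain R1 M L u where R1: "0 < R1" "R1 \<le> R / 2" "0 \<le> M" "0 \<le> L" and fl: "\<forall>\<delta>\<in>D.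
     (\<forall>\<phi>\<in>J. \<forall>r. \<bar>r\<bar> < R1 \<longrightarrow> 0 < Wr \<phi> \<delta> r) \<and>
     (\<forall>\<phi>\<in>J. \<forall>r r'. \<bar>r\<bar> < R1 \<longrightarrow> \<bar>r'\<bar> < R1 \<longrightarrow> \<bar>Hr \<phi> \<delta> r - Hr \<phi> \<delta> r'\<bar> \<le> L * \<bar>r - r'\<bar>) \<and>
     (\<forall>\<phi>\<in>J. \<forall>r. \<bar>r\<bar> < R1 \<longrightarrow> \<bar>Hr \<phi> \<delta> r\<bar> \<le> M) \<and>
     continuous_on (J \<times> {-R1<..<R1}) (\<lambda>(\<phi>, r). Wr \<phi> \<delta> r) \<and>
     (\<forall>x. \<bar>x\<bar> < R1 * exp (- (M * 7)) \<longrightarrow> u 0 \<delta> x = 0 \<and> (\<forall>\<phi>\<in>J. \<bar>u \<phi> \<delta> x\<bar> \<le> M * 7 \<and>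
        ((\<lambda>\<phi>. u \<phi> \<delta> x) has_real_derivative Hr \<phi> \<delta> (x * exp (u \<phi> \<delta> x))) (at \<phi> within J))) \<and>
     (\<exists>v. \<forall>x. \<bar>x\<bar> < R1 * exp (- (M * 7)) \<longrightarrow>
        (\<lambda>j. v (Suc j) * x ^ Suc j) sums (x * exp (u (2 * pi) \<delta> x) - x)) \<and>
     ((\<lambda>x. x * exp (u (2 * pi) \<delta> x)) has_real_derivative exp (u (2 * pi) \<delta> 0)) (at 0)"
    using flow_exists by blast
  \<comment> \<open>Strictly between \<open>s\<close> and \<open>\<rho>\<close>: points with
    \<open>\<bar>y\<bar> \<le> s\<close> are interior to the box of half-width \<open>q\<close>, and
    the field is Lipschitz on that box.\<close>
  define q where "q = (s + \<rho>) / 2"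
  have q: "s < q" "q < \<rho>" using R(4) by (auto simp: q_def)
  obtain L2 where L2: "\<forall>\<delta>\<in>D. \<forall>x y x' y'. \<bar>x\<bar> < q \<longrightarrow> \<bar>y\<bar> < q \<longrightarrow> \<bar>x'\<bar> < q \<longrightarrow> \<bar>y'\<bar> < q \<longrightarrow>
     norm ((y + X x y \<delta>, Y x y \<delta>) - (y' + X x' y' \<delta>, Y x' y' \<delta>)) \<le> L2 * norm ((x, y) - (x', y'))"
    using real_Lipschitz[OF q(2)] by blast
  have RR: "R1 < R" "R1 \<le> s" "R1 \<le> 1" using R1 R by linarith+
  have "polar_flow X Y \<Omega> F \<delta> n R1 s q M L L2 (\<lambda>\<phi> r. yr \<phi> \<delta> r) (\<lambda>\<phi> r. Ar \<phi> \<delta> r) (\<lambda>\<phi> r. Vr \<phi> \<delta> r)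
       (\<lambda>\<phi> r. Wr \<phi> \<delta> r) (\<lambda>\<phi> r. Hr \<phi> \<delta> r) (\<lambda>\<phi> x. u \<phi> \<delta> x)" if \<delta>: "\<delta> \<in> D" for \<delta>
  proof -
    have lt: "\<bar>x\<bar> < R" "\<bar>x\<bar> < \<rho>" "\<bar>x\<bar> \<le> s" if "\<bar>x\<bar> < R1" for x :: real using that RR R by linarith+
    have Fs: "\<bar>F x \<delta>\<bar> \<le> s" if "\<bar>x\<bar> < R1" for x
      using F_small[OF \<delta>, of "of_real x"] rF[OF \<delta> lt(1)[OF that]] lt(1)[OF that] s_pos by simp
    have Fe: "F x \<delta> + X x (F x \<delta>) \<delta> = 0" if x: "\<bar>x\<bar> < R1" for x
    proof -
      have f: "\<bar>F x \<delta>\<bar> < \<rho>" using Fs[OF x] R(4) by linarith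
      have "complex_of_real (F x \<delta> + X x (F x \<delta>) \<delta>) = 0"
        using F_eq[OF \<delta>, of "of_real x"] rF[OF \<delta> lt(1)[OF x]] rX[OF \<delta> lt(2)[OF x] f] lt(1)[OF x] by simp
      then show ?thesis by (simp only: of_real_eq_0_iff)
    qed
    have X0: "X 0 0 \<delta> = 0" using Fe[of 0] F0[OF \<delta>] R1(1) by simp
    have ct: "\<bar>X x y \<delta> - X x y' \<delta>\<bar> \<le> 1/2 * \<bar>y - y'\<bar>" if x: "\<bar>x\<bar> < R1" and y: "\<bar>y\<bar> \<le> s" "\<bar>y'\<bar> \<le> s" for x y y'
    proof -
      have y\<rho>: "\<bar>y\<bar> < \<rho>" "\<bar>y'\<bar> < \<rho>" using y R(4) by linarith+
      have "norm (complex_of_real (X x y \<delta>) - of_real (X x y' \<delta>)) \<le> 1/2 * norm (complex_of_real y - of_real y')"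
        using contr[OF \<delta>, of "of_real x" "of_real y" "of_real y'"] lt[OF x] y
          rX[OF \<delta> lt(2)[OF x] y\<rho>(1)] rX[OF \<delta> lt(2)[OF x] y\<rho>(2)] by simp
      then show ?thesis by (simp flip: of_real_diff)
    qed
    have fW: "\<forall>\<phi>\<in>J. \<forall>r. \<bar>r\<bar> < R1 \<longrightarrow> 0 < Wr \<phi> \<delta> r"
      and fH: "\<forall>\<phi>\<in>J. \<forall>r r'. \<bar>r\<bar> < R1 \<longrightarrow> \<bar>r'\<bar> < R1 \<longrightarrow> \<bar>Hr \<phi> \<delta> r - Hr \<phi> \<delta> r'\<bar> \<le> L * \<bar>r - r'\<bar>"
      and fM: "\<forall>\<phi>\<in>J. \<forall>r. \<bar>r\<bar> < R1 \<longrightarrow> \<bar>Hr \<phi> \<delta> r\<bar> \<le> M"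
      and fc: "continuous_on (J \<times> {-R1<..<R1}) (\<lambda>(\<phi>, r). Wr \<phi> \<delta> r)"
      and fu: "\<forall>x. \<bar>x\<bar> < R1 * exp (- (M * 7)) \<longrightarrow> u 0 \<delta> x = 0 \<and> (\<forall>\<phi>\<in>J. \<bar>u \<phi> \<delta> x\<bar> \<le> M * 7 \<and>
        ((\<lambda>\<phi>. u \<phi> \<delta> x) has_real_derivative Hr \<phi> \<delta> (x * exp (u \<phi> \<delta> x))) (at \<phi> within J))"
      using fl[rule_format, OF \<delta>] by blast+
    show ?thesis
    proof unfold_locales
      show "n \<ge> 2" "0 < R1" "R1 \<le> s" "R1 \<le> 1" "s < q" "0 \<le> M" "0 \<le> L"
        by (fact n2 R1 RR q)+
      show "X 0 0 \<delta> = 0" "Y 0 0 \<delta> = 0" "F 0 \<delta> = 0" by (fact X0 Y0[OF \<delta>] F0[OF \<delta>])+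
      show "(x, y, \<delta>) \<in> \<Omega>" if "\<bar>x\<bar> < q" "\<bar>y\<bar> < q" for x y
        using that q by (intro \<Omega> \<delta>) auto
      show "norm ((y + X x y \<delta>, Y x y \<delta>) - (y' + X x' y' \<delta>, Y x' y' \<delta>)) \<le> L2 * norm ((x, y) - (x', y'))"
        if "\<bar>x\<bar> < q" "\<bar>y\<bar> < q" "\<bar>x'\<bar> < q" "\<bar>y'\<bar> < q" for x y x' y'
        using L2 \<delta> that by blast
      show "((\<lambda>x. F x \<delta>) has_real_derivative deriv (\<lambda>x. F x \<delta>) x) (at x)" if "\<bar>x\<bar> < R1" for x
        using F_real_deriv(1)[OF \<delta> lt(1)[OF that]] .
      show "F x \<delta> + X x (F x \<delta>) \<delta> = 0" "\<bar>F x \<delta>\<bar> \<le> s" if "\<bar>x\<bar> < R1" for x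
        using Fe[OF that] Fs[OF that] by auto
      show "\<bar>X x y \<delta> - X x y' \<delta>\<bar> \<le> 1/2 * \<bar>y - y'\<bar>" if "\<bar>x\<bar> < R1" "\<bar>y\<bar> \<le> s" "\<bar>y'\<bar> \<le> s" for x y y'
        using ct[OF that] .
      show "yr \<phi> \<delta> r = F (r * cos \<phi>) \<delta> - r ^ n * sin \<phi>" for \<phi> r by (rule yr_def)
      show "Ar \<phi> \<delta> r = yr \<phi> \<delta> r + X (r * cos \<phi>) (yr \<phi> \<delta> r) \<delta>" for \<phi> r by (rule Ar_def)
      show "Vr \<phi> \<delta> r = Y (r * cos \<phi>) (yr \<phi> \<delta> r) \<delta> - deriv (\<lambda>x. F x \<delta>) (r * cos \<phi>) * Ar \<phi> \<delta> r" for \<phi> r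
        by (rule Vr_def)
      show "\<bar>yr \<phi> \<delta> r\<bar> \<le> s" if "\<bar>r\<bar> < R1" for \<phi> r
        using Ac_real(4)[OF \<delta> lt(1)[OF that]] .
      show "Wr \<phi> \<delta> r = - (n * sin \<phi> * (Ar \<phi> \<delta> r / r ^ n) + cos \<phi> * (Vr \<phi> \<delta> r / r ^ (2 * n - 1)))"
        if "\<bar>r\<bar> < R1" "r \<noteq> 0" for \<phi> r
        using Wr_eq[OF \<delta> lt(1)[OF that(1)] that(2)] .
      show "Hr \<phi> \<delta> r = (cos \<phi> * (Ar \<phi> \<delta> r / r ^ n) - sin \<phi> * (Vr \<phi> \<delta> r / r ^ (2 * n - 1))) / Wr \<phi> \<delta> r"
        if "\<bar>r\<bar> < R1" "r \<noteq> 0" for \<phi> r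
        using Hr_eq[OF \<delta> lt(1)[OF that(1)] that(2)] .
      show "0 < Wr \<phi> \<delta> r" if "\<phi> \<in> J" "\<bar>r\<bar> < R1" for \<phi> r using fW that by blast
      show "continuous_on (J \<times> {-R1<..<R1}) (\<lambda>(\<phi>, r). Wr \<phi> \<delta> r)" by (rule fc)
      show "\<bar>Hr \<phi> \<delta> r - Hr \<phi> \<delta> r'\<bar> \<le> L * \<bar>r - r'\<bar>" if "\<phi> \<in> J" "\<bar>r\<bar> < R1" "\<bar>r'\<bar> < R1" for \<phi> r r'
        using fH that by blast
      show "\<bar>Hr \<phi> \<delta> r\<bar> \<le> M" if "\<phi> \<in> J" "\<bar>r\<bar> < R1" for \<phi> r using fM that by blast
      show "u 0 \<delta> x = 0" if "\<bar>x\<bar> < R1 * exp (- (M * 7))" for x using fu that by blast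
      show "\<bar>u \<phi> \<delta> x\<bar> \<le> M * 7" "((\<lambda>\<phi>. u \<phi> \<delta> x) has_real_derivative Hr \<phi> \<delta> (x * exp (u \<phi> \<delta> x))) (at \<phi> within J)"
        if "\<bar>x\<bar> < R1 * exp (- (M * 7))" "\<phi> \<in> J" for x \<phi> using fu that by blast+
    qed
  qed
  then show ?thesis
    using R1 fl
    by (rule_tac exI[of _ R1], rule_tac exI[of _ M], rule_tac exI[of _ L], rule_tac exI[of _ L2],
        rule_tac exI[of _ q], rule_tac exI[of _ "\<lambda>\<delta> \<phi> r. Wr \<phi> \<delta> r"], rule_tac exI[of _ "\<lambda>\<delta> \<phi> r. Hr \<phi> \<delta> r"],
        rule_tac exI[of _ u]) simp
qed

text \<open>Unique existence of the first return is asserted explicitly because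
  \<open>return_map\<close> is a definite description. \<open>Pbar\<close> is unique as a germ at 0.
  Closeness to the origin is rendered by arbitrarily small neighbourhoods \<open>U\<close>, each
  with a radius \<eta> for the zeros, both common to all \<delta>.\<close>

theorem theorem1p4:
  fixes X Y :: "real \<Rightarrow> real \<Rightarrow> real ^ 'm \<Rightarrow> real"
    and F :: "real \<Rightarrow> real ^ 'm \<Rightarrow> real"
    and D :: "(real ^ 'm) set"
    and \<Omega> :: "(real \<times> real \<times> (real ^ 'm)) set"
    and n :: nat
    and a :: "real ^ 'm \<Rightarrow> real"
    and b :: "nat \<Rightarrow> real ^ 'm \<Rightarrow> real"
  assumes "compact D"
    and "open \<Omega>" and "\<And>\<delta>. \<delta> \<in> D \<Longrightarrow> (0, 0, \<delta>) \<in> \<Omega>"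
    and "real_analytic_on (\<lambda>(x, y, \<delta>). X x y \<delta>) \<Omega>"
    and "real_analytic_on (\<lambda>(x, y, \<delta>). Y x y \<delta>) \<Omega>"
    and "\<exists>C r. 0 < r \<and> (\<forall>\<delta>\<in>D. \<forall>x y. norm (x, y) < r \<longrightarrow>
           \<bar>X x y \<delta>\<bar> \<le> C * norm (x, y) ^ 2 \<and> \<bar>Y x y \<delta>\<bar> \<le> C * norm (x, y) ^ 2)"
    and "implicit_solution X \<Omega> D F"
    and "n \<ge> 2"
    and "\<And>\<delta>. \<delta> \<in> D \<Longrightarrow>
           (\<lambda>x. g_fun Y F x \<delta> / x ^ (2 * n - 1) - a \<delta>) \<in> O[at 0](\<lambda>x. x)"
    and "\<And>\<delta>. \<delta> \<in> D \<Longrightarrow> a \<delta> > 0"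
    and "\<And>\<delta>. \<delta> \<in> D \<Longrightarrow> \<forall>\<^sub>F x in nhds 0.
           (\<lambda>k. b (n - 1 + k) \<delta> * x ^ (n - 1 + k)) sums f_fun X Y F x \<delta>"
    and "\<And>\<delta>. \<delta> \<in> D \<Longrightarrow> (b (n - 1) \<delta>) ^ 2 - 4 * real n * a \<delta> < 0"
  shows "\<exists>(Pbar :: real \<Rightarrow> real ^ 'm \<Rightarrow> real) \<rho> \<epsilon>.
     (\<forall>\<delta>\<in>D. \<forall>x0. 0 < \<bar>x0\<bar> \<and> \<bar>x0\<bar> < \<epsilon> \<longrightarrow> (\<exists>!p. first_return X Y \<Omega> F \<delta> x0 p)) \<and>
     0 < \<epsilon> \<and>
     (\<forall>\<delta>\<in>D. analytic_return n (\<lambda>x. return_map X Y \<Omega> F x \<delta>) \<rho> \<epsilon> (\<lambda>x. Pbar x \<delta>)) \<and>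
     (\<forall>\<delta>\<in>D. \<forall>q \<rho>' \<epsilon>'. analytic_return n (\<lambda>x. return_map X Y \<Omega> F x \<delta>) \<rho>' \<epsilon>' q \<longrightarrow>
        (\<forall>\<^sub>F x in nhds 0. q x = Pbar x \<delta>)) \<and>
     (\<forall>\<kappa>>0. \<exists>\<eta> U. 0 < \<eta> \<and> \<eta> < \<kappa> \<and> open U \<and> (0, 0) \<in> U \<and> U \<subseteq> ball (0, 0) \<kappa> \<and>
        (\<forall>\<delta>\<in>D.
           (\<exists>z. is_periodic_solution X Y \<Omega> \<delta> z \<and> range z \<subseteq> U) \<longleftrightarrow>
           (\<exists>x1 x2. 0 < x1 \<and> x1 < \<eta> \<and> - \<eta> < x2 \<and> x2 < 0 \<and>
              Pbar x1 \<delta> - x1 = 0 \<and> Pbar x2 \<delta> - x2 = 0)))"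
proof -
  note D = assms(1)
  obtain \<rho>X XC where X: "0 < \<rho>X"
    "\<And>\<delta>. \<delta> \<in> D \<Longrightarrow> bihol \<rho>X (\<lambda>x y. XC x y \<delta>)"
    "\<And>\<delta> x y. \<delta> \<in> D \<Longrightarrow> \<bar>x\<bar> < \<rho>X \<Longrightarrow> \<bar>y\<bar> < \<rho>X \<Longrightarrow> (x, y, \<delta>) \<in> \<Omega>"
    "\<And>\<delta> x y. \<delta> \<in> D \<Longrightarrow> \<bar>x\<bar> < \<rho>X \<Longrightarrow> \<bar>y\<bar> < \<rho>X \<Longrightarrow>
       XC (of_real x) (of_real y) \<delta> = complex_of_real (X x y \<delta>)"
    "continuous_on (ball 0 \<rho>X \<times> ball 0 \<rho>X \<times> D) (\<lambda>(x, y, \<delta>). XC x y \<delta>)"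
    by (rule real_analytic_complexify[OF assms(4,2,1,3)], assumption, rule that; assumption)
  obtain \<rho>Y YC where Y: "0 < \<rho>Y"
    "\<And>\<delta>. \<delta> \<in> D \<Longrightarrow> bihol \<rho>Y (\<lambda>x y. YC x y \<delta>)"
    "\<And>\<delta> x y. \<delta> \<in> D \<Longrightarrow> \<bar>x\<bar> < \<rho>Y \<Longrightarrow> \<bar>y\<bar> < \<rho>Y \<Longrightarrow> (x, y, \<delta>) \<in> \<Omega>"
    "\<And>\<delta> x y. \<delta> \<in> D \<Longrightarrow> \<bar>x\<bar> < \<rho>Y \<Longrightarrow> \<bar>y\<bar> < \<rho>Y \<Longrightarrow>
       YC (of_real x) (of_real y) \<delta> = complex_of_real (Y x y \<delta>)"
    "continuous_on (ball 0 \<rho>Y \<times> ball 0 \<rho>Y \<times> D) (\<lambda>(x, y, \<delta>). YC x y \<delta>)"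
    by (rule real_analytic_complexify[OF assms(5,2,1,3)], assumption, rule that; assumption)
  define \<rho> where "\<rho> = min \<rho>X \<rho>Y"
  have \<rho>: "0 < \<rho>" "\<rho> \<le> \<rho>X" "\<rho> \<le> \<rho>Y" using X(1) Y(1) by (auto simp: \<rho>_def)
  have bX: "bihol \<rho> (\<lambda>x y. XC x y \<delta>)" and bY: "bihol \<rho> (\<lambda>x y. YC x y \<delta>)" if "\<delta> \<in> D" for \<delta>
    using bihol_mono[OF X(2)[OF that] \<rho>(2)] bihol_mono[OF Y(2)[OF that] \<rho>(3)] .
  have sub: "ball 0 \<rho> \<times> ball 0 \<rho> \<times> D \<subseteq> ball (0::complex) r \<times> ball (0::complex) r \<times> D" if "\<rho> \<le> r" for r
    using subset_ball[OF that, of "0::complex"] by (intro Sigma_mono) auto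
  have cX: "continuous_on (ball 0 \<rho> \<times> ball 0 \<rho> \<times> D) (\<lambda>(x, y, \<delta>). XC x y \<delta>)"
    and cY: "continuous_on (ball 0 \<rho> \<times> ball 0 \<rho> \<times> D) (\<lambda>(x, y, \<delta>). YC x y \<delta>)"
    by (rule continuous_on_subset[OF X(5) sub[OF \<rho>(2)]], rule continuous_on_subset[OF Y(5) sub[OF \<rho>(3)]])
  have rX: "XC (of_real x) (of_real y) \<delta> = of_real (X x y \<delta>)"
    and rY: "YC (of_real x) (of_real y) \<delta> = of_real (Y x y \<delta>)"
    and dom: "(x, y, \<delta>) \<in> \<Omega>" if "\<delta> \<in> D" "\<bar>x\<bar> < \<rho>" "\<bar>y\<bar> < \<rho>" for x y \<delta>
    using that \<rho> by (intro X(4) Y(4) X(3); linarith)+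
  obtain C r where r: "0 < r" and Cr: "\<And>\<delta> x y. \<delta> \<in> D \<Longrightarrow> norm (x, y) < r \<Longrightarrow>
      \<bar>X x y \<delta>\<bar> \<le> C * norm (x, y) ^ 2 \<and> \<bar>Y x y \<delta>\<bar> \<le> C * norm (x, y) ^ 2"
    using assms(6) by blast
  have X00: "X 0 0 \<delta> = 0" and Y00: "Y 0 0 \<delta> = 0" if "\<delta> \<in> D" for \<delta>
    using Cr[OF that, of 0 0] r by (simp_all add: zero_prod_def[symmetric])
  have XC00: "XC 0 0 \<delta> = 0" if "\<delta> \<in> D" for \<delta>
    using rX[OF that, of 0 0] \<rho>(1) X00[OF that] by simp
  \<comment> \<open>\<open>X(0, y)\<close> is bounded by \<open>C y^2\<close>, so its derivative at
    0 vanishes; this is what makes the implicit equation a contraction near the origin.\<close>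
  have dX: "deriv (\<lambda>y. XC 0 y \<delta>) 0 = 0" if \<delta>: "\<delta> \<in> D" for \<delta>
  proof -
    have "(\<lambda>y. XC 0 y \<delta>) holomorphic_on ball 0 \<rho>"
      using \<rho>(1) by (intro biholD[OF bX[OF \<delta>]] holomorphic_intros) auto
    then have "deriv (\<lambda>y. XC 0 y \<delta>) (of_real 0) = of_real (deriv (\<lambda>y. X 0 y \<delta>) 0)"
      by (rule real_deriv_of_holomorphic(2)) (use \<rho>(1) rX[OF \<delta>, of 0] in auto)
    also have "deriv (\<lambda>y. X 0 y \<delta>) 0 = 0"
      by (rule deriv_zero_of_quadratic_bound[OF r, of _ C]) (use Cr[OF \<delta>, of 0] in \<open>simp add: norm_Pair\<close>)
    finally show ?thesis by simp
  qed
  obtain s s1 G where s1: "0 < s1" "s1 \<le> s" "s < \<rho>" and hG: "hol_family D s1 (\<lambda>\<delta> x. G x \<delta>)"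
    and contr: "\<And>\<delta> x y y'. \<delta> \<in> D \<Longrightarrow> norm x \<le> s \<Longrightarrow> norm y \<le> s \<Longrightarrow> norm y' \<le> s \<Longrightarrow>
       norm (XC x y \<delta> - XC x y' \<delta>) \<le> 1/2 * norm (y - y')"
    and G: "\<And>\<delta> x. \<delta> \<in> D \<Longrightarrow> norm x < s1 \<Longrightarrow> norm (G x \<delta>) \<le> s \<and> G x \<delta> + XC x (G x \<delta>) \<delta> = 0"
    by (rule hol_implicit[OF D \<rho>(1) bX cX XC00 dX], assumption+, rule that; assumption)
  obtain r0 where r0: "0 < r0" and cF: "continuous_on ({-r0<..<r0} \<times> D) (\<lambda>(x, \<delta>). F x \<delta>)"
    and F0: "\<And>\<delta>. \<delta> \<in> D \<Longrightarrow> F 0 \<delta> = 0"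
    and Feq: "\<And>\<delta> x. \<delta> \<in> D \<Longrightarrow> x \<in> {-r0<..<r0} \<Longrightarrow> F x \<delta> + X x (F x \<delta>) \<delta> = 0"
    using assms(7) unfolding implicit_solution_def by blast
  have s: "0 < s" using s1 by linarith
  \<comment> \<open>Halving \<open>r0\<close> gives a compact interval on which the continuous
    \<open>F\<close> is uniformly close to its value 0 at \<open>x = 0\<close>.\<close>
  have F_near: "\<exists>d>0. d \<le> r0 / 2 \<and> (\<forall>\<delta>\<in>D. \<forall>x. \<bar>x\<bar> < d \<longrightarrow> \<bar>F x \<delta>\<bar> < e)" if e: "0 < e" for e
  proof -
    let ?K = "{-(r0/2)..r0/2}"
    have c: "continuous_on (?K \<times> D) (\<lambda>(x, \<delta>). F x \<delta>)"
      by (rule continuous_on_subset[OF cF]) (use r0 in auto)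
    have "0 \<in> ?K" using r0 by simp
    from continuous_on_uniform_near[OF c compact_Icc D this e]
    obtain d where d: "0 < d" "\<forall>x\<in>?K. \<forall>\<delta>\<in>D. dist x 0 < d \<longrightarrow>
        dist ((\<lambda>(x, \<delta>). F x \<delta>) (x, \<delta>)) ((\<lambda>(x, \<delta>). F x \<delta>) (0, \<delta>)) < e" by blast
    have "\<bar>F x \<delta>\<bar> < e" if "\<delta> \<in> D" "\<bar>x\<bar> < min d (r0/2)" for x \<delta>
    proof -
      have "x \<in> ?K" using that(2) unfolding atLeastAtMost_iff by linarith
      moreover have "dist x 0 < d" using that(2) by simp
      ultimately show ?thesis using d(2)[rule_format, of x \<delta>] that(1) F0[OF that(1)] by simp
    qed
    then show ?thesis using d(1) r0 by (intro exI[of _ "min d (r0/2)"]) auto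
  qed
  obtain d1 where d1: "0 < d1" "d1 \<le> r0 / 2" "\<And>\<delta> x. \<delta> \<in> D \<Longrightarrow> \<bar>x\<bar> < d1 \<Longrightarrow> \<bar>F x \<delta>\<bar> < s"
    using F_near[OF s] by blast
  \<comment> \<open>\<open>F\<close> and \<open>G\<close> are fixed points of the same contraction
    in the disc of radius \<open>s\<close>, so their distance is at most half of itself. The radius
    \<open>d1\<close> ensures that \<open>F\<close> lies in that disc.\<close>
  have GF: "G (of_real x) \<delta> = of_real (F x \<delta>)" if \<delta>: "\<delta> \<in> D" and x: "\<bar>x\<bar> < s1" "\<bar>x\<bar> < d1" for x \<delta>
  proof -
    have x': "\<bar>x\<bar> < \<rho>" "norm (complex_of_real x) \<le> s" "norm (complex_of_real x) < s1" "x \<in> {-r0<..<r0}"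
      using x s1 d1(2) r0 by auto
    have F: "\<bar>F x \<delta>\<bar> < \<rho>" "\<bar>F x \<delta>\<bar> \<le> s" using d1(3)[OF \<delta> x(2)] s1 by linarith+
    have "complex_of_real (F x \<delta> + X x (F x \<delta>) \<delta>) = 0" using Feq[OF \<delta> x'(4)] by simp
    then have e1: "of_real (F x \<delta>) + XC (of_real x) (of_real (F x \<delta>)) \<delta> = 0"
      using rX[OF \<delta> x'(1) F(1)] by simp
    have e2: "G (of_real x) \<delta> + XC (of_real x) (G (of_real x) \<delta>) \<delta> = 0"
      using G[OF \<delta> x'(3)] by blast
    have "G (of_real x) \<delta> - of_real (F x \<delta>) =
        XC (of_real x) (of_real (F x \<delta>)) \<delta> - XC (of_real x) (G (of_real x) \<delta>) \<delta>"
      using e1 e2 by algebra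
    then have "norm (G (of_real x) \<delta> - of_real (F x \<delta>)) =
        norm (XC (of_real x) (of_real (F x \<delta>)) \<delta> - XC (of_real x) (G (of_real x) \<delta>) \<delta>)"
      by (rule arg_cong)
    also have "\<dots> \<le> 1/2 * norm (of_real (F x \<delta>) - G (of_real x) \<delta>)"
      using G[OF \<delta> x'(3)] F(2) by (intro contr[OF \<delta> x'(2)]) auto
    finally show ?thesis by (simp add: norm_minus_commute)
  qed
  have G0: "G 0 \<delta> = 0" if "\<delta> \<in> D" for \<delta>
    using GF[OF that, of 0] s1 d1 F0[OF that] by simp
  obtain d2 where d2: "0 < d2" "d2 \<le> s1 / 2" "\<And>\<delta> x. \<delta> \<in> D \<Longrightarrow> norm x < d2 \<Longrightarrow> norm (G x \<delta>) \<le> s / 2"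
  proof -
    let ?K = "cball (0::complex) (s1/2)"
    have "continuous_on (?K \<times> D) ((\<lambda>(\<delta>, x). G x \<delta>) \<circ> (\<lambda>p. (snd p, fst p)))"
      by (intro continuous_on_compose continuous_intros continuous_on_subset[OF hol_family_cont[OF hG]])
        (use s1 in auto)
    then have c: "continuous_on (?K \<times> D) (\<lambda>(x, \<delta>). G x \<delta>)" by (simp add: o_def split_beta)
    have "0 \<in> ?K" "0 < s / 2" using s1 s by simp_all
    from continuous_on_uniform_near[OF c compact_cball D this]
    obtain d where d: "0 < d" "\<forall>x\<in>?K. \<forall>\<delta>\<in>D. dist x 0 < d \<longrightarrow>
        dist ((\<lambda>(x, \<delta>). G x \<delta>) (x, \<delta>)) ((\<lambda>(x, \<delta>). G x \<delta>) (0, \<delta>)) < s / 2" by blast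
    show ?thesis
    proof (rule that[of "min d (s1/2)"])
      show "norm (G x \<delta>) \<le> s / 2" if "\<delta> \<in> D" "norm x < min d (s1/2)" for x \<delta>
        using d(2)[rule_format, of x \<delta>] that G0[OF that(1)] by simp
    qed (use d s1 in auto)
  qed
  \<comment> \<open>\<open>s / 2\<close> leaves room for \<open>v\<close>, 1 makes higher powers of
    \<open>r\<close> smaller, \<open>d1\<close> gives the agreement of \<open>G\<close> with
    \<open>F\<close>, and \<open>d2\<close> gives the bound \<open>s / 2\<close> on \<open>G\<close>
    within its domain of holomorphy.\<close>
  define R where "R = min (min 1 (s / 2)) (min d1 d2)"
  have R: "0 < R" "R \<le> s / 2" "R \<le> 1" "R \<le> d1" "R \<le> d2" "R \<le> s1"
    using s s1 d1 d2 by (auto simp: R_def)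
  interpret complex_system X Y F D XC YC G \<rho> s R n a "b (n - 1)"
  proof unfold_locales
    show "hol_family D R (\<lambda>\<delta> x. G x \<delta>)" by (rule hol_family_subset[OF hG subset_refl R(6)])
    show "((\<lambda>x. g_fun Y F x \<delta> / x ^ (2 * n - 1)) \<longlongrightarrow> a \<delta>) (at 0)" if \<delta>: "\<delta> \<in> D" for \<delta>
    proof -
      obtain c where "\<forall>\<^sub>F x in at 0. norm (g_fun Y F x \<delta> / x ^ (2 * n - 1) - a \<delta>) \<le> c * norm x"
        using assms(9)[OF \<delta>] by (auto elim: landau_o.bigE)
      moreover have "((\<lambda>x. c * norm x) \<longlongrightarrow> 0) (at (0::real))" by (auto intro!: tendsto_eq_intros)
      ultimately have "((\<lambda>x. g_fun Y F x \<delta> / x ^ (2 * n - 1) - a \<delta>) \<longlongrightarrow> 0) (at 0)"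
        by (rule Lim_null_comparison)
      then show ?thesis by (simp add: LIM_zero_iff)
    qed
    show "((\<lambda>x. f_fun X Y F x \<delta> / x ^ (n - 1)) \<longlongrightarrow> b (n - 1) \<delta>) (at 0)" if "\<delta> \<in> D" for \<delta>
      using power_series_quotient_tendsto(1)[of "\<lambda>k. b k \<delta>", OF assms(11)[OF that]] .
    show "f_fun X Y F 0 \<delta> = 0" if "\<delta> \<in> D" for \<delta>
      using power_series_quotient_tendsto(2)[of "\<lambda>k. b k \<delta>", OF assms(11)[OF that]] assms(8) by simp
    show "norm (G x \<delta>) \<le> s / 2" "G x \<delta> + XC x (G x \<delta>) \<delta> = 0" if "\<delta> \<in> D" "norm x < R" for \<delta> x
      using d2(3)[OF that(1), of x] G[OF that(1), of x] that(2) R by auto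
    show "G (of_real x) \<delta> = of_real (F x \<delta>)" if "\<delta> \<in> D" "\<bar>x\<bar> < R" for \<delta> x
      using GF[OF that(1), of x] that(2) R by auto
  qed (use R s1 D bX bY cX cY rX rY F0 contr dX Y00 assms(8,10,12) in auto)
  obtain R1 M L L2 q W H u where R1: "0 < R1" "0 \<le> M"
    and PF: "\<And>\<delta>. \<delta> \<in> D \<Longrightarrow> polar_flow X Y \<Omega> F \<delta> n R1 s q M L L2 (\<lambda>\<phi> r. yr \<phi> \<delta> r) (\<lambda>\<phi> r. Ar \<phi> \<delta> r)
       (\<lambda>\<phi> r. Vr \<phi> \<delta> r) (W \<delta>) (H \<delta>) (\<lambda>\<phi> x. u \<phi> \<delta> x)"
    and ser: "\<And>\<delta>. \<delta> \<in> D \<Longrightarrow> \<exists>v. \<forall>x. \<bar>x\<bar> < R1 * exp (- (M * 7)) \<longrightarrow>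
        (\<lambda>j. v (Suc j) * x ^ Suc j) sums (x * exp (u (2 * pi) \<delta> x) - x)"
    and der: "\<And>\<delta>. \<delta> \<in> D \<Longrightarrow>
        ((\<lambda>x. x * exp (u (2 * pi) \<delta> x)) has_real_derivative exp (u (2 * pi) \<delta> 0)) (at 0)"
    using polar_flow_exists[OF dom] by blast
  define Pbar where "Pbar = (\<lambda>x \<delta>. x * exp (u (2 * pi) \<delta> x))"
  \<comment> \<open>These repeat the radii of \<open>polar_flow\<close> outside any interpretation,
    which makes their independence of \<delta> visible.\<close>
  define \<rho>1 where "\<rho>1 = R1 * exp (- (M * 7)) * exp (- (M * 7))"
  define \<epsilon> where "\<epsilon> = \<rho>1 * exp (- (M * 7))"
  have \<epsilon>: "0 < \<epsilon>" "\<epsilon> \<le> \<rho>1" "0 < \<rho>1"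
    using R1 by (auto simp: \<epsilon>_def \<rho>1_def intro!: mult_left_le)
  have ret: "\<exists>!p. first_return X Y \<Omega> F \<delta> x p" if \<delta>: "\<delta> \<in> D" and x: "0 < \<bar>x\<bar>" "\<bar>x\<bar> < \<epsilon>" for \<delta> x
  proof -
    interpret P: polar_flow X Y \<Omega> F \<delta> n R1 s q M L L2 "\<lambda>\<phi> r. yr \<phi> \<delta> r" "\<lambda>\<phi> r. Ar \<phi> \<delta> r"
       "\<lambda>\<phi> r. Vr \<phi> \<delta> r" "W \<delta>" "H \<delta>" "\<lambda>\<phi> x. u \<phi> \<delta> x" by (rule PF[OF \<delta>])
    have "\<bar>x\<bar> < P.\<rho>0"
      using x(2) \<epsilon>(2) P.\<rho>_pos(2) unfolding P.\<rho>1_def P.\<rho>0_def \<rho>1_def by linarith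
    then show ?thesis using P.first_return_unique[of x] x(1) by auto
  qed
  have ana: "analytic_return n (\<lambda>x. return_map X Y \<Omega> F x \<delta>) \<rho>1 \<epsilon> (\<lambda>x. Pbar x \<delta>)" if \<delta>: "\<delta> \<in> D" for \<delta>
  proof -
    interpret P: polar_flow X Y \<Omega> F \<delta> n R1 s q M L L2 "\<lambda>\<phi> r. yr \<phi> \<delta> r" "\<lambda>\<phi> r. Ar \<phi> \<delta> r"
       "\<lambda>\<phi> r. Vr \<phi> \<delta> r" "W \<delta>" "H \<delta>" "\<lambda>\<phi> x. u \<phi> \<delta> x" by (rule PF[OF \<delta>])
    obtain v where v: "\<And>x. \<bar>x\<bar> < R1 * exp (- (M * 7)) \<Longrightarrow>
        (\<lambda>j. v (Suc j) * x ^ Suc j) sums (x * exp (u (2 * pi) \<delta> x) - x)"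
      using ser[OF \<delta>] by blast
    have "analytic_return n (\<lambda>x. return_map X Y \<Omega> F x \<delta>) P.\<rho>1 (P.\<rho>1 * exp (- (M * 7))) (\<lambda>x. P.rr (2 * pi) x)"
      by (rule P.analytic_return_rr) (use v der[OF \<delta>] in \<open>simp_all only: P.rr_def P.\<rho>0_def\<close>)
    then show ?thesis
      by (simp only: P.rr_def P.\<rho>1_def P.\<rho>0_def Pbar_def \<epsilon>_def \<rho>1_def)
  qed
  have per: "\<exists>\<eta> U. 0 < \<eta> \<and> \<eta> < \<kappa> \<and> open U \<and> (0, 0) \<in> U \<and> U \<subseteq> ball (0, 0) \<kappa> \<and>
        (\<forall>\<delta>\<in>D. (\<exists>z. is_periodic_solution X Y \<Omega> \<delta> z \<and> range z \<subseteq> U) \<longleftrightarrow>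
           (\<exists>x1 x2. 0 < x1 \<and> x1 < \<eta> \<and> - \<eta> < x2 \<and> x2 < 0 \<and>
              Pbar x1 \<delta> - x1 = 0 \<and> Pbar x2 \<delta> - x2 = 0))" if \<kappa>: "0 < \<kappa>" for \<kappa>
  proof -
    \<comment> \<open>Half-widths \<open>\<eta> \<le> \<kappa> / 4\<close> and
      \<open>k \<le> \<kappa> / 2\<close> put the box into the ball of radius \<kappa>;
      \<open>k \<le> s\<close> keeps it where \<open>field_sign\<close> applies.\<close>
    define k where "k = min (\<kappa> / 2) s"
    have k: "0 < k" "k \<le> \<kappa> / 2" "k \<le> s" using \<kappa> s by (auto simp: k_def)
    obtain d where d: "0 < d" "\<And>\<delta> x. \<delta> \<in> D \<Longrightarrow> \<bar>x\<bar> < d \<Longrightarrow> \<bar>F x \<delta>\<bar> < k / 2"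
      using F_near[OF half_gt_zero[OF k(1)]] by blast
    \<comment> \<open>\<open>\<rho>1\<close> admits full turns in both directions, \<open>d\<close>
      bounds \<open>F\<close> by \<open>k / 2\<close>, and the exponential factor bounds
      \<open>r\<close> along the curves by \<open>k / 2\<close>.\<close>
    define \<eta> where "\<eta> = min (min (\<kappa> / 4) \<rho>1) (min d (k / 2 * exp (- (M * 7))))"
    have \<eta>: "0 < \<eta>" "\<eta> \<le> \<kappa> / 4" "\<eta> \<le> \<rho>1" "\<eta> \<le> d" "\<eta> \<le> k / 2 * exp (- (M * 7))"
      using \<kappa> \<epsilon> d k by (auto simp: \<eta>_def)
    have "\<eta> * exp (M * 7) \<le> k / 2 * exp (- (M * 7)) * exp (M * 7)"
      using \<eta>(5) by (rule mult_right_mono) simp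
    also have "k / 2 * exp (- (M * 7)) * exp (M * 7) = k / 2" by (simp add: exp_minus)
    finally have \<eta>k: "\<eta> * exp (M * 7) \<le> k / 2" .
    let ?U = "{-\<eta><..<\<eta>} \<times> {-k<..<k}"
    have "open ?U" by (intro open_Times open_greaterThanLessThan)
    moreover have "(0, 0) \<in> ?U" using \<eta> k by simp
    moreover have "?U \<subseteq> ball (0, 0) \<kappa>"
    proof
      fix p assume "p \<in> ?U"
      then have "\<bar>fst p\<bar> < \<eta>" "\<bar>snd p\<bar> < k" by auto
      then have "norm (fst p, snd p) < \<kappa>"
        using norm_Pair_le[of "fst p" "snd p"] \<eta>(2) k(2) \<kappa> by simp
      then show "p \<in> ball (0, 0) \<kappa>" by (simp add: zero_prod_def[symmetric])
    qed
    moreover have "(\<exists>z. is_periodic_solution X Y \<Omega> \<delta> z \<and> range z \<subseteq> ?U) \<longleftrightarrow>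
           (\<exists>x1 x2. 0 < x1 \<and> x1 < \<eta> \<and> - \<eta> < x2 \<and> x2 < 0 \<and>
              Pbar x1 \<delta> - x1 = 0 \<and> Pbar x2 \<delta> - x2 = 0)" if \<delta>: "\<delta> \<in> D" for \<delta>
    proof -
      interpret P: polar_flow X Y \<Omega> F \<delta> n R1 s q M L L2 "\<lambda>\<phi> r. yr \<phi> \<delta> r" "\<lambda>\<phi> r. Ar \<phi> \<delta> r"
         "\<lambda>\<phi> r. Vr \<phi> \<delta> r" "W \<delta>" "H \<delta>" "\<lambda>\<phi> x. u \<phi> \<delta> x" by (rule PF[OF \<delta>])
      have "\<eta> \<le> P.\<rho>1" using \<eta>(3) by (simp only: P.\<rho>1_def P.\<rho>0_def \<rho>1_def)
      from P.periodic_iff[OF \<eta>(1) this k(3) _ \<eta>k] show ?thesis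
        using d(2)[OF \<delta>] \<eta>(4) by (simp only: P.rr_def Pbar_def)
    qed
    ultimately show ?thesis
      using \<eta>(1,2) \<kappa> by (intro exI[of _ \<eta>] exI[of _ ?U]) auto
  qed
  show ?thesis
  proof (rule exI[of _ Pbar], rule exI[of _ \<rho>1], rule exI[of _ \<epsilon>], intro conjI ballI allI impI)
    show "\<exists>!p. first_return X Y \<Omega> F \<delta> x0 p" if "\<delta> \<in> D" "0 < \<bar>x0\<bar> \<and> \<bar>x0\<bar> < \<epsilon>" for \<delta> x0
      using ret that by blast
    show "\<forall>\<^sub>F x in nhds 0. q x = Pbar x \<delta>"
      if "\<delta> \<in> D" "analytic_return n (\<lambda>x. return_map X Y \<Omega> F x \<delta>) \<rho>' \<epsilon>' q" for \<delta> q \<rho>' \<epsilon>'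
      by (rule analytic_return_eventually_unique[OF that(2) ana[OF that(1)]])
  qed (use \<epsilon> ana per in auto)
qed

end
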